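(* Let $p\in(2,6)$ and $\mu>0$. For $\ell>0$ let $\mathcal G_\ell$ be the metric graph consisting of three halflines and one bounded terminal edge of length $\ell$, all emanating from a common vertex. Then there exists a critical length $\ell^*>0$ such that $\mathcal G_\ell$ has a ground state of mass $\mu$ if and only if $\ell\ge\ell^*$.
   Context: $H^1_\mu(\mathcal G)$: continuous functions on $\mathcal G$, $H^1$ on each edge, with $\int_{\mathcal G}|u|^2=\mu$. $E(u,\mathcal G)=\frac12\int_{\mathcal G}|u'|^2-\frac1p\int_{\mathcal G}|u|^p$; a ground state of mass $\mu$ is a minimizer of $E(\cdot,\mathcal G)$ on $H^1_\mu(\mathcal G)$. *)

theory Defs
  imports "HOL-Analysis.Analysis"
begin

definition test_fun_on :: "real set \<Rightarrow> (real \<Rightarrow> real) \<Rightarrow> (real \<Rightarrow> real) \<Rightarrow> bool" where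
  "test_fun_on I \<phi> \<phi>' \<longleftrightarrow>
     (\<forall>x. (\<phi> has_real_derivative \<phi>' x) (at x)) \<and> continuous_on UNIV \<phi>' \<and>
     (\<exists>K. compact K \<and> K \<subseteq> interior I \<and> (\<forall>x. x \<notin> K \<longrightarrow> \<phi> x = 0))"

definition has_weak_deriv_on :: "(real \<Rightarrow> real) \<Rightarrow> (real \<Rightarrow> real) \<Rightarrow> real set \<Rightarrow> bool" where
  "has_weak_deriv_on u g I \<longleftrightarrow>
     (\<forall>\<phi> \<phi>'. test_fun_on I \<phi> \<phi>' \<longrightarrow>
        (LINT x:I|lborel. u x * \<phi>' x) = - (LINT x:I|lborel. g x * \<phi> x))"

definition L2_on :: "real set \<Rightarrow> (real \<Rightarrow> real) \<Rightarrow> bool" where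
  "L2_on I f \<longleftrightarrow> set_borel_measurable lborel I f \<and> set_integrable lborel I (\<lambda>x. (f x)\<^sup>2)"

definition H1_on :: "real set \<Rightarrow> (real \<Rightarrow> real) \<Rightarrow> bool" where
  "H1_on I u \<longleftrightarrow> L2_on I u \<and> (\<exists>g. L2_on I g \<and> has_weak_deriv_on u g I)"

definition weak_deriv :: "real set \<Rightarrow> (real \<Rightarrow> real) \<Rightarrow> (real \<Rightarrow> real)" where
  "weak_deriv I u = (SOME g. L2_on I g \<and> has_weak_deriv_on u g I)"

text \<open>The metric graph G_l: edges 0,1,2 are halflines [0,\<infinity>), edge 3 is the terminal
edge [0,l]; all edges emanate from the common vertex at coordinate 0.
A function on G_l is represented by u :: nat \<Rightarrow> real \<Rightarrow> real, u i being its restriction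
to edge i (i < 4).\<close>
definition edge_dom :: "real \<Rightarrow> nat \<Rightarrow> real set" where
  "edge_dom l i = (if i < 3 then {0..} else {0..l})"

definition H1_mass :: "real \<Rightarrow> real \<Rightarrow> (nat \<Rightarrow> real \<Rightarrow> real) set" where
  "H1_mass l \<mu> = {u. (\<forall>i<4. continuous_on (edge_dom l i) (u i) \<and> H1_on (edge_dom l i) (u i)
                        \<and> u i 0 = u 0 0)
                  \<and> (\<Sum>i<4. LINT x:edge_dom l i|lborel. (u i x)\<^sup>2) = \<mu>}"

definition energy :: "real \<Rightarrow> real \<Rightarrow> (nat \<Rightarrow> real \<Rightarrow> real) \<Rightarrow> real" where
  "energy p l u =
     (1/2) * (\<Sum>i<4. LINT x:edge_dom l i|lborel. (weak_deriv (edge_dom l i) (u i) x)\<^sup>2)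
     - (1/p) * (\<Sum>i<4. LINT x:edge_dom l i|lborel. \<bar>u i x\<bar> powr p)"

definition ground_state :: "real \<Rightarrow> real \<Rightarrow> real \<Rightarrow> (nat \<Rightarrow> real \<Rightarrow> real) \<Rightarrow> bool" where
  "ground_state p l \<mu> u \<longleftrightarrow> u \<in> H1_mass l \<mu> \<and> (\<forall>v\<in>H1_mass l \<mu>. energy p l u \<le> energy p l v)"

end

theory Submission
  imports Defs "HOL-Complex_Analysis.Great_Picard"
begin

text \<open>
  A function on the graph is compared with its decreasing rearrangement \<open>f\<close> on \<open>[0,\<infinity>)\<close>. If
  almost every level in a band has at least \<open>n\<close> preimages, the kinetic energy carried by the band
  is at least \<open>n\<^sup>2\<close> times that of \<open>f\<close>. Levels below the vertex value have three preimages.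
  If the maximum lies on a halfline, all levels have two, so the energy is at least the ground
  state energy \<open>e\<close> of the line, strictly if the vertex value is nonzero; a ground state that
  vanishes at the vertex can be improved by stretching it next to a zero. If the maximum lies on the
  terminal edge, the energy is at least that of \<open>f\<close> for the halfline functional with weight 1 on
  \<open>[0,l]\<close> and 9 on \<open>[l,\<infinity>)\<close>, and conversely every decreasing \<open>f\<close> is realized on the graph by
  folding its tail onto the three halflines.

  Truncated line profiles fit on a single halfline, so the infimum on the graph never exceeds \<open>e\<close>.
  Hence a ground state exists iff the minimum \<open>J(l)\<close> of the weighted functional is at most \<open>e\<close>.
  The function \<open>J\<close> is nonincreasing and, by dilation of profiles, right continuous; it exceeds \<open>e\<close>
  for small \<open>l\<close> and is below \<open>e\<close> for large \<open>l\<close>.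
\<close>

section \<open>Integration over subsets of the line\<close>

lemma is_interval_sets_lborel:
  fixes I :: "real set"
  assumes "is_interval I"
  shows "I \<in> sets lborel"
  using assms by (simp add: is_interval_convex_1 real_interval_borel_measurable)

lemma is_interval_Icc_subset:
  fixes I :: "real set"
  assumes "is_interval I" "x \<in> I" "y \<in> I"
  shows "{x..y} \<subseteq> I"
  using assms by (meson atLeastAtMost_iff is_interval_1 subsetI)

lemma emeasure_lborel_Icc_finite: "emeasure lborel {x..y::real} < \<infinity>"
  by (cases "x \<le> y") auto

lemma set_integrable_const:
  fixes c :: real
  assumes "A \<in> sets M" "emeasure M A < \<infinity>"
  shows "set_integrable M A (\<lambda>x. c)"
  using assms unfolding set_integrable_def
  by (intro integrable_scaleR_left integrable_real_indicator) (auto simp: less_top)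

lemma set_integrable_const_Icc: "set_integrable lborel {x..y::real} (\<lambda>t. c :: real)"
  by (rule set_integrable_const[OF _ emeasure_lborel_Icc_finite]) simp

lemma set_integral_nonneg:
  fixes f :: "'a \<Rightarrow> real"
  assumes "\<And>x. x \<in> A \<Longrightarrow> 0 \<le> f x"
  shows "0 \<le> (LINT x:A|M. f x)"
  unfolding set_lebesgue_integral_def using assms
  by (intro integral_nonneg_AE AE_I2) (auto split: split_indicator)

lemma set_integral_mono_set:
  fixes f :: "'a \<Rightarrow> real"
  assumes "set_integrable M B f" "A \<in> sets M" "A \<subseteq> B" "\<And>x. x \<in> B \<Longrightarrow> 0 \<le> f x"
  shows "(LINT x:A|M. f x) \<le> (LINT x:B|M. f x)"
  using assms set_integrable_subset[OF assms(1-3)]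
  unfolding set_lebesgue_integral_def set_integrable_def
  by (intro integral_mono) (auto split: split_indicator)

lemma const_mult_length_le_set_integral:
  fixes f :: "real \<Rightarrow> real"
  assumes "set_integrable lborel {a..b} f" "a \<le> b" "\<And>x. x \<in> {a..b} \<Longrightarrow> c \<le> f x"
  shows "(b - a) * c \<le> (LINT x:{a..b}|lborel. f x)"
  using set_integral_mono[OF set_integrable_const_Icc assms(1,3)] assms(2)
  by (simp add: set_integral_const)

lemma set_integral_le_const_mult_length:
  fixes f :: "real \<Rightarrow> real"
  assumes "set_integrable lborel {a..b} f" "a \<le> b" "\<And>x. x \<in> {a..b} \<Longrightarrow> f x \<le> c"
  shows "(LINT x:{a..b}|lborel. f x) \<le> (b - a) * c"
  using set_integral_mono[OF assms(1) set_integrable_const_Icc assms(3)] assms(2)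
  by (simp add: set_integral_const)

lemma set_integral_Un_point:
  fixes f :: "real \<Rightarrow> real"
  assumes "set_integrable lborel (A \<union> B) f" "A \<in> sets lborel" "B \<in> sets lborel" "A \<inter> B \<subseteq> {c}"
  shows "(LINT x:A \<union> B|lborel. f x) = (LINT x:A|lborel. f x) + (LINT x:B|lborel. f x)"
proof (rule set_integral_Un_AE)
  show "AE x in lborel. \<not> (x \<in> A \<and> x \<in> B)"
    using AE_lborel_singleton[of c] by eventually_elim (use assms(4) in auto)
  show "set_integrable lborel A f" "set_integrable lborel B f"
    using assms(2,3) by (auto intro: set_integrable_subset[OF assms(1)])
qed (use assms in simp_all)

lemma set_integral_Icc_split:
  fixes f :: "real \<Rightarrow> real"
  assumes "set_integrable lborel {a..c} f" "a \<le> b" "b \<le> c"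
  shows "(LINT x:{a..c}|lborel. f x) = (LINT x:{a..b}|lborel. f x) + (LINT x:{b..c}|lborel. f x)"
  using set_integral_Un_point[of "{a..b}" "{b..c}" f b] assms by (simp add: ivl_disj_un_two_touch)

lemma set_integral_Ici_split:
  fixes f :: "real \<Rightarrow> real"
  assumes "set_integrable lborel {a..} f" "a \<le> b"
  shows "(LINT x:{a..}|lborel. f x) = (LINT x:{a..b}|lborel. f x) + (LINT x:{b..}|lborel. f x)"
proof -
  have "{a..b} \<union> {b..} = {a..}" using assms(2) by auto
  then show ?thesis
    using set_integral_Un_point[of "{a..b}" "{b..}" f b] assms by (simp add: Int_atLeastAtMostL2)
qed

lemma set_integral_cong_except_point:
  fixes f h :: "real \<Rightarrow> real"
  assumes "\<And>x. x \<in> A \<Longrightarrow> x \<noteq> c \<Longrightarrow> f x = h x"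
  shows "(LINT x:A|lborel. f x) = (LINT x:A|lborel. h x)"
    and "set_integrable lborel A f \<longleftrightarrow> set_integrable lborel A h"
proof -
  have indicator_eq: "indicator A x *\<^sub>R f x = indicator A x *\<^sub>R h x" if "x \<notin> {c}" for x
    using assms[of x] that by (auto split: split_indicator)
  show "(LINT x:A|lborel. f x) = (LINT x:A|lborel. h x)"
    unfolding set_lebesgue_integral_def
    by (rule integral_discrete_difference[of "{c}"]) (use indicator_eq in auto)
  show "set_integrable lborel A f \<longleftrightarrow> set_integrable lborel A h"
    unfolding set_integrable_def
    by (rule integrable_discrete_difference[of "{c}"]) (use indicator_eq in auto)
qed

lemma set_integral_Ici_If:
  fixes \<phi> \<psi> :: "real \<Rightarrow> real"
  assumes "set_integrable lborel {a..c} \<phi>" "set_integrable lborel {c..} \<psi>" and ac: "a \<le> c"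
  shows "(LINT x:{a..}|lborel. if x \<le> c then \<phi> x else \<psi> x)
    = (LINT x:{a..c}|lborel. \<phi> x) + (LINT x:{c..}|lborel. \<psi> x)"
proof -
  let ?F = "\<lambda>x. if x \<le> c then \<phi> x else \<psi> x"
  have left: "set_integrable lborel {a..c} ?F"
      "(LINT x:{a..c}|lborel. ?F x) = (LINT x:{a..c}|lborel. \<phi> x)"
    using set_integral_cong_except_point[of "{a..c}" c ?F \<phi>] assms(1) by simp_all
  have right: "set_integrable lborel {c..} ?F" "(LINT x:{c..}|lborel. ?F x) = (LINT x:{c..}|lborel. \<psi> x)"
    using set_integral_cong_except_point[of "{c..}" c ?F \<psi>] assms(2) by simp_all
  have "{a..c} \<union> {c..} = {a..}" using ac by auto
  then have "set_integrable lborel {a..} ?F" using set_integrable_Un[OF left(1) right(1)] by simp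
  from set_integral_Ici_split[OF this ac] show ?thesis using left(2) right(2) by simp
qed

lemma set_integral_affine:
  fixes f :: "real \<Rightarrow> real"
  assumes "b \<noteq> 0"
  shows "(LINT x:{x. a + b * x \<in> A}|lborel. f (a + b * x)) = (LINT x:A|lborel. f x) / \<bar>b\<bar>"
    and "set_integrable lborel {x. a + b * x \<in> A} (\<lambda>x. f (a + b * x)) \<longleftrightarrow> set_integrable lborel A f"
proof -
  have ind: "indicator {x. a + b * x \<in> A} x = (indicator A (a + b * x) :: real)" for x
    by (auto split: split_indicator)
  show "(LINT x:{x. a + b * x \<in> A}|lborel. f (a + b * x)) = (LINT x:A|lborel. f x) / \<bar>b\<bar>"
    using lborel_integral_real_affine[OF assms, of "\<lambda>x. indicator A x *\<^sub>R f x" a] assms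
    by (simp add: set_lebesgue_integral_def ind)
  show "set_integrable lborel {x. a + b * x \<in> A} (\<lambda>x. f (a + b * x)) \<longleftrightarrow> set_integrable lborel A f"
    using lborel_integrable_real_affine_iff[OF assms, of "\<lambda>x. indicator A x *\<^sub>R f x" a]
    by (simp add: set_integrable_def ind)
qed

lemma set_integral_Ici_tail_tendsto_0:
  fixes f :: "real \<Rightarrow> real"
  assumes f: "set_integrable lborel {a..} f"
  shows "((\<lambda>b. LINT x:{b..}|lborel. f x) \<longlongrightarrow> 0) at_top"
proof -
  have "((\<lambda>b. LINT x:{a..b}|lborel. f x) \<longlongrightarrow> (LINT x:{a..}|lborel. f x)) at_top"
    using f by (intro tendsto_set_lebesgue_integral_at_top) auto
  then have "((\<lambda>b. (LINT x:{a..}|lborel. f x) - (LINT x:{a..b}|lborel. f x)) \<longlongrightarrow> 0) at_top"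
    by (rule tendsto_eq_rhs[OF tendsto_diff[OF tendsto_const]]) simp
  then show ?thesis
    by (rule Lim_transform_eventually)
      (use eventually_ge_at_top[of a] in eventually_elim, simp add: set_integral_Ici_split[OF f])
qed

lemma integral_Cauchy_Schwarz:
  fixes f g :: "'a \<Rightarrow> real"
  assumes [measurable]: "f \<in> borel_measurable M" "g \<in> borel_measurable M"
    and sq: "integrable M (\<lambda>x. (f x)\<^sup>2)" "integrable M (\<lambda>x. (g x)\<^sup>2)"
  shows "integrable M (\<lambda>x. f x * g x)"
    and "(\<integral>x. f x * g x \<partial>M)\<^sup>2 \<le> (\<integral>x. (f x)\<^sup>2 \<partial>M) * (\<integral>x. (g x)\<^sup>2 \<partial>M)"
proof -
  have abs_mult_le: "\<bar>a * b\<bar> \<le> a\<^sup>2 + b\<^sup>2" for a b :: real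
    using zero_le_power2[of "a + b"] zero_le_power2[of "a - b"] zero_le_power2[of a] zero_le_power2[of b]
    by (simp add: power2_sum power2_diff abs_le_iff)
  show prod: "integrable M (\<lambda>x. f x * g x)"
    by (rule Bochner_Integration.integrable_bound[OF Bochner_Integration.integrable_add[OF sq]])
      (use abs_mult_le in auto)
  have nn_integral_sq: "(\<integral>\<^sup>+x. ennreal \<bar>h x\<bar> ^ 2 \<partial>M) = ennreal (\<integral>x. (h x)\<^sup>2 \<partial>M)"
    if "integrable M (\<lambda>x. (h x)\<^sup>2)"
    for h :: "'a \<Rightarrow> real"
    using that by (simp add: ennreal_power nn_integral_eq_integral)
  have "(\<integral>\<^sup>+x. ennreal \<bar>f x\<bar> * ennreal \<bar>g x\<bar> \<partial>M) = ennreal (\<integral>x. \<bar>f x * g x\<bar> \<partial>M)"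
    using nn_integral_eq_integral[OF integrable_abs[OF prod]]
    by (simp add: abs_mult flip: ennreal_mult)
  then have "ennreal ((\<integral>x. \<bar>f x * g x\<bar> \<partial>M)\<^sup>2) = (\<integral>\<^sup>+x. ennreal \<bar>f x\<bar> * ennreal \<bar>g x\<bar> \<partial>M)\<^sup>2"
    by (simp add: ennreal_power)
  also have "\<dots> \<le> ennreal ((\<integral>x. (f x)\<^sup>2 \<partial>M) * (\<integral>x. (g x)\<^sup>2 \<partial>M))"
    using Cauchy_Schwarz_nn_integral[of "\<lambda>x. ennreal \<bar>f x\<bar>" M "\<lambda>x. ennreal \<bar>g x\<bar>"]
    by (simp add: nn_integral_sq sq ennreal_mult)
  finally have "(\<integral>x. \<bar>f x * g x\<bar> \<partial>M)\<^sup>2 \<le> (\<integral>x. (f x)\<^sup>2 \<partial>M) * (\<integral>x. (g x)\<^sup>2 \<partial>M)"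
    by (simp add: ennreal_le_iff)
  moreover have "\<bar>\<integral>x. f x * g x \<partial>M\<bar>\<^sup>2 \<le> (\<integral>x. \<bar>f x * g x\<bar> \<partial>M)\<^sup>2"
    by (intro power_mono integral_abs_bound) simp
  ultimately show "(\<integral>x. f x * g x \<partial>M)\<^sup>2 \<le> (\<integral>x. (f x)\<^sup>2 \<partial>M) * (\<integral>x. (g x)\<^sup>2 \<partial>M)" by simp
qed

section \<open>Square-integrable functions on subsets of the line\<close>

abbreviation sqnorm :: "real set \<Rightarrow> (real \<Rightarrow> real) \<Rightarrow> real" where
  "sqnorm A f \<equiv> LINT x:A|lborel. (f x)\<^sup>2"

lemma sqnorm_nonneg [simp]: "0 \<le> sqnorm A f"
  by (rule set_integral_nonneg) simp

lemma L2_onD: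
  assumes "L2_on A f"
  shows "(\<lambda>x. indicator A x * f x) \<in> borel_measurable borel" "set_integrable lborel A (\<lambda>x. (f x)\<^sup>2)"
  using assms by (auto simp: L2_on_def set_borel_measurable_def)

lemma L2_on_subset:
  assumes "L2_on A f" "B \<in> sets lborel" "B \<subseteq> A"
  shows "L2_on B f"
  using assms set_borel_measurable_subset[of lborel A f B]
  by (auto simp: L2_on_def intro: set_integrable_subset)

lemma L2_on_cong:
  assumes "L2_on A f" "\<And>x. x \<in> A \<Longrightarrow> f x = h x"
  shows "L2_on A h"
proof -
  have "(\<lambda>x. indicator A x * h x) = (\<lambda>x. indicator A x * f x)"
    "(\<lambda>x. indicator A x * (h x)\<^sup>2) = (\<lambda>x. indicator A x * (f x)\<^sup>2)"
    using assms(2) by (auto split: split_indicator)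
  with assms(1) show ?thesis
    by (simp add: L2_on_def set_borel_measurable_def set_integrable_def)
qed

lemma L2_on_Un:
  assumes "L2_on A f" "L2_on B f" "A \<in> sets lborel" "B \<in> sets lborel"
  shows "L2_on (A \<union> B) f"
proof -
  have [measurable]: "A \<in> sets borel" "B \<in> sets borel" using assms by auto
  note [measurable] = L2_onD(1)[OF assms(1)] L2_onD(1)[OF assms(2)]
  have "(\<lambda>x. indicator A x * f x + indicator (- A) x * (indicator B x * f x)) \<in> borel_measurable borel"
    by measurable
  also have "(\<lambda>x. indicator A x * f x + indicator (- A) x * (indicator B x * f x))
      = (\<lambda>x. indicator (A \<union> B) x * f x)"
    by (auto split: split_indicator)
  finally show ?thesis
    using assms set_integrable_Un[OF L2_onD(2)[OF assms(1)] L2_onD(2)[OF assms(2)]]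
    by (simp add: L2_on_def set_borel_measurable_def)
qed

lemma L2_on_Ici_If:
  assumes "L2_on {a..c} u" "L2_on {c..} v" "a \<le> c"
  shows "L2_on {a..} (\<lambda>x. if x \<le> c then u x else v x)"
proof -
  have "{a..c} \<union> {c<..} = {a..}" using assms(3) by auto
  moreover have "L2_on ({a..c} \<union> {c<..}) (\<lambda>x. if x \<le> c then u x else v x)"
  proof (rule L2_on_Un)
    show "L2_on {a..c} (\<lambda>x. if x \<le> c then u x else v x)" by (rule L2_on_cong[OF assms(1)]) simp
    have "L2_on {c<..} v" by (rule L2_on_subset[OF assms(2)]) auto
    then show "L2_on {c<..} (\<lambda>x. if x \<le> c then u x else v x)" by (rule L2_on_cong) simp
  qed simp_all
  ultimately show ?thesis by simp
qed

lemma L2_on_affine: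
  assumes "L2_on A f" "b \<noteq> 0"
  shows "L2_on {x. a + b * x \<in> A} (\<lambda>x. c * f (a + b * x))"
proof -
  have ind: "indicator {x. a + b * x \<in> A} x = (indicator A (a + b * x) :: real)" for x
    by (auto split: split_indicator)
  note [measurable] = L2_onD(1)[OF assms(1)]
  have "(\<lambda>x. c * (indicator A (a + b * x) * f (a + b * x))) \<in> borel_measurable borel"
    by measurable
  moreover have "set_integrable lborel {x. a + b * x \<in> A} (\<lambda>x. (f (a + b * x))\<^sup>2)"
    using set_integral_affine(2)[OF assms(2), of a A "\<lambda>x. (f x)\<^sup>2"] L2_onD(2)[OF assms(1)] by simp
  ultimately show ?thesis
    by (simp add: L2_on_def set_borel_measurable_def ind power_mult_distrib mult.left_commute)
qed

lemma L2_on_const_mult: "L2_on A f \<Longrightarrow> L2_on A (\<lambda>x. c * f x)"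
  using L2_on_affine[of A f 1 0 c] by simp

lemma L2_on_continuous:
  assumes "continuous_on A f" "A \<in> sets borel" "set_integrable lborel A (\<lambda>x. (f x)\<^sup>2)"
  shows "L2_on A f"
  using set_measurable_continuous_on[OF assms(2,1)] assms(3)
  by (simp add: L2_on_def set_borel_measurable_def)

lemma L2_on_continuous_Icc: "continuous_on {a..b} f \<Longrightarrow> L2_on {a..b} f"
  by (rule L2_on_continuous) (auto intro!: borel_integrable_atLeastAtMost' continuous_intros)

lemma
  assumes L2: "L2_on A f" "B \<in> sets lborel" "B \<subseteq> A" and fin: "emeasure lborel B < \<infinity>"
  shows L2_on_set_integrable: "set_integrable lborel B f"
    and set_integral_power2_le: "(LINT x:B|lborel. f x)\<^sup>2 \<le> measure lborel B * sqnorm B f"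
proof -
  note fB = L2_on_subset[OF L2]
  note [measurable] = L2_onD(1)[OF fB] L2(2)
  have sq: "(indicator B x * c)\<^sup>2 = indicator B x * c\<^sup>2" for x and c :: real
    by (auto split: split_indicator)
  have int: "integrable lborel (indicator B :: real \<Rightarrow> real)"
    using L2(2) fin by (simp add: less_top)
  have ind: "(indicator B x :: real)\<^sup>2 = indicator B x" for x by (auto split: split_indicator)
  have idem: "indicator B x * (indicator B x * f x) = indicator B x * f x" for x
    by (auto split: split_indicator)
  note CS = integral_Cauchy_Schwarz[of "indicator B" lborel "\<lambda>x. indicator B x * f x"]
  show "set_integrable lborel B f"
    using CS(1) int L2_onD(2)[OF fB] by (simp add: sq ind idem set_integrable_def)
  show "(LINT x:B|lborel. f x)\<^sup>2 \<le> measure lborel B * sqnorm B f"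
    using CS(2) int L2_onD(2)[OF fB]
    by (simp add: sq ind idem set_integrable_def set_lebesgue_integral_def)
qed

lemma L2_on_mult_set_integrable:
  assumes "L2_on A f" "L2_on A h"
  shows "set_integrable lborel A (\<lambda>x. f x * h x)"
proof -
  have restrict_mult: "(indicator A x * f x) * (indicator A x * h x) = indicator A x * (f x * h x)"
    "(indicator A x * f x)\<^sup>2 = indicator A x * (f x)\<^sup>2"
    "(indicator A x * h x)\<^sup>2 = indicator A x * (h x)\<^sup>2" for x
    by (auto split: split_indicator)
  show ?thesis
    using integral_Cauchy_Schwarz(1)[of "\<lambda>x. indicator A x * f x" lborel "\<lambda>x. indicator A x * h x"]
      L2_onD[OF assms(1)] L2_onD[OF assms(2)]
    by (simp add: restrict_mult set_integrable_def)
qed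

lemma L2_on_diff:
  assumes "L2_on A f" "L2_on A h"
  shows "L2_on A (\<lambda>x. f x - h x)"
proof -
  note [measurable] = L2_onD(1)[OF assms(1)] L2_onD(1)[OF assms(2)]
  have "(\<lambda>x. indicator A x * f x - indicator A x * h x) \<in> borel_measurable borel" by measurable
  then show ?thesis
    using L2_onD(2)[OF assms(1)] L2_onD(2)[OF assms(2)] L2_on_mult_set_integrable[OF assms]
    by (simp add: L2_on_def set_borel_measurable_def right_diff_distrib power2_diff mult.assoc)
qed

lemma L2_on_set_integrable_Icc:
  assumes "L2_on I f" "is_interval I" "x \<in> I" "y \<in> I"
  shows "set_integrable lborel {x..y} f"
  by (rule L2_on_set_integrable[OF assms(1) _ is_interval_Icc_subset[OF assms(2-4)]
        emeasure_lborel_Icc_finite]) simp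

lemma sqnorm_mono: "L2_on B f \<Longrightarrow> A \<in> sets lborel \<Longrightarrow> A \<subseteq> B \<Longrightarrow> sqnorm A f \<le> sqnorm B f"
  by (rule set_integral_mono_set[OF L2_onD(2)]) auto

section \<open>Functions with square-integrable derivative\<close>

definition has_L2_deriv_on :: "(real \<Rightarrow> real) \<Rightarrow> (real \<Rightarrow> real) \<Rightarrow> real set \<Rightarrow> bool" where
  "has_L2_deriv_on u g I \<longleftrightarrow> L2_on I g \<and>
     (\<forall>x\<in>I. \<forall>y\<in>I. x \<le> y \<longrightarrow> u y - u x = (LINT t:{x..y}|lborel. g t))"

lemma has_L2_deriv_onD:
  assumes "has_L2_deriv_on u g I"
  shows "L2_on I g" "\<And>x y. x \<in> I \<Longrightarrow> y \<in> I \<Longrightarrow> x \<le> y \<Longrightarrow> u y - u x = (LINT t:{x..y}|lborel. g t)"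
  using assms by (auto simp: has_L2_deriv_on_def)

lemma has_L2_deriv_on_subset:
  assumes "has_L2_deriv_on u g I" "J \<subseteq> I" "is_interval J"
  shows "has_L2_deriv_on u g J"
  using assms
    L2_on_subset[OF has_L2_deriv_onD(1)[OF assms(1)] is_interval_sets_lborel[OF assms(3)] assms(2)]
  by (auto simp: has_L2_deriv_on_def)

lemma has_L2_deriv_on_Hoelder_Icc:
  assumes "has_L2_deriv_on u g I" "is_interval I" "x \<in> I" "y \<in> I" "x \<le> y"
  shows "(u y - u x)\<^sup>2 \<le> (y - x) * sqnorm {x..y} g"
  using set_integral_power2_le[OF has_L2_deriv_onD(1)[OF assms(1)] _
      is_interval_Icc_subset[OF assms(2-4)] emeasure_lborel_Icc_finite]
    has_L2_deriv_onD(2)[OF assms(1,3-5)] assms(5)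
  by simp

lemma has_L2_deriv_on_Hoelder:
  assumes u: "has_L2_deriv_on u g I" "is_interval I" and "x \<in> I" "y \<in> I"
  shows "(u y - u x)\<^sup>2 \<le> \<bar>y - x\<bar> * sqnorm I g"
proof -
  have "(u t - u s)\<^sup>2 \<le> (t - s) * sqnorm I g" if "s \<in> I" "t \<in> I" "s \<le> t" for s t
  proof -
    have "(t - s) * sqnorm {s..t} g \<le> (t - s) * sqnorm I g"
      using that is_interval_Icc_subset[OF u(2) that(1,2)]
      by (intro mult_left_mono sqnorm_mono[OF has_L2_deriv_onD(1)[OF u(1)]]) auto
    with has_L2_deriv_on_Hoelder_Icc[OF u that] show ?thesis by linarith
  qed
  from this[of x y] this[of y x] assms(3,4) show ?thesis
    by (cases "x \<le> y") (auto simp: power2_commute)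
qed

lemma Hoelder_half_imp_continuous_on:
  fixes u :: "real \<Rightarrow> real"
  assumes "\<And>x y. x \<in> A \<Longrightarrow> y \<in> A \<Longrightarrow> (u y - u x)\<^sup>2 \<le> \<bar>y - x\<bar> * C"
  shows "continuous_on A u"
  unfolding continuous_on_def
proof
  fix x assume x: "x \<in> A"
  have "((\<lambda>y. sqrt (\<bar>y - x\<bar> * C)) \<longlongrightarrow> sqrt (\<bar>x - x\<bar> * C)) (at x within A)"
    by (intro tendsto_intros)
  then have bound: "((\<lambda>y. sqrt (\<bar>y - x\<bar> * C)) \<longlongrightarrow> 0) (at x within A)" by simp
  have "norm (u y - u x) \<le> sqrt (\<bar>y - x\<bar> * C)" if "y \<in> A" for y
    using real_sqrt_le_mono[OF assms[OF x that]] by simp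
  then have "\<forall>\<^sub>F y in at x within A. norm (u y - u x) \<le> sqrt (\<bar>y - x\<bar> * C)"
    by (simp add: eventually_at_filter)
  then have "((\<lambda>y. u y - u x) \<longlongrightarrow> 0) (at x within A)" by (rule Lim_null_comparison[OF _ bound])
  then show "(u \<longlongrightarrow> u x) (at x within A)" by (rule LIM_zero_cancel)
qed

lemma has_L2_deriv_on_imp_continuous_on:
  assumes "has_L2_deriv_on u g I" "is_interval I"
  shows "continuous_on I u"
  by (rule Hoelder_half_imp_continuous_on) (rule has_L2_deriv_on_Hoelder[OF assms])

lemma has_L2_deriv_on_affine:
  assumes u: "has_L2_deriv_on u g I" and b: "b \<noteq> 0"
  shows "has_L2_deriv_on (\<lambda>x. c * u (a + b * x)) (\<lambda>x. c * b * g (a + b * x)) {x. a + b * x \<in> I}"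
  unfolding has_L2_deriv_on_def
proof (intro conjI ballI impI)
  show "L2_on {x. a + b * x \<in> I} (\<lambda>x. c * b * g (a + b * x))"
    by (rule L2_on_affine[OF has_L2_deriv_onD(1)[OF u] b])
  fix x y assume xy: "x \<in> {x. a + b * x \<in> I}" "y \<in> {x. a + b * x \<in> I}" "x \<le> y"
  define s t where "s = min (a + b * x) (a + b * y)" and "t = max (a + b * x) (a + b * y)"
  have sgn: "(s = a + b * x \<and> t = a + b * y \<and> 0 < b) \<or> (s = a + b * y \<and> t = a + b * x \<and> b < 0)"
    using xy(3) b by (cases "0 < b") (auto simp: s_def t_def min_def max_def)
  then have "{x..y} = {r. a + b * r \<in> {s..t}}" by auto
  then have "(LINT r:{x..y}|lborel. g (a + b * r)) = (LINT r:{s..t}|lborel. g r) / \<bar>b\<bar>"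
    using set_integral_affine(1)[OF b, of a "{s..t}" g] by simp
  also have "(LINT r:{s..t}|lborel. g r) = u t - u s"
    using xy by (intro has_L2_deriv_onD(2)[OF u, symmetric]) (auto simp: s_def t_def min_def max_def)
  finally have "b * (LINT r:{x..y}|lborel. g (a + b * r)) = u (a + b * y) - u (a + b * x)"
    using sgn b by (auto simp: field_simps)
  then show "c * u (a + b * y) - c * u (a + b * x) = (LINT r:{x..y}|lborel. c * b * g (a + b * r))"
    by (simp add: mult.assoc flip: right_diff_distrib)
qed

lemma has_L2_deriv_on_const_mult:
  "has_L2_deriv_on u g I \<Longrightarrow> has_L2_deriv_on (\<lambda>x. c * u x) (\<lambda>x. c * g x) I"
  using has_L2_deriv_on_affine[of u g I 1 c 0] by simp

lemma has_L2_deriv_on_const: "has_L2_deriv_on (\<lambda>x. c) (\<lambda>x. 0) I"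
  by (simp add: has_L2_deriv_on_def L2_on_def set_borel_measurable_def set_integrable_def)

lemma has_L2_deriv_on_cong:
  assumes "has_L2_deriv_on u g I" "is_interval I"
    and "\<And>x. x \<in> I \<Longrightarrow> u x = u' x" and deriv_eq: "\<And>x. x \<in> I \<Longrightarrow> x \<noteq> c \<Longrightarrow> g x = g' x"
  shows "has_L2_deriv_on u' g' I"
  unfolding has_L2_deriv_on_def
proof (intro conjI ballI impI)
  note gI = has_L2_deriv_onD(1)[OF assms(1)]
  note [measurable] = is_interval_sets_lborel[OF assms(2), simplified] L2_onD(1)[OF gI]
  have "(\<lambda>x. if x = c then indicator I c * g' c else indicator I x * g x) \<in> borel_measurable borel"
    by measurable
  also have "(\<lambda>x. if x = c then indicator I c * g' c else indicator I x * g x)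
      = (\<lambda>x. indicator I x * g' x)"
    using deriv_eq by (auto split: split_indicator)
  finally have "set_borel_measurable lborel I g'" by (simp add: set_borel_measurable_def)
  moreover have "set_integrable lborel I (\<lambda>x. (g' x)\<^sup>2)"
    using L2_onD(2)[OF gI] deriv_eq set_integral_cong_except_point(2)[of I c "\<lambda>x. (g x)\<^sup>2" "\<lambda>x. (g' x)\<^sup>2"]
    by simp
  ultimately show "L2_on I g'" by (simp add: L2_on_def)
  fix x y assume xy: "x \<in> I" "y \<in> I" "x \<le> y"
  have "(LINT t:{x..y}|lborel. g t) = (LINT t:{x..y}|lborel. g' t)"
    by (rule set_integral_cong_except_point(1)[of _ c])
      (use deriv_eq is_interval_Icc_subset[OF assms(2) xy(1,2)] in auto)
  then show "u' y - u' x = (LINT t:{x..y}|lborel. g' t)"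
    using has_L2_deriv_onD(2)[OF assms(1) xy] assms(3) xy by simp
qed

lemma has_L2_deriv_on_Un:
  assumes "has_L2_deriv_on u g A" "has_L2_deriv_on u g B" "is_interval A" "is_interval B"
    and AB: "A \<subseteq> {..c}" "B \<subseteq> {c..}" "c \<in> A" "c \<in> B"
  shows "has_L2_deriv_on u g (A \<union> B)"
  unfolding has_L2_deriv_on_def
proof (intro conjI ballI impI)
  show L2: "L2_on (A \<union> B) g"
    using assms by (intro L2_on_Un is_interval_sets_lborel) (auto simp: has_L2_deriv_on_def)
  have "connected (A \<union> B)"
    using assms by (intro connected_Un) (auto simp: is_interval_connected_1)
  then have int: "is_interval (A \<union> B)" by (simp add: is_interval_connected_1)
  fix x y assume xy: "x \<in> A \<union> B" "y \<in> A \<union> B" "x \<le> y"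
  have "x \<in> A" if "x \<in> B" "y \<in> A"
  proof -
    have "x = c" using that xy(3) AB(1,2) by force
    then show ?thesis using AB(3) by simp
  qed
  then consider "x \<in> A" "y \<in> A" | "x \<in> B" "y \<in> B" | "x \<in> A" "y \<in> B"
    using xy by blast
  then show "u y - u x = (LINT t:{x..y}|lborel. g t)"
  proof cases
    assume x: "x \<in> A" and y: "y \<in> B"
    then have c: "x \<le> c" "c \<le> y" using AB(1,2) by auto
    then have "(LINT t:{x..y}|lborel. g t) = (LINT t:{x..c}|lborel. g t) + (LINT t:{c..y}|lborel. g t)"
      using set_integral_Icc_split[OF L2_on_set_integrable_Icc[OF L2 int xy(1,2)]] by simp
    also have "\<dots> = (u c - u x) + (u y - u c)"
      using has_L2_deriv_onD(2)[OF assms(1) x AB(3) c(1)] has_L2_deriv_onD(2)[OF assms(2) AB(4) y c(2)]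
      by simp
    finally show ?thesis by simp
  qed (use xy assms(1,2) in \<open>auto simp: has_L2_deriv_on_def\<close>)
qed

lemma has_L2_deriv_on_If:
  assumes "has_L2_deriv_on u g A" "has_L2_deriv_on v h B" "is_interval A" "is_interval B"
    and AB: "A \<subseteq> {..c}" "B \<subseteq> {c..}" "c \<in> A" "c \<in> B" and "u c = v c"
  shows "has_L2_deriv_on (\<lambda>x. if x \<le> c then u x else v x) (\<lambda>x. if x \<le> c then g x else h x) (A \<union> B)"
proof (rule has_L2_deriv_on_Un[OF _ _ assms(3-8)])
  show "has_L2_deriv_on (\<lambda>x. if x \<le> c then u x else v x) (\<lambda>x. if x \<le> c then g x else h x) A"
    by (rule has_L2_deriv_on_cong[OF assms(1,3)]) (use AB(1) in auto)
  show "has_L2_deriv_on (\<lambda>x. if x \<le> c then u x else v x) (\<lambda>x. if x \<le> c then g x else h x) B"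
  proof (rule has_L2_deriv_on_cong[OF assms(2,4), of _ c])
    fix x assume "x \<in> B"
    then have "c \<le> x" using AB(2) by auto
    then show "v x = (if x \<le> c then u x else v x)" "x \<noteq> c \<Longrightarrow> h x = (if x \<le> c then g x else h x)"
      using assms(9) by (cases "x = c"; simp)+
  qed
qed

lemma has_L2_deriv_on_Ici_If:
  assumes "has_L2_deriv_on u g {a..c}" "has_L2_deriv_on v h {c..}" "a \<le> c" "u c = v c"
  shows "has_L2_deriv_on (\<lambda>x. if x \<le> c then u x else v x) (\<lambda>x. if x \<le> c then g x else h x) {a..}"
proof -
  have "{a..c} \<union> {c..} = {a..}" using assms(3) by auto
  then show ?thesis using has_L2_deriv_on_If[OF assms(1,2), of c] assms(3,4) by simp
qed

section \<open>Weak derivatives\<close>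

lemma set_integral_Fubini_triangle:
  fixes g h :: "real \<Rightarrow> real"
  assumes "set_integrable lborel {a..b} g" "set_integrable lborel {a..b} h"
  shows "(LINT x:{a..b}|lborel. h x * (LINT t:{a..x}|lborel. g t))
    = (LINT t:{a..b}|lborel. g t * (LINT x:{t..b}|lborel. h x))"
proof -
  define G H where "G x = indicator {a..b} x * g x" and "H x = indicator {a..b} x * h x" for x
  define F where "F x t = (if t \<le> x then H x * G t else 0)" for x t :: real
  have int_GH: "integrable lborel G" "integrable lborel H"
    using assms by (simp_all add: G_def[abs_def] H_def[abs_def] set_integrable_def)
  then have [measurable]: "G \<in> borel_measurable borel" "H \<in> borel_measurable borel" by auto
  have "integrable (lborel \<Otimes>\<^sub>M lborel) (\<lambda>(x, t). H x * G t)"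
    using lborel_pair.Fubini_integrable[of "\<lambda>(x, t). H x * G t"] int_GH by (simp add: abs_mult)
  then have "integrable (lborel \<Otimes>\<^sub>M lborel) (case_prod F)"
    by (rule Bochner_Integration.integrable_bound) (auto simp: F_def[abs_def])
  note Fubini = lborel_pair.Fubini_integral[OF this]
  have inner_t: "(\<integral>t. F x t \<partial>lborel) = indicator {a..b} x * (h x * (LINT t:{a..x}|lborel. g t))" for x
  proof (cases "x \<in> {a..b}")
    case True
    then have "(\<integral>t. F x t \<partial>lborel) = (\<integral>t. h x * (indicator {a..x} t *\<^sub>R g t) \<partial>lborel)"
      by (intro Bochner_Integration.integral_cong) (auto simp: F_def G_def H_def split: split_indicator)
    with True show ?thesis by (simp add: set_lebesgue_integral_def)
  qed (simp add: F_def H_def cong: if_cong)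
  have inner_x: "(\<integral>x. F x t \<partial>lborel) = indicator {a..b} t * (g t * (LINT x:{t..b}|lborel. h x))" for t
  proof (cases "t \<in> {a..b}")
    case True
    then have "(\<integral>x. F x t \<partial>lborel) = (\<integral>x. g t * (indicator {t..b} x *\<^sub>R h x) \<partial>lborel)"
      by (intro Bochner_Integration.integral_cong) (auto simp: F_def G_def H_def split: split_indicator)
    with True show ?thesis by (simp add: set_lebesgue_integral_def)
  qed (simp add: F_def G_def cong: if_cong)
  show ?thesis using Fubini by (simp add: inner_t inner_x set_lebesgue_integral_def)
qed

lemma has_L2_deriv_on_integral_by_parts:
  assumes ab: "a \<le> b" and u: "has_L2_deriv_on u g {a..b}" and v: "has_L2_deriv_on v h {a..b}"
  shows "(LINT x:{a..b}|lborel. u x * h x) + (LINT x:{a..b}|lborel. g x * v x) = u b * v b - u a * v a"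
proof -
  note L2 = has_L2_deriv_onD(1)[OF u] has_L2_deriv_onD(1)[OF v]
  have int: "set_integrable lborel {a..b} g" "set_integrable lborel {a..b} h"
    "set_integrable lborel {a..b} (\<lambda>x. h x * u x)" "set_integrable lborel {a..b} (\<lambda>x. g x * v x)"
    using L2 ab has_L2_deriv_on_imp_continuous_on[OF u] has_L2_deriv_on_imp_continuous_on[OF v]
    by (auto intro!: L2_on_set_integrable_Icc[of "{a..b}"]
        L2_on_mult_set_integrable L2_on_continuous_Icc)
  have "(LINT x:{a..b}|lborel. h x * (u x - u a))
      = (LINT x:{a..b}|lborel. h x * (LINT t:{a..x}|lborel. g t))"
    "(LINT t:{a..b}|lborel. g t * (LINT x:{t..b}|lborel. h x))
        = (LINT t:{a..b}|lborel. g t * (v b - v t))"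
    using has_L2_deriv_onD(2)[OF u, of a] has_L2_deriv_onD(2)[OF v, of _ b]
    by (auto intro!: set_lebesgue_integral_cong)
  with set_integral_Fubini_triangle[OF int(1,2)]
  have "(LINT x:{a..b}|lborel. h x * (u x - u a)) = (LINT t:{a..b}|lborel. g t * (v b - v t))"
    by simp
  moreover have
    "(LINT x:{a..b}|lborel. h x * (u x - u a)) = (LINT x:{a..b}|lborel. h x * u x) - u a * (v b - v a)"
    "(LINT x:{a..b}|lborel. g x * (v b - v x)) = v b * (u b - u a) - (LINT x:{a..b}|lborel. g x * v x)"
    using int has_L2_deriv_onD(2)[OF u _ _ ab] has_L2_deriv_onD(2)[OF v _ _ ab] ab
    by (simp_all add: right_diff_distrib)
  ultimately show ?thesis by (simp add: algebra_simps)
qed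

lemma has_L2_deriv_on_C1:
  assumes "\<And>x. (\<phi> has_real_derivative \<phi>' x) (at x)" "continuous_on UNIV \<phi>'"
  shows "has_L2_deriv_on \<phi> \<phi>' {a..b}"
  unfolding has_L2_deriv_on_def
proof (intro conjI ballI impI)
  show "L2_on {a..b} \<phi>'"
    by (intro L2_on_continuous_Icc continuous_on_subset[OF assms(2)]) simp
  fix x y :: real assume "x \<le> y"
  then show "\<phi> y - \<phi> x = (LINT t:{x..y}|lborel. \<phi>' t)"
    using integral_FTC_atLeastAtMost[of x y \<phi> \<phi>'] assms
    by (simp add: set_lebesgue_integral_def has_real_derivative_iff_has_vector_derivative
        has_vector_derivative_at_within continuous_on_subset)
qed

lemma test_fun_on_deriv_eq_0:
  assumes "test_fun_on I \<phi> \<phi>'" "compact K" "\<And>x. x \<notin> K \<Longrightarrow> \<phi> x = 0" "x \<notin> K"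
  shows "\<phi>' x = 0"
proof -
  have "open (- K)" using assms(2) by (simp add: compact_imp_closed open_Compl)
  then have "(\<phi> has_real_derivative 0) (at x)"
    using has_field_derivative_transform_within_open[OF DERIV_const[of 0 "at x"], of "- K" \<phi>] assms(3,4)
    by auto
  moreover have "(\<phi> has_real_derivative \<phi>' x) (at x)"
    using assms(1) by (simp add: test_fun_on_def)
  ultimately show ?thesis by (rule DERIV_unique[symmetric])
qed

lemma compact_subset_Ioo_in_open_interval:
  fixes K :: "real set"
  assumes K: "compact K" "K \<noteq> {}" "K \<subseteq> U" and U: "open U" "is_interval U"
  obtains a b where "a < b" "K \<subseteq> {a<..<b}" "{a..b} \<subseteq> U"
proof -
  obtain s t where s: "s \<in> K" "\<And>x. x \<in> K \<Longrightarrow> s \<le> x" and t: "t \<in> K" "\<And>x. x \<in> K \<Longrightarrow> x \<le> t"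
    using compact_attains_inf[OF K(1,2)] compact_attains_sup[OF K(1,2)] by metis
  obtain d e where d: "0 < d" "ball s d \<subseteq> U" and e: "0 < e" "ball t e \<subseteq> U"
    using s(1) t(1) K(3) U(1) by (meson open_contains_ball subsetD)
  have "s - d / 2 \<in> U" "t + e / 2 \<in> U" using d e by (auto simp: dist_real_def)
  then have "{s - d / 2..t + e / 2} \<subseteq> U" by (rule is_interval_Icc_subset[OF U(2)])
  moreover have "K \<subseteq> {s - d / 2<..<t + e / 2}" using s(2) t(2) d(1) e(1) by fastforce
  moreover have "s - d / 2 < t + e / 2" using s(2)[OF t(1)] d(1) e(1) by simp
  ultimately show thesis using that by blast
qed

lemma has_L2_deriv_on_imp_has_weak_deriv_on:
  assumes u: "has_L2_deriv_on u g I" and I: "is_interval I"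
  shows "has_weak_deriv_on u g I"
  unfolding has_weak_deriv_on_def
proof (intro allI impI)
  fix \<phi> \<phi>' assume test: "test_fun_on I \<phi> \<phi>'"
  then obtain K where K: "compact K" "K \<subseteq> interior I" "\<And>x. x \<notin> K \<Longrightarrow> \<phi> x = 0"
    unfolding test_fun_on_def by blast
  note \<phi>' = test_fun_on_deriv_eq_0[OF test K(1,3)]
  show "(LINT x:I|lborel. u x * \<phi>' x) = - (LINT x:I|lborel. g x * \<phi> x)"
  proof (cases "K = {}")
    case True
    then show ?thesis using K(3) \<phi>' by simp
  next
    case False
    obtain a b where ab: "a < b" "K \<subseteq> {a<..<b}" "{a..b} \<subseteq> interior I"
      using compact_subset_Ioo_in_open_interval[OF K(1) False K(2)] I
      by (metis convex_interior is_interval_convex_1 open_interior)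
    have restrict: "(LINT x:I|lborel. f x) = (LINT x:{a..b}|lborel. f x)" if "\<And>x. x \<notin> K \<Longrightarrow> f x = 0"
      for f :: "real \<Rightarrow> real"
      unfolding set_lebesgue_integral_def
    proof (intro Bochner_Integration.integral_cong refl)
      show "indicator I x *\<^sub>R f x = indicator {a..b} x *\<^sub>R f x" for x
        using that[of x] ab(2,3) interior_subset[of I] by (cases "x \<in> K") (auto split: split_indicator)
    qed
    have u_ab: "has_L2_deriv_on u g {a..b}"
      using ab(3) interior_subset by (intro has_L2_deriv_on_subset[OF u]) auto
    have \<phi>_ab: "has_L2_deriv_on \<phi> \<phi>' {a..b}"
      using test by (intro has_L2_deriv_on_C1) (auto simp: test_fun_on_def)
    have "\<phi> a = 0" "\<phi> b = 0" using ab(2) by (auto intro!: K(3))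
    then show ?thesis
      using has_L2_deriv_on_integral_by_parts[OF less_imp_le[OF ab(1)] u_ab \<phi>_ab]
        restrict[of "\<lambda>x. u x * \<phi>' x"] restrict[of "\<lambda>x. g x * \<phi> x"] \<phi>' K(3)
      by simp
  qed
qed

lemma test_fun_on_antiderivative:
  assumes \<psi>: "continuous_on UNIV \<psi>" "\<And>x. x \<notin> {a..b} \<Longrightarrow> \<psi> x = 0" "(LINT x:{a..b}|lborel. \<psi> x) = 0"
    and ab: "a \<le> b" "{a..b} \<subseteq> interior I"
  obtains \<phi> where "test_fun_on I \<phi> \<psi>"
proof -
  obtain F where F: "\<And>x. (F has_real_derivative \<psi> x) (at x)"
    using einterval_antiderivative[of "-\<infinity>" \<infinity> \<psi>] \<psi>(1)
    by (auto simp: continuous_on_eq_continuous_at has_real_derivative_iff_has_vector_derivative)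
  have incr: "F y - F x = (LINT t:{x..y}|lborel. \<psi> t)" if "x \<le> y" for x y
    using has_L2_deriv_onD(2)[OF has_L2_deriv_on_C1[OF F \<psi>(1), of x y], of x y] that by simp
  have zero: "(LINT t:{x..a}|lborel. \<psi> t) = 0" "(LINT t:{b..x}|lborel. \<psi> t) = 0" for x
    using set_integral_cong_except_point(1)[of "{x..a}" a \<psi> "\<lambda>x. 0"]
      set_integral_cong_except_point(1)[of "{b..x}" b \<psi> "\<lambda>x. 0"] \<psi>(2) by auto
  have "F x = F a" if "x \<notin> {a..b}" for x
  proof (cases "x < a")
    case True
    then show ?thesis using incr[of x a] zero by simp
  next
    case False
    then have "b \<le> x" using that by auto
    then show ?thesis using incr[of b x] zero incr[OF ab(1)] \<psi>(3) by simp
  qed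
  then have "test_fun_on I (\<lambda>x. F x - F a) \<psi>"
    unfolding test_fun_on_def using \<psi>(1) ab(2) F
    by (auto intro!: derivative_eq_intros exI[of _ "{a..b}"])
  then show thesis by (rule that)
qed

lemma set_integral_Icc_eq_0_imp_eq_0:
  fixes f :: "real \<Rightarrow> real"
  assumes ab: "a < b" and f: "continuous_on {a..b} f" "\<And>x. x \<in> {a<..<b} \<Longrightarrow> 0 \<le> f x"
    and zero: "(LINT t:{a..b}|lborel. f t) = 0" and x: "x \<in> {a..b}"
  shows "f x = 0"
proof -
  have "(f has_integral 0) {a..b}"
    using set_borel_integral_eq_integral[OF borel_integrable_atLeastAtMost'[OF f(1)]] zero
    by (simp add: has_integral_integral)
  then show ?thesis using has_integral_0_cbox_imp_0[of a b f x] f ab x by simp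
qed

lemma continuous_on_eq_mean_if_weighted_variance_0:
  fixes w \<eta> :: "real \<Rightarrow> real"
  assumes cont: "continuous_on {a..b} w" "continuous_on {a..b} \<eta>" and ab: "a < b"
    and \<eta>: "\<And>t. t \<in> {a<..<b} \<Longrightarrow> 0 < \<eta> t"
    and mean: "(LINT t:{a..b}|lborel. (w t - c) * \<eta> t) = 0"
    and moment: "(LINT t:{a..b}|lborel. w t * ((w t - c) * \<eta> t)) = 0"
    and t: "t \<in> {a<..<b}"
  shows "w t = c"
proof -
  have "(LINT t:{a..b}|lborel. (w t - c)\<^sup>2 * \<eta> t)
      = (LINT t:{a..b}|lborel. w t * ((w t - c) * \<eta> t) - c * ((w t - c) * \<eta> t))"
    by (intro set_lebesgue_integral_cong) (auto simp: power2_eq_square algebra_simps)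
  also have "\<dots> = (LINT t:{a..b}|lborel. w t * ((w t - c) * \<eta> t))
      - (LINT t:{a..b}|lborel. c * ((w t - c) * \<eta> t))"
    by (intro set_integral_diff borel_integrable_atLeastAtMost' continuous_intros cont)
  also have "\<dots> = 0" unfolding moment using mean by simp
  finally have variance: "(LINT t:{a..b}|lborel. (w t - c)\<^sup>2 * \<eta> t) = 0" .
  have "(w t - c)\<^sup>2 * \<eta> t = 0"
    by (rule set_integral_Icc_eq_0_imp_eq_0[OF ab _ _ variance])
      (use t in \<open>auto intro!: continuous_intros cont mult_nonneg_nonneg simp: \<eta> less_imp_le\<close>)
  then show ?thesis using \<eta>[OF t] by simp
qed

text \<open>The du Bois-Reymond lemma. Testing with the primitive of \<open>(v - c) \<eta>\<close>, where \<open>\<eta>\<close> is a bump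
  function and \<open>c\<close> the \<open>\<eta>\<close>-weighted mean of \<open>v\<close>, gives \<open>\<integral> (v - c)\<^sup>2 \<eta> = 0\<close>.\<close>

lemma has_weak_deriv_on_0_imp_constant_on_subinterval:
  assumes v: "continuous_on {a..b} v" and weak: "has_weak_deriv_on v (\<lambda>x. 0) I"
    and ab: "a < b" "{a..b} \<subseteq> interior I"
  obtains c where "\<And>x. x \<in> {a<..<b} \<Longrightarrow> v x = c"
proof -
  define \<eta> where "\<eta> t = max 0 ((t - a) * (b - t))" for t
  define w where "w t = v (max a (min b t))" for t
  have \<eta>_pos: "0 < \<eta> t" if "t \<in> {a<..<b}" for t using that by (simp add: \<eta>_def)
  have \<eta>_zero: "\<eta> t = 0" if "t \<notin> {a..b}" for t
    using that ab(1) by (auto simp: \<eta>_def max.absorb1 mult_le_0_iff)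
  have cont_\<eta>: "continuous_on A \<eta>" for A unfolding \<eta>_def by (intro continuous_intros)
  have "continuous_on A (\<lambda>t. max a (min b t))" for A by (intro continuous_intros)
  then have cont_w: "continuous_on A w" for A
    unfolding w_def by (rule continuous_on_compose2[OF v]) (use ab(1) in auto)
  note int = borel_integrable_atLeastAtMost'[of a b]
  define c where "c = (LINT t:{a..b}|lborel. w t * \<eta> t) / (LINT t:{a..b}|lborel. \<eta> t)"
  have "(LINT t:{a..b}|lborel. \<eta> t) \<noteq> 0"
    using set_integral_Icc_eq_0_imp_eq_0[OF ab(1) cont_\<eta>, of "(a + b) / 2"] \<eta>_pos[of "(a + b) / 2"] ab(1)
    by (auto simp: \<eta>_def)
  then have mean: "(LINT t:{a..b}|lborel. (w t - c) * \<eta> t) = 0"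
    using int[of "\<lambda>t. w t * \<eta> t"] int[OF cont_\<eta>] cont_w cont_\<eta>
    by (simp add: c_def left_diff_distrib continuous_on_mult)
  obtain \<phi> where "test_fun_on I \<phi> (\<lambda>t. (w t - c) * \<eta> t)"
    by (rule test_fun_on_antiderivative[OF _ _ mean _ ab(2)])
      (use ab(1) \<eta>_zero in \<open>auto intro!: continuous_intros cont_w cont_\<eta>\<close>)
  with weak have "(LINT t:I|lborel. v t * ((w t - c) * \<eta> t)) = 0"
    by (auto simp: has_weak_deriv_on_def)
  also have "(LINT t:I|lborel. v t * ((w t - c) * \<eta> t))
      = (LINT t:{a..b}|lborel. w t * ((w t - c) * \<eta> t))"
    unfolding set_lebesgue_integral_def
  proof (intro Bochner_Integration.integral_cong refl)
    show "indicator I t *\<^sub>R (v t * ((w t - c) * \<eta> t))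
        = indicator {a..b} t *\<^sub>R (w t * ((w t - c) * \<eta> t))" for t
      using \<eta>_zero[of t] ab(2) interior_subset[of I]
      by (cases "t \<in> {a..b}") (auto simp: w_def split: split_indicator)
  qed
  finally have moment: "(LINT t:{a..b}|lborel. w t * ((w t - c) * \<eta> t)) = 0" .
  have "w t = c" if "t \<in> {a<..<b}" for t
    by (rule continuous_on_eq_mean_if_weighted_variance_0[OF cont_w cont_\<eta> ab(1) \<eta>_pos mean moment that])
  then show thesis by (intro that) (force simp: w_def)
qed

lemma has_weak_deriv_on_0_imp_constant:
  assumes v: "continuous_on {a..b} v" and weak: "has_weak_deriv_on v (\<lambda>x. 0) {a..b}"
    and x: "x \<in> {a..b}" and y: "y \<in> {a..b}"
  shows "v x = v y"
proof (cases "a < b")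
  case True
  have "v s = v t" if st: "s \<in> {a<..<b}" "t \<in> {a<..<b}" for s t
  proof -
    obtain a' b' where ab': "a < a'" "a' < min s t" "max s t < b'" "b' < b"
      using st dense[of a "min s t"] dense[of "max s t" b] by auto
    obtain c where "\<And>r. r \<in> {a'<..<b'} \<Longrightarrow> v r = c"
      by (rule has_weak_deriv_on_0_imp_constant_on_subinterval[OF _ weak, of a' b'])
        (use ab' in \<open>auto intro: continuous_on_subset[OF v]\<close>)
    then show ?thesis using ab' by auto
  qed
  then have "v constant_on {a<..<b}" unfolding constant_on_def by blast
  then have "v constant_on {a..b}"
    using constant_on_closureI[of v "{a<..<b}"] v True by simp
  then show ?thesis using x y by (auto simp: constant_on_def)
next
  case False
  then have "x = y" using x y by auto
  then show ?thesis by simp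
qed

lemma has_weak_deriv_on_subset:
  assumes weak: "has_weak_deriv_on u g I" and "J \<subseteq> I"
  shows "has_weak_deriv_on u g J"
  unfolding has_weak_deriv_on_def
proof (intro allI impI)
  fix \<phi> \<phi>' assume test: "test_fun_on J \<phi> \<phi>'"
  then obtain K where K: "compact K" "K \<subseteq> interior J" "\<And>x. x \<notin> K \<Longrightarrow> \<phi> x = 0"
    unfolding test_fun_on_def by blast
  have "K \<subseteq> interior I" using K(2) interior_mono[OF assms(2)] by blast
  then have "test_fun_on I \<phi> \<phi>'" using test K unfolding test_fun_on_def by blast
  then have "(LINT x:I|lborel. u x * \<phi>' x) = - (LINT x:I|lborel. g x * \<phi> x)"
    using weak by (simp add: has_weak_deriv_on_def)
  moreover have "(LINT x:I|lborel. f x) = (LINT x:J|lborel. f x)" if "\<And>x. x \<notin> K \<Longrightarrow> f x = 0"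
    for f :: "real \<Rightarrow> real"
    unfolding set_lebesgue_integral_def
  proof (intro Bochner_Integration.integral_cong refl)
    show "indicator I x *\<^sub>R f x = indicator J x *\<^sub>R f x" for x
      using that[of x] K(2) interior_subset[of J] assms(2)
      by (cases "x \<in> K") (auto split: split_indicator)
  qed
  ultimately show "(LINT x:J|lborel. u x * \<phi>' x) = - (LINT x:J|lborel. g x * \<phi> x)"
    using K(3) test_fun_on_deriv_eq_0[OF test K(1,3)] by simp
qed

lemma has_weak_deriv_on_imp_has_L2_deriv_on:
  assumes u: "continuous_on I u" and g: "L2_on I g" and weak: "has_weak_deriv_on u g I"
    and I: "is_interval I"
  shows "has_L2_deriv_on u g I"
  unfolding has_L2_deriv_on_def
proof (intro conjI ballI impI)
  fix x y assume xy: "x \<in> I" "y \<in> I" "x \<le> y"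
  define G where "G t = (LINT s:{x..t}|lborel. g s)" for t
  note sub = is_interval_Icc_subset[OF I xy(1,2)]
  have g_xy: "L2_on {x..y} g" using sub by (intro L2_on_subset[OF g]) auto
  have "G t - G s = (LINT r:{s..t}|lborel. g r)" if "s \<in> {x..y}" "t \<in> {x..y}" "s \<le> t" for s t
    using set_integral_Icc_split[OF L2_on_set_integrable_Icc[OF g_xy, of x t], of s] that
    by (simp add: G_def)
  then have G: "has_L2_deriv_on G g {x..y}" using g_xy by (simp add: has_L2_deriv_on_def)
  have cont: "continuous_on {x..y} u" "continuous_on {x..y} G"
    using continuous_on_subset[OF u sub] has_L2_deriv_on_imp_continuous_on[OF G] by auto
  have "has_weak_deriv_on (\<lambda>t. u t - G t) (\<lambda>t. 0) {x..y}"
    unfolding has_weak_deriv_on_def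
  proof (intro allI impI)
    fix \<phi> \<phi>' assume test: "test_fun_on {x..y} \<phi> \<phi>'"
    then have "continuous_on {x..y} \<phi>'"
      using continuous_on_subset[of UNIV \<phi>'] by (auto simp: test_fun_on_def)
    then have "set_integrable lborel {x..y} (\<lambda>t. u t * \<phi>' t)"
        "set_integrable lborel {x..y} (\<lambda>t. G t * \<phi>' t)"
      using cont by (auto intro!: borel_integrable_atLeastAtMost' continuous_on_mult)
    moreover have "(LINT t:{x..y}|lborel. u t * \<phi>' t) = (LINT t:{x..y}|lborel. G t * \<phi>' t)"
      using has_weak_deriv_on_subset[OF weak sub] has_L2_deriv_on_imp_has_weak_deriv_on[OF G] test
      by (simp add: has_weak_deriv_on_def)
    ultimately show "(LINT t:{x..y}|lborel. (u t - G t) * \<phi>' t) = - (LINT t:{x..y}|lborel. 0 * \<phi> t)"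
      by (simp add: left_diff_distrib)
  qed
  then have "u y - G y = u x - G x"
    using cont xy(3) by (intro has_weak_deriv_on_0_imp_constant[of x y] continuous_intros) auto
  moreover have "G x = 0"
    using set_integral_cong_except_point(1)[of "{x..x}" x g "\<lambda>_. 0"] by (simp add: G_def)
  ultimately show "u y - u x = (LINT t:{x..y}|lborel. g t)" by (simp add: G_def)
qed (rule g)

lemma AE_eq_0_if_integral_greaterThan_eq_0:
  fixes d :: "real \<Rightarrow> real"
  assumes d: "integrable lborel d" and zero: "\<And>x. (LINT t:{x<..}|lborel. d t) = 0"
  shows "AE t in lborel. d t = 0"
proof -
  have [measurable]: "d \<in> borel_measurable borel" using d by auto
  have int: "integrable lborel (\<lambda>t. indicator {x<..} t * max 0 (e t))"
    if "integrable lborel e" for x and e :: "real \<Rightarrow> real"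
    by (rule Bochner_Integration.integrable_bound[OF that])
      (use that in \<open>auto split: split_indicator\<close>)
  have emeasure: "emeasure (density lborel (\<lambda>t. ennreal (e t))) {x<..}
      = ennreal (LINT t:{x<..}|lborel. max 0 (e t))"
    if "integrable lborel e" for x and e :: "real \<Rightarrow> real"
  proof -
    have "emeasure (density lborel (\<lambda>t. ennreal (e t))) {x<..}
        = (\<integral>\<^sup>+t. ennreal (indicator {x<..} t * max 0 (e t)) \<partial>lborel)"
      using that by (subst emeasure_density)
        (auto intro!: nn_integral_cong simp: max_def ennreal_neg split: split_indicator)
    then show ?thesis
      using int[OF that] by (simp add: nn_integral_eq_integral set_lebesgue_integral_def)
  qed
  have minus: "integrable lborel (\<lambda>t. - d t)" using d by simp
  have "(LINT t:{x<..}|lborel. max 0 (d t)) = (LINT t:{x<..}|lborel. max 0 (- d t))" for x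
  proof -
    have "(LINT t:{x<..}|lborel. max 0 (d t)) - (LINT t:{x<..}|lborel. max 0 (- d t))
        = (LINT t:{x<..}|lborel. max 0 (d t) - max 0 (- d t))"
      using int[OF d, of x] int[OF minus, of x] by (simp add: set_integrable_def)
    also have "(\<lambda>t. max 0 (d t) - max 0 (- d t)) = d" by (auto simp: max_def)
    finally show ?thesis using zero[of x] by simp
  qed
  then have "density lborel (\<lambda>t. ennreal (d t)) = density lborel (\<lambda>t. ennreal (- d t))"
    by (intro measure_eqI_lessThan) (simp_all add: emeasure[OF d] emeasure[OF minus])
  then have "AE t in lborel. ennreal (d t) = ennreal (- d t)"
    by (intro sigma_finite_measure.density_unique[OF sigma_finite_lborel]) auto
  then show ?thesis
  proof eventually_elim
    case (elim t)
    then show ?case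
      by (cases "d t" "0::real" rule: linorder_cases) (auto simp: ennreal_neg ennreal_eq_0_iff)
  qed
qed

lemma has_L2_deriv_on_unique_Icc:
  assumes "has_L2_deriv_on u g {a..b}" "has_L2_deriv_on u h {a..b}"
  shows "AE t in lborel. t \<in> {a..b} \<longrightarrow> g t = h t"
proof (cases "a \<le> b")
  case True
  define d where "d t = indicator {a..b} t * (g t - h t)" for t
  note int = L2_on_set_integrable_Icc[OF has_L2_deriv_onD(1)[OF assms(1)]]
    L2_on_set_integrable_Icc[OF has_L2_deriv_onD(1)[OF assms(2)]]
  have d: "integrable lborel d"
    using int[of a b] True
    by (simp add: d_def[abs_def] set_integrable_def right_diff_distrib)
  have "(LINT t:{x<..}|lborel. d t) = 0" for x
  proof -
    have "(LINT t:{x<..}|lborel. d t) = (LINT t:{max a x..b}|lborel. g t - h t)"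
      unfolding set_lebesgue_integral_def
      by (rule integral_discrete_difference[of "{x}"]) (auto simp: d_def split: split_indicator)
    also have "\<dots> = 0"
    proof (cases "max a x \<le> b")
      case True
      then show ?thesis
        using int[of "max a x" b] has_L2_deriv_onD(2)[OF assms(1), of "max a x" b]
          has_L2_deriv_onD(2)[OF assms(2), of "max a x" b] by auto
    qed (simp add: set_lebesgue_integral_def)
    finally show ?thesis .
  qed
  from AE_eq_0_if_integral_greaterThan_eq_0[OF d this] show ?thesis
    by eventually_elim (auto simp: d_def)
qed simp

lemma has_L2_deriv_on_unique:
  assumes "has_L2_deriv_on u g I" "has_L2_deriv_on u h I" and I: "is_interval I"
  shows "AE t in lborel. t \<in> I \<longrightarrow> g t = h t"
proof -
  have Icc: "AE t in lborel. t \<in> {a..b} \<longrightarrow> g t = h t" if "{a..b} \<subseteq> I" for a b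
    by (intro has_L2_deriv_on_unique_Icc[of u] has_L2_deriv_on_subset[OF assms(1)]
        has_L2_deriv_on_subset[OF assms(2)] that) simp_all
  define P where "P = {q \<in> \<rat> \<times> \<rat>. {fst q..snd q} \<subseteq> I}"
  have "countable (\<rat> \<times> \<rat> :: (real \<times> real) set)" by (intro countable_SIGMA countable_rat)
  then have "countable P" by (rule countable_subset[rotated]) (auto simp: P_def)
  moreover have "AE t in lborel. t \<in> {fst q..snd q} \<longrightarrow> g t = h t" if "q \<in> P" for q
    by (rule Icc) (use that in \<open>simp add: P_def\<close>)
  ultimately have rational: "AE t in lborel. \<forall>q\<in>P. t \<in> {fst q..snd q} \<longrightarrow> g t = h t"
    by (subst AE_ball_countable) blast+
  have "AE t in lborel. t \<notin> frontier I"
    using negligible_convex_frontier[of I] I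
    by (intro AE_not_in)
        (simp add: is_interval_convex_1 negligible_iff_null_sets null_sets_completion_iff)
  with rational show ?thesis
  proof eventually_elim
    case (elim t)
    show ?case
    proof
      assume "t \<in> I"
      then have t: "t \<in> interior I" using elim(2) closure_subset[of I] by (auto simp: frontier_def)
      have int: "is_interval (interior I)" using I by (simp add: is_interval_convex_1 convex_interior)
      obtain a b where ab: "{t} \<subseteq> {a<..<b}" "{a..b} \<subseteq> interior I"
        by (rule compact_subset_Ioo_in_open_interval[OF _ _ _ open_interior int, of "{t}"])
          (use t in simp_all)
      obtain q r where qr: "q \<in> \<rat>" "a < q" "q < t" "r \<in> \<rat>" "t < r" "r < b"
        using ab(1) Rats_dense_in_real[of a t] Rats_dense_in_real[of t b] by auto
      have "{q..r} \<subseteq> {a..b}" using qr by auto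
      then have "{q..r} \<subseteq> I" using ab(2) interior_subset[of I] by blast
      then have "(q, r) \<in> P" "t \<in> {q..r}" using qr by (auto simp: P_def)
      then show "g t = h t" using elim(1) by fastforce
    qed
  qed
qed

lemma H1_on_imp_has_L2_deriv_on_weak_deriv:
  assumes "continuous_on I u" "H1_on I u" "is_interval I"
  shows "has_L2_deriv_on u (weak_deriv I u) I"
proof -
  have "\<exists>g. L2_on I g \<and> has_weak_deriv_on u g I" using assms(2) by (simp add: H1_on_def)
  then have "L2_on I (weak_deriv I u) \<and> has_weak_deriv_on u (weak_deriv I u) I"
    unfolding weak_deriv_def by (rule someI_ex)
  then show ?thesis using has_weak_deriv_on_imp_has_L2_deriv_on[OF assms(1) _ _ assms(3)] by blast
qed

lemma has_L2_deriv_on_imp_H1_on: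
  assumes "L2_on I u" "has_L2_deriv_on u g I" "is_interval I"
  shows "H1_on I u"
  using assms has_L2_deriv_onD(1)[OF assms(2)] has_L2_deriv_on_imp_has_weak_deriv_on[OF assms(2,3)]
  by (auto simp: H1_on_def)

lemma sqnorm_weak_deriv:
  assumes "L2_on I u" and g: "has_L2_deriv_on u g I" and I: "is_interval I"
  shows "sqnorm I (weak_deriv I u) = sqnorm I g"
proof -
  have weak: "has_L2_deriv_on u (weak_deriv I u) I"
    by (rule H1_on_imp_has_L2_deriv_on_weak_deriv
        [OF has_L2_deriv_on_imp_continuous_on[OF g I] has_L2_deriv_on_imp_H1_on[OF assms] I])
  have "AE t in lborel. t \<in> I \<longrightarrow> (weak_deriv I u t)\<^sup>2 = (g t)\<^sup>2"
    using has_L2_deriv_on_unique[OF weak g I] by eventually_elim simp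
  then have "AE t in lborel. indicator I t *\<^sub>R (weak_deriv I u t)\<^sup>2 = indicator I t *\<^sub>R (g t)\<^sup>2"
    by eventually_elim (simp split: split_indicator)
  then show ?thesis
    unfolding set_lebesgue_integral_def
    using L2_onD(2)[OF has_L2_deriv_onD(1)[OF weak]] L2_onD(2)[OF has_L2_deriv_onD(1)[OF g]]
    by (intro integral_cong_AE) (auto simp: set_integrable_def)
qed

section \<open>Completeness of \<open>L\<^sup>2\<close>\<close>

lemma integrable_power2_diff:
  fixes f g :: "'a \<Rightarrow> real"
  assumes [measurable]: "f \<in> borel_measurable M" "g \<in> borel_measurable M"
    and "integrable M (\<lambda>x. (f x)\<^sup>2)" "integrable M (\<lambda>x. (g x)\<^sup>2)"
  shows "integrable M (\<lambda>x. (f x - g x)\<^sup>2)"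
  using assms(3,4) integral_Cauchy_Schwarz(1)[OF assms]
  by (simp add: power2_diff mult.assoc)

context sigma_finite_measure
begin

lemma exists_positive_square_integrable:
  obtains w :: "'a \<Rightarrow> real"
  where "w \<in> borel_measurable M" "\<And>x. x \<in> space M \<Longrightarrow> 0 < w x" "integrable M (\<lambda>x. (w x)\<^sup>2)"
proof -
  obtain h where h [measurable]: "h \<in> borel_measurable M" and fin: "(\<integral>\<^sup>+x. h x \<partial>M) \<noteq> \<infinity>"
    and pos: "\<And>x. x \<in> space M \<Longrightarrow> 0 < h x \<and> h x < \<infinity>"
    using Ex_finite_integrable_function by blast
  have "(\<integral>\<^sup>+x. ennreal ((sqrt (enn2real (h x)))\<^sup>2) \<partial>M) = (\<integral>\<^sup>+x. h x \<partial>M)"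
    using pos by (intro nn_integral_cong) simp
  then have "integrable M (\<lambda>x. (sqrt (enn2real (h x)))\<^sup>2)"
    using fin by (intro integrableI_nonneg) (auto simp: less_top)
  with that[of "\<lambda>x. sqrt (enn2real (h x))"] show thesis
    using pos by (simp add: enn2real_positive_iff)
qed

lemma L2_Cauchy_AE_Cauchy_subseq:
  fixes u :: "nat \<Rightarrow> 'a \<Rightarrow> real"
  assumes [measurable]: "\<And>n. u n \<in> borel_measurable M"
    and sq: "\<And>n. integrable M (\<lambda>x. (u n x)\<^sup>2)"
    and Cauchy: "\<And>e. 0 < e \<Longrightarrow> \<exists>N. \<forall>i\<ge>N. \<forall>j\<ge>N. (\<integral>x. (u i x - u j x)\<^sup>2 \<partial>M) < e"
  obtains r where "strict_mono r" "AE x in M. Cauchy (\<lambda>i. u (r i) x)"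
proof -
  obtain w :: "'a \<Rightarrow> real" where [measurable]: "w \<in> borel_measurable M"
    and w_pos: "\<And>x. x \<in> space M \<Longrightarrow> 0 < w x" and w: "integrable M (\<lambda>x. (w x)\<^sup>2)"
    using exists_positive_square_integrable by blast
  have "\<exists>N. \<forall>i\<ge>N. \<forall>j\<ge>N. (\<integral>x. norm (w x * u i x - w x * u j x) \<partial>M) < e" if e: "0 < e" for e
  proof -
    define W where "W = (\<integral>x. (w x)\<^sup>2 \<partial>M) + 1"
    have W: "0 < W" unfolding W_def by (rule add_nonneg_pos) simp_all
    obtain N where N: "\<And>i j. N \<le> i \<Longrightarrow> N \<le> j \<Longrightarrow> (\<integral>x. (u i x - u j x)\<^sup>2 \<partial>M) < e\<^sup>2 / W"
      using Cauchy[of "e\<^sup>2 / W"] e W by auto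
    have "(\<integral>x. norm (w x * u i x - w x * u j x) \<partial>M) < e" if ij: "N \<le> i" "N \<le> j" for i j
    proof (rule power2_less_imp_less)
      have "(\<integral>x. w x * \<bar>u i x - u j x\<bar> \<partial>M)\<^sup>2 \<le> (\<integral>x. (w x)\<^sup>2 \<partial>M) * (\<integral>x. (u i x - u j x)\<^sup>2 \<partial>M)"
        using integral_Cauchy_Schwarz(2)[of w M "\<lambda>x. \<bar>u i x - u j x\<bar>"] w
          integrable_power2_diff[OF _ _ sq sq]
        by simp
      also have "\<dots> \<le> W * (\<integral>x. (u i x - u j x)\<^sup>2 \<partial>M)"
        by (intro mult_right_mono) (simp_all add: W_def)
      also have "\<dots> < e\<^sup>2" using N[OF ij] W by (simp add: field_simps)
      also have "(\<integral>x. w x * \<bar>u i x - u j x\<bar> \<partial>M) = (\<integral>x. norm (w x * u i x - w x * u j x) \<partial>M)"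
        using w_pos by (intro Bochner_Integration.integral_cong)
          (auto simp: abs_mult less_imp_le simp flip: right_diff_distrib)
      finally show "(\<integral>x. norm (w x * u i x - w x * u j x) \<partial>M)\<^sup>2 < e\<^sup>2" .
    qed (use e in simp)
    then show ?thesis by blast
  qed
  then obtain r where r: "strict_mono r" "AE x in M. Cauchy (\<lambda>i. w x * u (r i) x)"
    by (rule cauchy_L1_AE_cauchy_subseq[rotated]) (simp_all add: integral_Cauchy_Schwarz(1)[OF _ _ w sq])
  from r(2) have "AE x in M. Cauchy (\<lambda>i. u (r i) x)"
    using AE_space
  proof eventually_elim
    case (elim x)
    then show ?case using w_pos[OF elim(2)]
      by (simp add: Cauchy_convergent_iff convergent_mult_const_iff)
  qed
  with r(1) show thesis by (rule that)
qed

lemma L2_Fatou: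
  fixes u :: "nat \<Rightarrow> 'a \<Rightarrow> real"
  assumes [measurable]: "\<And>n. u n \<in> borel_measurable M" "g \<in> borel_measurable M"
    and sq: "\<And>n. integrable M (\<lambda>x. (u n x)\<^sup>2)"
    and lim: "AE x in M. (\<lambda>n. u n x) \<longlonglongrightarrow> g x"
    and bound: "\<forall>\<^sub>F n in sequentially. (\<integral>x. (u n x)\<^sup>2 \<partial>M) \<le> B"
  shows "integrable M (\<lambda>x. (g x)\<^sup>2)" "(\<integral>x. (g x)\<^sup>2 \<partial>M) \<le> B"
proof -
  obtain n where "(\<integral>x. (u n x)\<^sup>2 \<partial>M) \<le> B" using eventually_happens[OF bound] by auto
  moreover have "0 \<le> (\<integral>x. (u n x)\<^sup>2 \<partial>M)" by simp
  ultimately have B: "0 \<le> B" by linarith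
  have "(\<integral>\<^sup>+x. ennreal ((g x)\<^sup>2) \<partial>M) = (\<integral>\<^sup>+x. liminf (\<lambda>n. ennreal ((u n x)\<^sup>2)) \<partial>M)"
  proof (rule nn_integral_cong_AE)
    show "AE x in M. ennreal ((g x)\<^sup>2) = liminf (\<lambda>n. ennreal ((u n x)\<^sup>2))"
      using lim
    proof eventually_elim
      case (elim x)
      have "(\<lambda>n. ennreal ((u n x)\<^sup>2)) \<longlonglongrightarrow> ennreal ((g x)\<^sup>2)"
        by (intro tendsto_ennrealI tendsto_power elim)
      from lim_imp_Liminf[OF _ this] show ?case by simp
    qed
  qed
  also have "\<dots> \<le> liminf (\<lambda>n. \<integral>\<^sup>+x. ennreal ((u n x)\<^sup>2) \<partial>M)"
    by (rule nn_integral_liminf) measurable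
  also have "\<dots> \<le> ennreal B"
  proof (rule Liminf_le)
    show "\<forall>\<^sub>F n in sequentially. (\<integral>\<^sup>+x. ennreal ((u n x)\<^sup>2) \<partial>M) \<le> ennreal B"
      using bound by eventually_elim (simp add: nn_integral_eq_integral[OF sq] ennreal_leI)
  qed simp
  finally have nn_integral_le: "(\<integral>\<^sup>+x. ennreal ((g x)\<^sup>2) \<partial>M) \<le> ennreal B" .
  then show int: "integrable M (\<lambda>x. (g x)\<^sup>2)"
    by (intro integrableI_nonneg) (auto intro: le_less_trans)
  show "(\<integral>x. (g x)\<^sup>2 \<partial>M) \<le> B"
    using nn_integral_le B by (simp add: nn_integral_eq_integral[OF int])
qed

lemma L2_Cauchy_close_to_limit:
  fixes u :: "nat \<Rightarrow> 'a \<Rightarrow> real"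
  assumes [measurable]: "\<And>n. u n \<in> borel_measurable M" "g \<in> borel_measurable M"
    and sq: "\<And>n. integrable M (\<lambda>x. (u n x)\<^sup>2)"
    and Cauchy: "\<And>e. 0 < e \<Longrightarrow> \<exists>N. \<forall>i\<ge>N. \<forall>j\<ge>N. (\<integral>x. (u i x - u j x)\<^sup>2 \<partial>M) < e"
    and r: "strict_mono r" "AE x in M. (\<lambda>i. u (r i) x) \<longlonglongrightarrow> g x" and e: "0 < e"
  shows "\<exists>N. \<forall>j\<ge>N. integrable M (\<lambda>x. (g x - u j x)\<^sup>2) \<and> (\<integral>x. (g x - u j x)\<^sup>2 \<partial>M) \<le> e"
proof -
  obtain N where N: "\<And>i j. N \<le> i \<Longrightarrow> N \<le> j \<Longrightarrow> (\<integral>x. (u i x - u j x)\<^sup>2 \<partial>M) < e"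
    using Cauchy[OF e] by auto
  have "integrable M (\<lambda>x. (g x - u j x)\<^sup>2) \<and> (\<integral>x. (g x - u j x)\<^sup>2 \<partial>M) \<le> e" if j: "N \<le> j" for j
  proof -
    have "AE x in M. (\<lambda>i. u (r i) x - u j x) \<longlonglongrightarrow> g x - u j x"
      using r(2) by eventually_elim (intro tendsto_intros)
    moreover have "\<forall>\<^sub>F i in sequentially. (\<integral>x. (u (r i) x - u j x)\<^sup>2 \<partial>M) \<le> e"
      using N[OF _ j] seq_suble[OF r(1)]
      by (intro eventually_sequentiallyI[of N]) (meson less_imp_le order_trans)
    ultimately show ?thesis
      using L2_Fatou[of "\<lambda>i x. u (r i) x - u j x" "\<lambda>x. g x - u j x" e]
        integrable_power2_diff[OF _ _ sq sq]
      by auto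
  qed
  then show ?thesis by blast
qed

lemma Riesz_Fischer_L2:
  fixes u :: "nat \<Rightarrow> 'a \<Rightarrow> real"
  assumes [measurable]: "\<And>n. u n \<in> borel_measurable M"
    and sq: "\<And>n. integrable M (\<lambda>x. (u n x)\<^sup>2)"
    and Cauchy: "\<And>e. 0 < e \<Longrightarrow> \<exists>N. \<forall>i\<ge>N. \<forall>j\<ge>N. (\<integral>x. (u i x - u j x)\<^sup>2 \<partial>M) < e"
  obtains g where "g \<in> borel_measurable M" "integrable M (\<lambda>x. (g x)\<^sup>2)"
    "(\<lambda>n. \<integral>x. (g x - u n x)\<^sup>2 \<partial>M) \<longlonglongrightarrow> 0"
    "\<And>B. (\<And>n. (\<integral>x. (u n x)\<^sup>2 \<partial>M) \<le> B) \<Longrightarrow> (\<integral>x. (g x)\<^sup>2 \<partial>M) \<le> B"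
proof -
  obtain r where r: "strict_mono r" "AE x in M. Cauchy (\<lambda>i. u (r i) x)"
    by (rule L2_Cauchy_AE_Cauchy_subseq[OF assms])
  define g where "g x = lim (\<lambda>i. u (r i) x)" for x
  have [measurable]: "g \<in> borel_measurable M" unfolding g_def by measurable
  from r(2) have lim: "AE x in M. (\<lambda>i. u (r i) x) \<longlonglongrightarrow> g x"
    unfolding g_def by eventually_elim (simp add: Cauchy_convergent_iff convergent_LIMSEQ_iff)
  have close: "\<exists>N. \<forall>j\<ge>N. integrable M (\<lambda>x. (g x - u j x)\<^sup>2) \<and> (\<integral>x. (g x - u j x)\<^sup>2 \<partial>M) \<le> e"
    if "0 < e" for e
    by (rule L2_Cauchy_close_to_limit[OF _ _ sq Cauchy r(1) lim that]) simp_all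
  obtain j where "integrable M (\<lambda>x. (g x - u j x)\<^sup>2)" using close[of 1] by auto
  then have g: "integrable M (\<lambda>x. (g x)\<^sup>2)"
    using integrable_power2_diff[of "\<lambda>x. g x - u j x" M "\<lambda>x. - u j x"] sq by simp
  show thesis
  proof (rule that[OF _ g])
    show "(\<lambda>n. \<integral>x. (g x - u n x)\<^sup>2 \<partial>M) \<longlonglongrightarrow> 0"
    proof (rule LIMSEQ_I)
      fix e :: real assume "0 < e"
      then obtain N where "\<forall>j\<ge>N. (\<integral>x. (g x - u j x)\<^sup>2 \<partial>M) \<le> e / 2" using close[of "e / 2"] by auto
      with \<open>0 < e\<close> show "\<exists>N. \<forall>n\<ge>N. norm ((\<integral>x. (g x - u n x)\<^sup>2 \<partial>M) - 0) < e" by fastforce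
    qed
    show "(\<integral>x. (g x)\<^sup>2 \<partial>M) \<le> B" if "\<And>n. (\<integral>x. (u n x)\<^sup>2 \<partial>M) \<le> B" for B
      by (rule L2_Fatou(2)[OF _ _ sq lim]) (use that in auto)
  qed simp
qed

end

lemma sqnorm_le_integral:
  assumes "A \<in> sets lborel" "integrable lborel (\<lambda>x. (f x)\<^sup>2)"
  shows "sqnorm A f \<le> (\<integral>x. (f x)\<^sup>2 \<partial>lborel)"
  using set_integral_mono_set[of lborel UNIV "\<lambda>x. (f x)\<^sup>2" A] assms
  by (simp add: set_integrable_def set_lebesgue_integral_def)

lemma L2_on_complete:
  assumes A: "A \<in> sets lborel" and u: "\<And>n. L2_on A (u n)"
    and Cauchy: "\<And>e. 0 < e \<Longrightarrow> \<exists>N. \<forall>i\<ge>N. \<forall>j\<ge>N. sqnorm A (\<lambda>x. u i x - u j x) < e"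
  obtains g where "L2_on A g" "(\<lambda>n. sqnorm A (\<lambda>x. g x - u n x)) \<longlonglongrightarrow> 0"
    "\<And>B. (\<And>n. sqnorm A (u n) \<le> B) \<Longrightarrow> sqnorm A g \<le> B"
proof -
  define v where "v n x = indicator A x * u n x" for n x
  have sq: "(\<lambda>x. (indicator A x * h x)\<^sup>2) = (\<lambda>x. indicator A x *\<^sub>R (h x)\<^sup>2)" for h :: "real \<Rightarrow> real"
    by (auto split: split_indicator)
  have [measurable]: "v n \<in> borel_measurable lborel" for n
    using L2_onD(1)[OF u] by (simp add: v_def[abs_def])
  have v: "integrable lborel (\<lambda>x. (v n x)\<^sup>2)" for n
    using L2_onD(2)[OF u] by (simp add: v_def sq set_integrable_def)
  have "(\<integral>x. (v i x - v j x)\<^sup>2 \<partial>lborel) = sqnorm A (\<lambda>x. u i x - u j x)" for i j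
    unfolding v_def right_diff_distrib[symmetric] sq set_lebesgue_integral_def ..
  then obtain h where h: "h \<in> borel_measurable lborel" "integrable lborel (\<lambda>x. (h x)\<^sup>2)"
    "(\<lambda>n. \<integral>x. (h x - v n x)\<^sup>2 \<partial>lborel) \<longlonglongrightarrow> 0"
    "\<And>B. (\<And>n. (\<integral>x. (v n x)\<^sup>2 \<partial>lborel) \<le> B) \<Longrightarrow> (\<integral>x. (h x)\<^sup>2 \<partial>lborel) \<le> B"
    using lborel.Riesz_Fischer_L2[of v, OF _ v] Cauchy by auto
  show thesis
  proof (rule that)
    have "L2_on UNIV h" using h(1,2) by (simp add: L2_on_def set_borel_measurable_def set_integrable_def)
    then show "L2_on A h" using A by (rule L2_on_subset) simp
    have "sqnorm A (\<lambda>x. h x - u n x) \<le> (\<integral>x. (h x - v n x)\<^sup>2 \<partial>lborel)" for n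
    proof -
      have "sqnorm A (\<lambda>x. h x - u n x) = sqnorm A (\<lambda>x. h x - v n x)"
        using A by (intro set_lebesgue_integral_cong) (auto simp: v_def)
      also have "\<dots> \<le> (\<integral>x. (h x - v n x)\<^sup>2 \<partial>lborel)"
        by (intro sqnorm_le_integral A integrable_power2_diff h(1,2) v) simp
      finally show ?thesis .
    qed
    then show "(\<lambda>n. sqnorm A (\<lambda>x. h x - u n x)) \<longlonglongrightarrow> 0"
      by (intro tendsto_sandwich[OF _ _ tendsto_const h(3)]) simp_all
    show "sqnorm A h \<le> B" if B: "\<And>n. sqnorm A (u n) \<le> B" for B
    proof -
      have "(\<integral>x. (v n x)\<^sup>2 \<partial>lborel) \<le> B" for n
        using B[of n] by (simp add: v_def sq set_lebesgue_integral_def)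
      from h(4)[OF this] sqnorm_le_integral[OF A h(2)] show ?thesis by linarith
    qed
  qed
qed

section \<open>The Riesz criterion for a square-integrable derivative\<close>

lemma UN_initial_segments: "(\<Union>n. {0..<real n}) = {0..}"
  by (auto intro: reals_Archimedean2)

lemma set_integrable_Ici_if_bounded_integrals:
  fixes F :: "real \<Rightarrow> real"
  assumes int: "\<And>n. set_integrable lborel {0..<real n} F" and nonneg: "\<And>x. 0 \<le> x \<Longrightarrow> 0 \<le> F x"
    and bound: "\<And>n. (LINT x:{0..<real n}|lborel. F x) \<le> C"
  shows "set_integrable lborel {0..} F"
proof -
  have "incseq (\<lambda>n. LINT x:{0..<real n}|lborel. F x)"
    using nonneg by (intro incseq_SucI set_integral_mono_set int) auto
  then obtain L where "(\<lambda>n. LINT x:{0..<real n}|lborel. F x) \<longlonglongrightarrow> L"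
    using bound incseq_convergent by metis
  then have "set_integrable lborel (\<Union>n. {0..<real n}) F"
    using nonneg int by (intro pos_integrable_to_top) (auto simp: mono_def)
  then show ?thesis by (simp only: UN_initial_segments)
qed

lemma set_integral_initial_segments_tendsto:
  fixes F :: "real \<Rightarrow> real"
  assumes "set_integrable lborel {0..} F"
  shows "(\<lambda>n. LINT x:{0..<real n}|lborel. F x) \<longlonglongrightarrow> (LINT x:{0..}|lborel. F x)"
  using set_integral_cont_up[of "\<lambda>n. {0..<real n}" lborel F] assms
  by (simp add: UN_initial_segments incseq_def)

lemma dyadic_approximation_tendsto:
  assumes "0 \<le> y"
  shows "(\<lambda>n. real (nat \<lfloor>y * 2 ^ n\<rfloor>) / 2 ^ n) \<longlonglongrightarrow> y"
proof (rule tendsto_sandwich)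
  have floor: "real (nat \<lfloor>y * 2 ^ n\<rfloor>) = of_int \<lfloor>y * 2 ^ n\<rfloor>" for n using assms by simp
  show "\<forall>\<^sub>F n in sequentially. y - inverse (2 ^ n) \<le> real (nat \<lfloor>y * 2 ^ n\<rfloor>) / 2 ^ n"
  proof (intro always_eventually allI)
    fix n
    have "(y * 2 ^ n - 1) / 2 ^ n \<le> of_int \<lfloor>y * 2 ^ n\<rfloor> / 2 ^ n"
      by (rule divide_right_mono) (linarith, simp)
    then show "y - inverse (2 ^ n) \<le> real (nat \<lfloor>y * 2 ^ n\<rfloor>) / 2 ^ n"
      unfolding floor by (simp add: diff_divide_distrib inverse_eq_divide)
  qed
  show "\<forall>\<^sub>F n in sequentially. real (nat \<lfloor>y * 2 ^ n\<rfloor>) / 2 ^ n \<le> y"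
    unfolding floor by (intro always_eventually) (simp add: field_simps)
  show "(\<lambda>n. y - inverse (2 ^ n)) \<longlonglongrightarrow> y"
    using tendsto_diff[OF tendsto_const LIMSEQ_inverse_realpow_zero[of 2], of y] by simp
qed simp

definition cell :: "nat \<Rightarrow> nat \<Rightarrow> real set" where
  "cell n k = {real k / 2 ^ n..<real (Suc k) / 2 ^ n}"

lemma cell_sets [measurable]: "cell n k \<in> sets borel"
  by (simp add: cell_def)

lemma cell_Suc: "cell n k = cell (Suc n) (2 * k) \<union> cell (Suc n) (Suc (2 * k))"
  and cell_Suc_disjoint: "cell (Suc n) (2 * k) \<inter> cell (Suc n) (Suc (2 * k)) = {}"
proof -
  have "real (2 * k) / 2 ^ Suc n = real k / 2 ^ n"
      "real (Suc (Suc (2 * k))) / 2 ^ Suc n = real (Suc k) / 2 ^ n"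
    by (simp_all add: field_simps)
  then show "cell n k = cell (Suc n) (2 * k) \<union> cell (Suc n) (Suc (2 * k))"
    unfolding cell_def by (subst ivl_disj_un_two(3)) (auto simp: field_simps)
  show "cell (Suc n) (2 * k) \<inter> cell (Suc n) (Suc (2 * k)) = {}"
    by (auto simp: cell_def)
qed

lemma measure_cell: "measure lborel (cell n k) = 1 / 2 ^ n"
  and emeasure_cell_finite: "emeasure lborel (cell n k) < \<infinity>"
  by (simp_all add: cell_def divide_right_mono flip: diff_divide_distrib)

lemma nat_floor_cell: "x \<in> cell n k \<Longrightarrow> nat \<lfloor>x * 2 ^ n\<rfloor> = k"
  using floor_unique[of "int k" "x * 2 ^ n"] by (simp add: cell_def field_simps)

lemma set_integral_cells:
  fixes F :: "real \<Rightarrow> real"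
  assumes "set_integrable lborel {0..<real k / 2 ^ n} F"
  shows "(LINT x:{0..<real k / 2 ^ n}|lborel. F x) = (\<Sum>i<k. LINT x:cell n i|lborel. F x)"
  using assms
proof (induction k)
  case (Suc k)
  have split: "{0..<real (Suc k) / 2 ^ n} = {0..<real k / 2 ^ n} \<union> cell n k"
    unfolding cell_def by (subst ivl_disj_un_two(3)) (auto simp: divide_right_mono)
  then have int: "set_integrable lborel {0..<real k / 2 ^ n} F" "set_integrable lborel (cell n k) F"
    using Suc.prems by (auto intro: set_integrable_subset)
  have "(LINT x:{0..<real (Suc k) / 2 ^ n}|lborel. F x)
      = (LINT x:{0..<real k / 2 ^ n}|lborel. F x) + (LINT x:cell n k|lborel. F x)"
    unfolding split by (rule set_integral_Un[OF _ int]) (auto simp: cell_def)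
  then show ?case using Suc.IH[OF int(1)] by simp
qed (simp add: set_lebesgue_integral_def)

locale riesz_increments =
  fixes f \<kappa> :: "real \<Rightarrow> real" and C :: real
  assumes increment: "\<And>x y. 0 \<le> x \<Longrightarrow> x \<le> y \<Longrightarrow> (f y - f x)\<^sup>2 \<le> (y - x) * (\<kappa> y - \<kappa> x)"
    and bound: "\<And>x. 0 \<le> x \<Longrightarrow> \<kappa> x - \<kappa> 0 \<le> C"
begin

lemma \<kappa>_mono: "0 \<le> x \<Longrightarrow> x \<le> y \<Longrightarrow> \<kappa> x \<le> \<kappa> y"
  using order_trans[OF zero_le_power2 increment[of x y]]
  by (cases "x = y") (auto simp: zero_le_mult_iff)

lemma Hoelder:
  assumes "x \<in> {0..}" "y \<in> {0..}"
  shows "(f y - f x)\<^sup>2 \<le> \<bar>y - x\<bar> * C"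
proof -
  have "(f t - f s)\<^sup>2 \<le> (t - s) * C" if "0 \<le> s" "s \<le> t" for s t
  proof -
    have "\<kappa> t - \<kappa> s \<le> C" using bound[of t] \<kappa>_mono[of 0 s] that by simp
    then have "(t - s) * (\<kappa> t - \<kappa> s) \<le> (t - s) * C" using that by (intro mult_left_mono) auto
    with increment[OF that] show ?thesis by linarith
  qed
  from this[of x y] this[of y x] assms show ?thesis
    by (cases "x \<le> y") (auto simp: power2_commute)
qed

definition slope :: "nat \<Rightarrow> nat \<Rightarrow> real" where
  "slope n k = 2 ^ n * (f (real (Suc k) / 2 ^ n) - f (real k / 2 ^ n))"

definition dyadic_slope :: "nat \<Rightarrow> real \<Rightarrow> real" where
  "dyadic_slope n x = slope n (nat \<lfloor>x * 2 ^ n\<rfloor>)"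

lemma dyadic_slope_measurable [measurable]: "dyadic_slope n \<in> borel_measurable borel"
  unfolding dyadic_slope_def by measurable

lemma dyadic_slope_cell: "x \<in> cell n k \<Longrightarrow> dyadic_slope n x = slope n k"
  by (simp add: dyadic_slope_def nat_floor_cell)

lemma slope_power2_le: "(slope n k)\<^sup>2 \<le> 2 ^ n * (\<kappa> (real (Suc k) / 2 ^ n) - \<kappa> (real k / 2 ^ n))"
proof -
  have "(f (real (Suc k) / 2 ^ n) - f (real k / 2 ^ n))\<^sup>2
      \<le> 1 / 2 ^ n * (\<kappa> (real (Suc k) / 2 ^ n) - \<kappa> (real k / 2 ^ n))"
    using increment[of "real k / 2 ^ n" "real (Suc k) / 2 ^ n"]
    by (simp add: divide_right_mono flip: diff_divide_distrib)
  then have "(2 ^ n)\<^sup>2 * (f (real (Suc k) / 2 ^ n) - f (real k / 2 ^ n))\<^sup>2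
      \<le> (2 ^ n)\<^sup>2 * (1 / 2 ^ n * (\<kappa> (real (Suc k) / 2 ^ n) - \<kappa> (real k / 2 ^ n)))"
    by (rule mult_left_mono) simp
  then show ?thesis by (simp add: slope_def power_mult_distrib) (simp add: power2_eq_square)
qed

lemma dyadic_slope_power2_le: "(dyadic_slope n x)\<^sup>2 \<le> 2 ^ n * C"
proof -
  have "\<kappa> (real (Suc k) / 2 ^ n) - \<kappa> (real k / 2 ^ n) \<le> C" for k
    using bound[of "real (Suc k) / 2 ^ n"] \<kappa>_mono[of 0 "real k / 2 ^ n"] by simp
  then show ?thesis
    unfolding dyadic_slope_def by (intro order_trans[OF slope_power2_le] mult_left_mono) simp_all
qed

lemma L2_on_dyadic_slope:
  assumes "A \<in> sets lborel" "emeasure lborel A < \<infinity>"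
  shows "L2_on A (dyadic_slope n)"
  unfolding L2_on_def
proof
  show "set_borel_measurable lborel A (dyadic_slope n)"
    using assms(1) by (simp add: set_borel_measurable_def)
  show "set_integrable lborel A (\<lambda>x. (dyadic_slope n x)\<^sup>2)"
  proof (rule set_integrable_bound[OF set_integrable_const[OF assms, of "2 ^ n * C"]])
    show "set_borel_measurable lborel A (\<lambda>x. (dyadic_slope n x)\<^sup>2)"
      using assms(1) by (simp add: set_borel_measurable_def)
    show "AE x in lborel. x \<in> A \<longrightarrow> norm ((dyadic_slope n x)\<^sup>2) \<le> norm (2 ^ n * C)"
      by (intro AE_I2 impI) (simp add: order_trans[OF dyadic_slope_power2_le abs_ge_self])
  qed
qed

lemma L2_on_dyadic_slope_cell: "L2_on (cell m k) (dyadic_slope n)"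
  by (rule L2_on_dyadic_slope[OF _ emeasure_cell_finite]) simp

lemma set_integrable_dyadic_slope_cell: "set_integrable lborel (cell m k) (dyadic_slope n)"
  by (rule L2_on_set_integrable[OF L2_on_dyadic_slope_cell _ subset_refl emeasure_cell_finite]) simp

lemma integral_dyadic_slope_cell:
  "(LINT x:cell n k|lborel. dyadic_slope (n + j) x) = f (real (Suc k) / 2 ^ n) - f (real k / 2 ^ n)"
proof (induction j arbitrary: n k)
  case 0
  have "(LINT x:cell n k|lborel. dyadic_slope n x) = (LINT x:cell n k|lborel. slope n k)"
    by (intro set_lebesgue_integral_cong) (auto simp: dyadic_slope_cell)
  then show ?case
    using emeasure_cell_finite by (simp add: set_integral_const measure_cell slope_def less_top)
next
  case (Suc j)
  note int = set_integrable_dyadic_slope_cell[of _ _ "Suc n + j"]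
  have "(LINT x:cell n k|lborel. dyadic_slope (Suc n + j) x)
      = (LINT x:cell (Suc n) (2 * k)|lborel. dyadic_slope (Suc n + j) x)
        + (LINT x:cell (Suc n) (Suc (2 * k))|lborel. dyadic_slope (Suc n + j) x)"
    unfolding cell_Suc[of n k] by (rule set_integral_Un[OF cell_Suc_disjoint int int])
  also have "\<dots> = f (real (Suc (Suc (2 * k))) / 2 ^ Suc n) - f (real (2 * k) / 2 ^ Suc n)"
    unfolding Suc.IH by simp
  also have "real (Suc (Suc (2 * k))) / 2 ^ Suc n = real (Suc k) / 2 ^ n"
    by (simp add: field_simps)
  finally show ?case by simp
qed

lemma sqnorm_dyadic_slope_diff_cell:
  "sqnorm (cell n k) (\<lambda>x. dyadic_slope (n + j) x - dyadic_slope n x)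
    = sqnorm (cell n k) (dyadic_slope (n + j)) - sqnorm (cell n k) (dyadic_slope n)"
proof -
  let ?s = "dyadic_slope (n + j)" and ?c = "slope n k"
  have int: "set_integrable lborel (cell n k) (\<lambda>x. (?s x)\<^sup>2)" "set_integrable lborel (cell n k) (\<lambda>x. ?c\<^sup>2)"
    by (rule L2_onD(2)[OF L2_on_dyadic_slope_cell], rule
        set_integrable_const[OF _ emeasure_cell_finite]) simp
  have const: "(LINT x:cell n k|lborel. c) = c / 2 ^ n" for c :: real
    using emeasure_cell_finite by (simp add: set_integral_const measure_cell less_top)
  have "sqnorm (cell n k) (\<lambda>x. ?s x - dyadic_slope n x)
      = (LINT x:cell n k|lborel. (?s x)\<^sup>2 - 2 * ?c * ?s x + ?c\<^sup>2)"
    by (intro set_lebesgue_integral_cong) (auto simp: dyadic_slope_cell power2_diff algebra_simps)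
  also have "\<dots> = sqnorm (cell n k) ?s - 2 * ?c * (?c / 2 ^ n) + ?c\<^sup>2 / 2 ^ n"
    using int set_integrable_dyadic_slope_cell[of n k "n + j"]
    by (simp add: integral_dyadic_slope_cell const slope_def)
  also have "?c\<^sup>2 / 2 ^ n = sqnorm (cell n k) (dyadic_slope n)"
    unfolding const[symmetric] by (intro set_lebesgue_integral_cong) (auto simp: dyadic_slope_cell)
  moreover have "2 * ?c * (?c / 2 ^ n) = 2 * (?c\<^sup>2 / 2 ^ n)" by (simp add: power2_eq_square)
  ultimately show ?thesis by simp
qed

lemma L2_on_dyadic_slope_initial: "L2_on {0..<t} (dyadic_slope n)"
  by (rule L2_on_dyadic_slope) (cases "0 \<le> t"; simp)+



lemma sqnorm_dyadic_slope_diff_initial: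
  "sqnorm {0..<real N} (\<lambda>x. dyadic_slope (n + j) x - dyadic_slope n x)
    = sqnorm {0..<real N} (dyadic_slope (n + j)) - sqnorm {0..<real N} (dyadic_slope n)"
proof -
  have N: "real N = real (N * 2 ^ n) / 2 ^ n" by simp
  show ?thesis
    unfolding N using L2_onD(2)[OF L2_on_diff] L2_onD(2) L2_on_dyadic_slope_initial
    by (simp only: set_integral_cells sqnorm_dyadic_slope_diff_cell sum_subtractf)
qed

lemma sqnorm_dyadic_slope_initial_le: "sqnorm {0..<real N} (dyadic_slope n) \<le> C"
proof -
  have N: "real N = real (N * 2 ^ n) / 2 ^ n" by simp
  have "sqnorm (cell n k) (dyadic_slope n) \<le> \<kappa> (real (Suc k) / 2 ^ n) - \<kappa> (real k / 2 ^ n)" for k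
  proof -
    have "sqnorm (cell n k) (dyadic_slope n) = (LINT x:cell n k|lborel. (slope n k)\<^sup>2)"
      by (intro set_lebesgue_integral_cong) (auto simp: dyadic_slope_cell)
    also have "\<dots> = (slope n k)\<^sup>2 / 2 ^ n"
      using emeasure_cell_finite by (simp add: set_integral_const measure_cell less_top)
    finally show ?thesis using slope_power2_le[of n k] by (simp add: pos_divide_le_eq mult.commute)
  qed
  then have "sqnorm {0..<real N} (dyadic_slope n)
      \<le> (\<Sum>k<N * 2 ^ n. \<kappa> (real (Suc k) / 2 ^ n) - \<kappa> (real k / 2 ^ n))"
    unfolding N
    by (subst set_integral_cells) (auto intro: sum_mono L2_onD(2)[OF L2_on_dyadic_slope_initial])
  also have "\<dots> = \<kappa> (real N) - \<kappa> 0"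
    using sum_lessThan_telescope[of "\<lambda>k. \<kappa> (real k / 2 ^ n)" "N * 2 ^ n"] by simp
  also have "\<dots> \<le> C" by (rule bound) simp
  finally show ?thesis .
qed

lemma L2_on_dyadic_slope_Ici: "L2_on {0..} (dyadic_slope n)"
  unfolding L2_on_def set_borel_measurable_def
  using set_integrable_Ici_if_bounded_integrals[OF L2_onD(2)[OF L2_on_dyadic_slope_initial] _
      sqnorm_dyadic_slope_initial_le]
  by simp

lemma sqnorm_dyadic_slope_le: "sqnorm {0..} (dyadic_slope n) \<le> C"
  by (rule LIMSEQ_le_const2)
    (rule set_integral_initial_segments_tendsto[OF L2_onD(2)[OF L2_on_dyadic_slope_Ici]],
      use sqnorm_dyadic_slope_initial_le in blast)

lemma sqnorm_dyadic_slope_diff: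
  "sqnorm {0..} (\<lambda>x. dyadic_slope (n + j) x - dyadic_slope n x)
    = sqnorm {0..} (dyadic_slope (n + j)) - sqnorm {0..} (dyadic_slope n)"
proof -
  have "set_integrable lborel {0..} (\<lambda>x. (dyadic_slope (n + j) x - dyadic_slope n x)\<^sup>2)"
    by (intro L2_onD(2)[OF L2_on_diff] L2_on_dyadic_slope_Ici)
  from set_integral_initial_segments_tendsto[OF this]
  have "(\<lambda>N. sqnorm {0..<real N} (dyadic_slope (n + j)) - sqnorm {0..<real N} (dyadic_slope n))
      \<longlonglongrightarrow> sqnorm {0..} (\<lambda>x. dyadic_slope (n + j) x - dyadic_slope n x)"
    by (simp only: sqnorm_dyadic_slope_diff_initial)
  moreover have "(\<lambda>N. sqnorm {0..<real N} (dyadic_slope (n + j)) - sqnorm {0..<real N} (dyadic_slope n))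
      \<longlonglongrightarrow> sqnorm {0..} (dyadic_slope (n + j)) - sqnorm {0..} (dyadic_slope n)"
    by (intro tendsto_diff set_integral_initial_segments_tendsto L2_onD(2)[OF L2_on_dyadic_slope_Ici])
  ultimately show ?thesis by (rule LIMSEQ_unique)
qed

lemma dyadic_slope_Cauchy:
  assumes e: "0 < e"
  shows "\<exists>N. \<forall>i\<ge>N. \<forall>j\<ge>N. sqnorm {0..} (\<lambda>x. dyadic_slope i x - dyadic_slope j x) < e"
proof -
  define A where "A n = sqnorm {0..} (dyadic_slope n)" for n
  have A_diff: "sqnorm {0..} (\<lambda>x. dyadic_slope j x - dyadic_slope i x) = A j - A i" if "i \<le> j" for i j
    using sqnorm_dyadic_slope_diff[of i "j - i"] that by (simp add: A_def)
  have "A n \<le> A (Suc n)" for n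
  proof -
    have "0 \<le> sqnorm {0..} (\<lambda>x. dyadic_slope (Suc n) x - dyadic_slope n x)" by simp
    then show ?thesis using A_diff[of n "Suc n"] by simp
  qed
  then have "incseq A" by (rule incseq_SucI)
  then have "Cauchy A"
    using sqnorm_dyadic_slope_le by (metis A_def incseq_convergent LIMSEQ_imp_Cauchy)
  then obtain N where N: "\<And>i j. N \<le> i \<Longrightarrow> N \<le> j \<Longrightarrow> norm (A i - A j) < e"
    using CauchyD[OF _ e] by blast
  have "sqnorm {0..} (\<lambda>x. dyadic_slope i x - dyadic_slope j x) < e" if "N \<le> i" "N \<le> j" for i j
    using N[OF that] A_diff[of i j] A_diff[of j i]
    by (cases "i \<le> j") (auto simp: power2_commute[of "dyadic_slope i _"])
  then show ?thesis by blast
qed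

lemma integral_dyadic_slope_initial:
  "(LINT x:{0..<real k / 2 ^ m}|lborel. dyadic_slope (m + n) x) = f (real k / 2 ^ m) - f 0"
proof -
  have "set_integrable lborel {0..<real k / 2 ^ m} (dyadic_slope (m + n))"
    by (rule L2_on_set_integrable[OF L2_on_dyadic_slope_initial]) auto
  then have "(LINT x:{0..<real k / 2 ^ m}|lborel. dyadic_slope (m + n) x)
      = (\<Sum>i<k. f (real (Suc i) / 2 ^ m) - f (real i / 2 ^ m))"
    by (simp only: set_integral_cells integral_dyadic_slope_cell)
  then show ?thesis using sum_lessThan_telescope[of "\<lambda>i. f (real i / 2 ^ m)" k] by simp
qed

lemma integral_L2_limit_eq_increment:
  assumes g: "L2_on {0..} g" and lim: "(\<lambda>n. sqnorm {0..} (\<lambda>x. g x - dyadic_slope n x)) \<longlonglongrightarrow> 0"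
  shows "(LINT x:{0..<real k / 2 ^ m}|lborel. g x) = f (real k / 2 ^ m) - f 0"
proof -
  let ?y = "real k / 2 ^ m"
  have diff: "L2_on {0..} (\<lambda>x. g x - dyadic_slope n x)" for n
    by (rule L2_on_diff[OF g L2_on_dyadic_slope_Ici])
  have int: "set_integrable lborel {0..<?y} h" if "L2_on {0..} h" for h
    by (rule L2_on_set_integrable[OF that]) auto
  have sub: "{0..<?y} \<subseteq> {0..}" by auto
  have bound: "\<bar>(LINT x:{0..<?y}|lborel. g x) - (f ?y - f 0)\<bar>
      \<le> sqrt (?y * sqnorm {0..} (\<lambda>x. g x - dyadic_slope (m + n) x))"
    for n
  proof (rule real_le_rsqrt)
    have "(LINT x:{0..<?y}|lborel. g x) - (f ?y - f 0)
        = (LINT x:{0..<?y}|lborel. g x - dyadic_slope (m + n) x)"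
      using int[OF g] int[OF L2_on_dyadic_slope_Ici, of "m + n"]
      by (simp add: integral_dyadic_slope_initial)
    also have "\<dots>\<^sup>2 \<le> ?y * sqnorm {0..<?y} (\<lambda>x. g x - dyadic_slope (m + n) x)"
      using set_integral_power2_le[OF diff _ sub, of "m + n"] by simp
    also have "\<dots> \<le> ?y * sqnorm {0..} (\<lambda>x. g x - dyadic_slope (m + n) x)"
      by (intro mult_left_mono sqnorm_mono[OF diff]) auto
    finally show "\<bar>(LINT x:{0..<?y}|lborel. g x) - (f ?y - f 0)\<bar>\<^sup>2
        \<le> ?y * sqnorm {0..} (\<lambda>x. g x - dyadic_slope (m + n) x)" by simp
  qed
  have "(\<lambda>n. sqrt (?y * sqnorm {0..} (\<lambda>x. g x - dyadic_slope (m + n) x))) \<longlonglongrightarrow> sqrt (?y * 0)"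
    using LIMSEQ_ignore_initial_segment[OF lim, of m]
    by (intro tendsto_real_sqrt tendsto_mult tendsto_const) (simp add: add.commute)
  then have "\<bar>(LINT x:{0..<?y}|lborel. g x) - (f ?y - f 0)\<bar> \<le> sqrt (?y * 0)"
    by (rule LIMSEQ_le_const) (use bound in blast)
  then show ?thesis by simp
qed

lemma has_L2_deriv_on_Ici_0:
  obtains g where "has_L2_deriv_on f g {0..}" "sqnorm {0..} g \<le> C"
proof -
  obtain g where g: "L2_on {0..} g" "sqnorm {0..} g \<le> C"
    and lim: "(\<lambda>n. sqnorm {0..} (\<lambda>x. g x - dyadic_slope n x)) \<longlonglongrightarrow> 0"
    by (rule L2_on_complete[OF _ L2_on_dyadic_slope_Ici dyadic_slope_Cauchy])
      (simp_all add: sqnorm_dyadic_slope_le)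
  define G where "G y = (LINT x:{0..y}|lborel. g x)" for y
  have "G y - G x = (LINT t:{x..y}|lborel. g t)" if "0 \<le> x" "x \<le> y" for x y
    using set_integral_Icc_split[OF L2_on_set_integrable_Icc[OF g(1)], of 0 y x] that
    by (simp add: G_def)
  then have G: "has_L2_deriv_on G g {0..}" using g(1) by (simp add: has_L2_deriv_on_def)
  have dyadic: "G (real k / 2 ^ m) = f (real k / 2 ^ m) - f 0" for k m
    unfolding G_def integral_L2_limit_eq_increment[OF g(1) lim, symmetric]
    by (rule set_integral_discrete_difference[of "{real k / 2 ^ m}"]) auto
  have "G y = f y - f 0" if y: "0 \<le> y" for y
  proof (rule LIMSEQ_unique)
    let ?y = "\<lambda>n. real (nat \<lfloor>y * 2 ^ n\<rfloor>) / 2 ^ n"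
    have tendsto: "(\<lambda>n. h (?y n)) \<longlonglongrightarrow> h y" if "continuous_on {0..} h" for h :: "real \<Rightarrow> real"
      using y by (intro continuous_on_tendsto_compose[OF that dyadic_approximation_tendsto]) auto
    show "(\<lambda>n. G (?y n)) \<longlonglongrightarrow> G y"
      by (rule tendsto[OF has_L2_deriv_on_imp_continuous_on[OF G]]) simp
    have "continuous_on {0..} f" by (rule Hoelder_half_imp_continuous_on) (rule Hoelder)
    then show "(\<lambda>n. G (?y n)) \<longlonglongrightarrow> f y - f 0"
      unfolding dyadic by (intro tendsto_diff tendsto tendsto_const)
  qed
  then have "has_L2_deriv_on f g {0..}"
    using has_L2_deriv_onD(2)[OF G] g(1) by (fastforce simp: has_L2_deriv_on_def)
  then show thesis using g(2) by (rule that)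
qed

end

lemma Riesz_criterion_Ici:
  assumes "\<And>x y. a \<le> x \<Longrightarrow> x \<le> y \<Longrightarrow> (f y - f x)\<^sup>2 \<le> (y - x) * (\<kappa> y - \<kappa> x)"
    and "\<And>x. a \<le> x \<Longrightarrow> \<kappa> x - \<kappa> a \<le> C"
  obtains g where "has_L2_deriv_on f g {a..}" "sqnorm {a..} g \<le> C"
proof -
  interpret riesz_increments "\<lambda>x. f (a + x)" "\<lambda>x. \<kappa> (a + x)" C
  proof
    show "(f (a + y) - f (a + x))\<^sup>2 \<le> (y - x) * (\<kappa> (a + y) - \<kappa> (a + x))" if "0 \<le> x" "x \<le> y" for x y
      using assms(1)[of "a + x" "a + y"] that by simp
    show "\<kappa> (a + x) - \<kappa> (a + 0) \<le> C" if "0 \<le> x" for x using assms(2)[of "a + x"] that by simp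
  qed
  obtain g where g: "has_L2_deriv_on (\<lambda>x. f (a + x)) g {0..}" "sqnorm {0..} g \<le> C"
    by (rule has_L2_deriv_on_Ici_0)
  have Ici: "{x. - a + 1 * x \<in> {0..}} = {a..}" by auto
  show thesis
  proof (rule that)
    show "has_L2_deriv_on f (\<lambda>x. g (x - a)) {a..}"
      using has_L2_deriv_on_affine[OF g(1), of 1 1 "- a"] unfolding Ici by simp
    show "sqnorm {a..} (\<lambda>x. g (x - a)) \<le> C"
      using set_integral_affine(1)[of 1 "- a" "{0..}" "\<lambda>x. (g x)\<^sup>2"] g(2) unfolding Ici by simp
  qed
qed

lemma Riesz_criterion_Icc:
  assumes "a \<le> b" "\<And>x y. a \<le> x \<Longrightarrow> x \<le> y \<Longrightarrow> y \<le> b \<Longrightarrow> (f y - f x)\<^sup>2 \<le> (y - x) * (\<kappa> y - \<kappa> x)"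
  obtains g where "has_L2_deriv_on f g {a..b}" "sqnorm {a..b} g \<le> \<kappa> b - \<kappa> a"
proof -
  have \<kappa>_mono: "\<kappa> x \<le> \<kappa> y" if "a \<le> x" "x \<le> y" "y \<le> b" for x y
    using order_trans[OF zero_le_power2 assms(2)[OF that]] that
    by (cases "x = y") (auto simp: zero_le_mult_iff)
  obtain g where g: "has_L2_deriv_on (\<lambda>x. f (min x b)) g {a..}" "sqnorm {a..} g \<le> \<kappa> b - \<kappa> a"
  proof (rule Riesz_criterion_Ici[of a "\<lambda>x. f (min x b)" "\<lambda>x. \<kappa> (min x b)" "\<kappa> b - \<kappa> a"])
    fix x y assume xy: "a \<le> x" "x \<le> y"
    have "(f (min y b) - f (min x b))\<^sup>2 \<le> (min y b - min x b) * (\<kappa> (min y b) - \<kappa> (min x b))"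
      using xy assms(1) by (intro assms(2)) auto
    also have "\<dots> \<le> (y - x) * (\<kappa> (min y b) - \<kappa> (min x b))"
      using xy assms(1) \<kappa>_mono[of "min x b" "min y b"] by (intro mult_right_mono) auto
    finally show "(f (min y b) - f (min x b))\<^sup>2 \<le> (y - x) * (\<kappa> (min y b) - \<kappa> (min x b))" .
  qed (use assms(1) \<kappa>_mono in auto)
  show thesis
  proof (rule that)
    have "has_L2_deriv_on (\<lambda>x. f (min x b)) g {a..b}" by (rule has_L2_deriv_on_subset[OF g(1)]) auto
    then show "has_L2_deriv_on f g {a..b}" by (rule has_L2_deriv_on_cong) auto
    show "sqnorm {a..b} g \<le> \<kappa> b - \<kappa> a"
      using sqnorm_mono[OF has_L2_deriv_onD(1)[OF g(1)], of "{a..b}"] g(2) by auto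
  qed
qed

section \<open>The weighted problem on the halfline\<close>

abbreviation powr_int :: "real \<Rightarrow> real set \<Rightarrow> (real \<Rightarrow> real) \<Rightarrow> real" where
  "powr_int p A f \<equiv> LINT x:A|lborel. \<bar>f x\<bar> powr p"

lemma powr_int_nonneg [simp]: "0 \<le> powr_int p A f"
  by (rule set_integral_nonneg) simp

lemma powr_le_power2:
  fixes y M p :: real
  assumes "0 \<le> y" "y \<le> M" "2 \<le> p"
  shows "y powr p \<le> M powr (p - 2) * y\<^sup>2"
proof (cases "y = 0")
  case False
  with assms have y: "0 < y" by simp
  have "y powr p = y powr (p - 2) * y powr 2" by (simp flip: powr_add)
  also have "\<dots> = y powr (p - 2) * y\<^sup>2" using y by simp
  also have "\<dots> \<le> M powr (p - 2) * y\<^sup>2"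
    using assms by (intro mult_right_mono powr_mono2) auto
  finally show ?thesis .
qed simp

lemma
  assumes f: "L2_on A f" "\<And>x. x \<in> A \<Longrightarrow> \<bar>f x\<bar> \<le> M" and A: "A \<in> sets lborel" and p: "2 \<le> p"
  shows L2_on_bounded_powr_integrable: "set_integrable lborel A (\<lambda>x. \<bar>f x\<bar> powr p)"
    and powr_int_le: "powr_int p A f \<le> M powr (p - 2) * sqnorm A f"
proof -
  have bound: "\<bar>f x\<bar> powr p \<le> M powr (p - 2) * (f x)\<^sup>2" if "x \<in> A" for x
    using powr_le_power2[of "\<bar>f x\<bar>" M p] f(2)[OF that] p by simp
  note [measurable] = L2_onD(1)[OF f(1)] A[simplified]
  have "(\<lambda>x. indicator A x * \<bar>indicator A x * f x\<bar> powr p) \<in> borel_measurable borel" by measurable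
  also have "(\<lambda>x. indicator A x * \<bar>indicator A x * f x\<bar> powr p) = (\<lambda>x. indicator A x * \<bar>f x\<bar> powr p)"
    by (auto split: split_indicator)
  finally have meas: "set_borel_measurable lborel A (\<lambda>x. \<bar>f x\<bar> powr p)"
    by (simp add: set_borel_measurable_def)
  have int: "set_integrable lborel A (\<lambda>x. M powr (p - 2) * (f x)\<^sup>2)"
    using L2_onD(2)[OF f(1)] by simp
  show int_powr: "set_integrable lborel A (\<lambda>x. \<bar>f x\<bar> powr p)"
    by (rule set_integrable_bound[OF int meas]) (use bound in \<open>auto intro!: AE_I2\<close>)
  have "powr_int p A f \<le> (LINT x:A|lborel. M powr (p - 2) * (f x)\<^sup>2)"
    by (rule set_integral_mono[OF int_powr int]) (rule bound)
  then show "powr_int p A f \<le> M powr (p - 2) * sqnorm A f" by simp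
qed

lemma powr_int_const_mult: "0 \<le> c \<Longrightarrow> powr_int p A (\<lambda>x. c * f x) = c powr p * powr_int p A f"
  by (simp add: abs_mult powr_mult)

lemma sqnorm_const_mult: "sqnorm A (\<lambda>x. c * f x) = c\<^sup>2 * sqnorm A f"
  by (simp add: power_mult_distrib)

definition decreasing_profile :: "(real \<Rightarrow> real) \<Rightarrow> (real \<Rightarrow> real) \<Rightarrow> bool" where
  "decreasing_profile f g \<longleftrightarrow> (\<forall>x\<ge>0. 0 \<le> f x) \<and> (\<forall>x y. 0 \<le> x \<longrightarrow> x \<le> y \<longrightarrow> f y \<le> f x)
     \<and> L2_on {0..} f \<and> has_L2_deriv_on f g {0..}"

abbreviation mass :: "(real \<Rightarrow> real) \<Rightarrow> real" where
  "mass f \<equiv> sqnorm {0..} f"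

definition kinetic :: "real \<Rightarrow> real \<Rightarrow> real \<Rightarrow> (real \<Rightarrow> real) \<Rightarrow> real" where
  "kinetic \<alpha> \<gamma> l g = \<alpha> * sqnorm {0..l} g + \<gamma> * sqnorm {l..} g"

definition weighted_energy :: "real \<Rightarrow> real \<Rightarrow> real \<Rightarrow> real \<Rightarrow> (real \<Rightarrow> real) \<Rightarrow> (real \<Rightarrow> real) \<Rightarrow> real" where
  "weighted_energy p \<alpha> \<gamma> l f g = kinetic \<alpha> \<gamma> l g / 2 - powr_int p {0..} f / p"

lemma kinetic_nonneg: "0 \<le> \<alpha> \<Longrightarrow> 0 \<le> \<gamma> \<Longrightarrow> 0 \<le> kinetic \<alpha> \<gamma> l g"
  by (simp add: kinetic_def)

lemma kinetic_mono:
  "\<alpha> \<le> \<alpha>' \<Longrightarrow> \<gamma> \<le> \<gamma>' \<Longrightarrow> kinetic \<alpha> \<gamma> l g \<le> kinetic \<alpha>' \<gamma>' l g"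
  by (simp add: kinetic_def add_mono mult_right_mono)

lemma kinetic_const_mult: "kinetic \<alpha> \<gamma> l (\<lambda>x. c * g x) = c\<^sup>2 * kinetic \<alpha> \<gamma> l g"
  by (simp add: kinetic_def power_mult_distrib algebra_simps)

lemma kinetic_eq:
  assumes "L2_on {0..} g" "0 \<le> l"
  shows "kinetic \<alpha> \<gamma> l g = \<alpha> * sqnorm {0..} g + (\<gamma> - \<alpha>) * sqnorm {l..} g"
  using set_integral_Ici_split[OF L2_onD(2)[OF assms(1)] assms(2)]
  by (simp add: kinetic_def algebra_simps)

lemma kinetic_ge_sqnorm:
  assumes "c \<le> \<alpha>" "c \<le> \<gamma>" "L2_on {0..} g" "0 \<le> l"
  shows "c * sqnorm {0..} g \<le> kinetic \<alpha> \<gamma> l g"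
  using kinetic_mono[OF assms(1,2), of l g] kinetic_eq[OF assms(3,4), of c c] by simp

lemma decreasing_profileD:
  assumes "decreasing_profile f g"
  shows "\<And>x. 0 \<le> x \<Longrightarrow> 0 \<le> f x" "\<And>x y. 0 \<le> x \<Longrightarrow> x \<le> y \<Longrightarrow> f y \<le> f x"
    "L2_on {0..} f" "has_L2_deriv_on f g {0..}" "L2_on {0..} g"
  using assms by (auto simp: decreasing_profile_def has_L2_deriv_on_def)

lemma decreasing_profile_abs_le: "decreasing_profile f g \<Longrightarrow> x \<in> {0..} \<Longrightarrow> \<bar>f x\<bar> \<le> f 0"
  using decreasing_profileD(1,2)[of f g] by fastforce

lemma decreasing_profile_powr_integrable:
  assumes "decreasing_profile f g" "2 \<le> p"
  shows "set_integrable lborel {0..} (\<lambda>x. \<bar>f x\<bar> powr p)"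
  using decreasing_profile_abs_le[OF assms(1)] assms(2)
  by (intro L2_on_bounded_powr_integrable[OF decreasing_profileD(3)[OF assms(1)]]) auto

lemma decreasing_profile_powr_int_le:
  assumes "decreasing_profile f g" "2 \<le> p"
  shows "powr_int p {0..} f \<le> f 0 powr (p - 2) * mass f"
  using decreasing_profile_abs_le[OF assms(1)] assms(2)
  by (intro powr_int_le[OF decreasing_profileD(3)[OF assms(1)]]) auto

lemma decreasing_profile_tail:
  assumes f: "decreasing_profile f g" and x: "0 \<le> x"
  shows "x * (f x)\<^sup>2 \<le> mass f"
proof -
  have "set_integrable lborel {0..x} (\<lambda>t. (f t)\<^sup>2)"
    by (rule set_integrable_subset[OF L2_onD(2)[OF decreasing_profileD(3)[OF f]]]) auto
  then have "x * (f x)\<^sup>2 \<le> sqnorm {0..x} f"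
    using const_mult_length_le_set_integral[of 0 x "\<lambda>t. (f t)\<^sup>2" "(f x)\<^sup>2"] x
      decreasing_profileD(1,2)[OF f] by (auto intro: power_mono)
  also have "\<dots> \<le> mass f" by (rule sqnorm_mono[OF decreasing_profileD(3)[OF f]]) auto
  finally show ?thesis .
qed

lemma decreasing_profile_tail_kinetic_pos:
  assumes f: "decreasing_profile f g" and y: "0 \<le> y" "0 < f y"
  shows "0 < sqnorm {y..} g"
proof (rule ccontr)
  assume "\<not> 0 < sqnorm {y..} g"
  then have zero: "sqnorm {y..} g = 0" using sqnorm_nonneg[of "{y..}" g] by linarith
  define x where "x = max y ((mass f + 1) / (f y)\<^sup>2)"
  have "has_L2_deriv_on f g {y..}"
    by (rule has_L2_deriv_on_subset[OF decreasing_profileD(4)[OF f]]) (use y(1) in auto)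
  from has_L2_deriv_on_Hoelder[OF this, of y x] have "f x = f y" by (simp add: zero x_def)
  then have "x * (f y)\<^sup>2 \<le> mass f" using decreasing_profile_tail[OF f, of x] y(1) by (simp add: x_def)
  moreover have "mass f + 1 = (mass f + 1) / (f y)\<^sup>2 * (f y)\<^sup>2" using y(2) by simp
  moreover have "\<dots> \<le> x * (f y)\<^sup>2" by (intro mult_right_mono) (simp_all add: x_def)
  ultimately show False by linarith
qed

lemma decreasing_profile_powr_int_pos:
  assumes f: "decreasing_profile f g" and p: "2 \<le> p" and pos: "0 < f x" "0 < x"
  shows "0 < powr_int p {0..} f"
proof -
  note int = decreasing_profile_powr_integrable[OF f p]
  have "0 < (x - 0) * \<bar>f x\<bar> powr p" using pos by simp
  also have "\<dots> \<le> powr_int p {0..x} f"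
    using decreasing_profileD(1,2)[OF f] pos p
    by (intro const_mult_length_le_set_integral set_integrable_subset[OF int] powr_mono2) auto
  also have "\<dots> \<le> powr_int p {0..} f" by (rule set_integral_mono_set[OF int]) auto
  finally show ?thesis .
qed

lemma power2_le_4_mult:
  fixes a m K :: real
  assumes "0 \<le> a" "0 \<le> m" "0 \<le> K" and bound: "\<And>d. 0 < d \<Longrightarrow> a \<le> m / d + d * K"
  shows "a\<^sup>2 \<le> 4 * m * K"
proof (cases "a = 0")
  case False
  then have a: "0 < a" using assms(1) by simp
  have quadratic: "a * d \<le> m + d\<^sup>2 * K" if "0 < d" for d
    using bound[OF that] that by (simp add: field_simps power2_eq_square)
  have "0 < K"
  proof (rule ccontr)
    assume "\<not> 0 < K"
    then show False using quadratic[of "(m + 1) / a"] a assms(2,3) by simp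
  qed
  then have "a * (a / (2 * K)) \<le> m + (a / (2 * K))\<^sup>2 * K" using a by (intro quadratic) simp
  then show ?thesis using \<open>0 < K\<close> by (simp add: field_simps power2_eq_square)
qed (use assms in simp)

lemma decreasing_profile_sup_bound:
  assumes f: "decreasing_profile f g"
  shows "(f 0)^4 \<le> 16 * mass f * sqnorm {0..} g"
proof -
  have "(f 0)\<^sup>2 / 2 \<le> mass f / d + d * sqnorm {0..} g" if d: "0 < d" for d
  proof -
    have "(f d)\<^sup>2 \<le> mass f / d"
      using decreasing_profile_tail[OF f, of d] d by (simp add: field_simps)
    moreover have "(f d - f 0)\<^sup>2 \<le> d * sqnorm {0..} g"
      using has_L2_deriv_on_Hoelder[OF decreasing_profileD(4)[OF f], of 0 d] d by simp
    moreover have "(f 0)\<^sup>2 \<le> 2 * (f d)\<^sup>2 + 2 * (f d - f 0)\<^sup>2"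
      using zero_le_power2[of "f 0 - 2 * f d"] by (simp add: power2_eq_square algebra_simps)
    ultimately show ?thesis by linarith
  qed
  then have "((f 0)\<^sup>2 / 2)\<^sup>2 \<le> 4 * mass f * sqnorm {0..} g"
    by (intro power2_le_4_mult) simp_all
  then show ?thesis by (simp add: power_divide flip: power_mult)
qed

lemma decreasing_profile_const_mult:
  "decreasing_profile f g \<Longrightarrow> 0 \<le> c \<Longrightarrow> decreasing_profile (\<lambda>x. c * f x) (\<lambda>x. c * g x)"
  by (auto simp: decreasing_profile_def
      intro: mult_left_mono L2_on_const_mult has_L2_deriv_on_const_mult)

definition dilate :: "real \<Rightarrow> (real \<Rightarrow> real) \<Rightarrow> real \<Rightarrow> real" where
  "dilate r f x = sqrt r * f (r * x)"

lemma sqnorm_dilate: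
  assumes "0 < r"
  shows "sqnorm {x. r * x \<in> A} (dilate r f) = sqnorm A f"
  using set_integral_affine(1)[of r 0 A "\<lambda>x. (f x)\<^sup>2"] assms
  by (simp add: dilate_def power_mult_distrib)

lemma powr_int_dilate:
  assumes r: "0 < r"
  shows "powr_int p {x. r * x \<in> A} (dilate r f) = r powr (p / 2 - 1) * powr_int p A f"
proof -
  have "powr_int p {x. r * x \<in> A} (dilate r f) = sqrt r powr p * (powr_int p A f / r)"
    using set_integral_affine(1)[of r 0 A "\<lambda>x. \<bar>f x\<bar> powr p"] powr_int_const_mult[of "sqrt r"] r
    by (simp add: dilate_def)
  also have "sqrt r powr p = r powr (p / 2 - 1) * r"
    using r powr_add[of r "p / 2 - 1" 1] by (simp add: powr_half_sqrt[symmetric] powr_powr)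
  finally show ?thesis using r by simp
qed

lemma dilate_halfline: "0 < r \<Longrightarrow> {x. r * x \<in> {r * l..}} = {l..}"
  and dilate_segment: "0 < r \<Longrightarrow> {x. r * x \<in> {0..r * l}} = {0..l}"
  for l r :: real
  by (auto simp: zero_le_mult_iff)

lemma mass_dilate: "0 < r \<Longrightarrow> mass (dilate r f) = mass f"
  using sqnorm_dilate[of r "{0..}" f] dilate_halfline[of r 0] by simp

lemma kinetic_dilate: "0 < r \<Longrightarrow> kinetic \<alpha> \<gamma> l (\<lambda>x. r * dilate r g x) = r\<^sup>2 * kinetic \<alpha> \<gamma> (r * l) g"
  using sqnorm_dilate[of r "{0..r * l}" g] sqnorm_dilate[of r "{r * l..}" g]
  unfolding kinetic_const_mult by (simp only: kinetic_def dilate_halfline dilate_segment)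

lemma decreasing_profile_dilate:
  assumes f: "decreasing_profile f g" and r: "0 < r"
  shows "decreasing_profile (dilate r f) (\<lambda>x. r * dilate r g x)"
  unfolding decreasing_profile_def
proof (intro conjI allI impI)
  have Ici: "{x. 0 + r * x \<in> {0..}} = {0..}" using dilate_halfline[OF r, of 0] by simp
  show "0 \<le> dilate r f x" if "0 \<le> x" for x
    using that r decreasing_profileD(1)[OF f, of "r * x"] by (simp add: dilate_def)
  show "dilate r f y \<le> dilate r f x" if "0 \<le> x" "x \<le> y" for x y
    using that r decreasing_profileD(2)[OF f, of "r * x" "r * y"]
    by (simp add: dilate_def mult_left_mono)
  show "L2_on {0..} (dilate r f)"
    using L2_on_affine[OF decreasing_profileD(3)[OF f], of r 0 "sqrt r"] r
    unfolding Ici by (simp add: dilate_def[abs_def])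
  show "has_L2_deriv_on (dilate r f) (\<lambda>x. r * dilate r g x) {0..}"
    using has_L2_deriv_on_affine[OF decreasing_profileD(4)[OF f], of r "sqrt r" 0] r
    unfolding Ici by (simp add: dilate_def[abs_def] ac_simps)
qed

lemma weighted_energy_dilate:
  assumes "0 < r"
  shows "weighted_energy p \<alpha> \<gamma> l (dilate r f) (\<lambda>x. r * dilate r g x)
    = r\<^sup>2 * kinetic \<alpha> \<gamma> (r * l) g / 2 - r powr (p / 2 - 1) * powr_int p {0..} f / p"
  using powr_int_dilate[OF assms, of "{0..}" f p] dilate_halfline[OF assms, of 0]
  by (simp add: weighted_energy_def kinetic_dilate[OF assms])

lemma exists_decreasing_profile_pos:
  obtains f g where "decreasing_profile f g" "0 < f 1"
proof -
  define f where "f x = exp (- x)" for x :: real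
  have deriv: "(f has_real_derivative - f x) (at x)" for x
    unfolding f_def[abs_def] by (auto intro!: derivative_eq_intros)
  have cont: "continuous_on A f" for A unfolding f_def by (intro continuous_intros)
  have "set_integrable lebesgue {0..} (\<lambda>x::real. exp (- 2 * x))"
    by (intro nonnegative_absolutely_integrable_1 integrable_on_exp_minus_to_infinity) auto
  moreover have "(f x)\<^sup>2 = exp (- 2 * x)" for x
    using exp_double[of "- x"] by (simp add: f_def)
  ultimately have "set_integrable lborel {0..} (\<lambda>x. (f x)\<^sup>2)"
    by (simp add: set_integrable_def integrable_completion)
  then have "L2_on {0..} f" using cont by (intro L2_on_continuous) auto
  moreover have "f y - f x = (LINT t:{x..y}|lborel. - f t)" if "x \<le> y" for x y
    using has_L2_deriv_onD(2)[OF has_L2_deriv_on_C1[OF deriv, of x y], of x y] cont that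
    by (simp add: continuous_on_minus)
  then have "has_L2_deriv_on f (\<lambda>x. - f x) {0..}"
    using L2_on_const_mult[OF calculation, of "-1"] by (simp add: has_L2_deriv_on_def)
  ultimately have "decreasing_profile f (\<lambda>x. - f x)" by (simp add: decreasing_profile_def f_def)
  then show thesis by (rule that) (simp add: f_def)
qed

lemma exists_decreasing_profile_with_mass:
  assumes \<mu>: "0 < \<mu>"
  obtains f g where "decreasing_profile f g" "mass f = \<mu>" "0 < f 1"
proof -
  obtain f g where f: "decreasing_profile f g" "0 < f 1" by (rule exists_decreasing_profile_pos)
  have "0 < (f 1)\<^sup>2" using f(2) by simp
  also have "\<dots> \<le> mass f" using decreasing_profile_tail[OF f(1), of 1] by simp
  finally have pos: "0 < mass f" .
  define c where "c = sqrt (\<mu> / mass f)"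
  have c: "0 < c" "c\<^sup>2 = \<mu> / mass f" using \<mu> pos by (simp_all add: c_def)
  have "mass (\<lambda>x. c * f x) = \<mu>" using c(2) pos by (simp add: sqnorm_const_mult)
  then show thesis
    using that[OF decreasing_profile_const_mult[OF f(1) less_imp_le[OF c(1)]]] c(1) f(2) by simp
qed

lemma weighted_energy_neg_imp_mass_pos:
  assumes f: "decreasing_profile f g" and w: "0 \<le> \<alpha>" "0 \<le> \<gamma>" and p: "2 < p"
    and neg: "weighted_energy p \<alpha> \<gamma> l f g < 0"
  shows "0 < mass f"
proof (rule ccontr)
  assume "\<not> 0 < mass f"
  then have "mass f = 0" using sqnorm_nonneg[of "{0..}" f] by linarith
  then have "powr_int p {0..} f \<le> 0" using decreasing_profile_powr_int_le[OF f, of p] p by simp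
  then have "powr_int p {0..} f = 0" using powr_int_nonneg[of "{0..}" f p] by linarith
  then show False using neg kinetic_nonneg[OF w, of l g] by (simp add: weighted_energy_def)
qed

lemma weighted_energy_restore_mass:
  assumes f: "decreasing_profile f g" and m: "mass f \<le> \<mu>" and w: "0 \<le> \<alpha>" "0 \<le> \<gamma>" and p: "2 < p"
    and neg: "weighted_energy p \<alpha> \<gamma> l f g < 0"
  obtains c where "0 \<le> c" "mass (\<lambda>x. c * f x) = \<mu>"
    "weighted_energy p \<alpha> \<gamma> l (\<lambda>x. c * f x) (\<lambda>x. c * g x) \<le> weighted_energy p \<alpha> \<gamma> l f g"
proof -
  define c where "c = sqrt (\<mu> / mass f)"
  have mass_pos: "0 < mass f" by (rule weighted_energy_neg_imp_mass_pos[OF f w p neg])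
  have c: "1 \<le> c" "c\<^sup>2 = \<mu> / mass f" using m mass_pos by (simp_all add: c_def)
  have "c powr 2 \<le> c powr p" using c(1) p by (intro powr_mono) auto
  then have "c\<^sup>2 * (powr_int p {0..} f / p) \<le> c powr p * (powr_int p {0..} f / p)"
    using c(1) p by (intro mult_right_mono) auto
  then have "weighted_energy p \<alpha> \<gamma> l (\<lambda>x. c * f x) (\<lambda>x. c * g x) \<le> c\<^sup>2 * weighted_energy p \<alpha> \<gamma> l f g"
    using c(1) by (simp add: weighted_energy_def kinetic_const_mult powr_int_const_mult
        right_diff_distrib)
  also have "\<dots> \<le> 1 * weighted_energy p \<alpha> \<gamma> l f g"
    using neg c(1) by (intro mult_right_mono_neg) auto
  finally show thesis
    using that[of c] c mass_pos by (simp add: sqnorm_const_mult)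
qed

lemma exists_negative_weighted_energy:
  assumes p: "2 < p" "p < 6" and \<mu>: "0 < \<mu>" and w: "0 \<le> \<alpha>" "0 \<le> \<gamma>" and l: "0 \<le> l"
  obtains f g where "decreasing_profile f g" "mass f = \<mu>" "weighted_energy p \<alpha> \<gamma> l f g < 0"
proof -
  obtain f g where f: "decreasing_profile f g" and mass: "mass f = \<mu>" and f_pos: "0 < f 1"
    by (rule exists_decreasing_profile_with_mass[OF \<mu>])
  define P where "P = powr_int p {0..} f / p"
  have P: "0 < P"
    unfolding P_def using decreasing_profile_powr_int_pos[OF f, of p 1] f_pos p by simp
  define K where "K = (\<alpha> + \<gamma>) * sqnorm {0..} g"
  have kin: "kinetic \<alpha> \<gamma> s g \<le> K" if "0 \<le> s" for s
    unfolding kinetic_def K_def distrib_right using w that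
    by (intro add_mono mult_left_mono sqnorm_mono[OF decreasing_profileD(5)[OF f]]) auto
  have "((\<lambda>r. r powr (3 - p / 2) * (K / 2)) \<longlongrightarrow> 0 powr (3 - p / 2) * (K / 2)) (at_right 0)"
    using p by (intro tendsto_mult tendsto_powr' tendsto_intros) (auto simp: eventually_at_filter)
  then have "\<forall>\<^sub>F r in at_right 0. r powr (3 - p / 2) * (K / 2) < P"
    using P p by (intro order_tendstoD(2)) auto
  then have "\<forall>\<^sub>F r in at_right 0. 0 < r \<and> r powr (3 - p / 2) * (K / 2) < P"
    by (intro eventually_conj eventually_at_right_less)
  then obtain r where r: "0 < r" "r powr (3 - p / 2) * (K / 2) < P"
    using eventually_happens' trivial_limit_at_right_real by blast
  have "weighted_energy p \<alpha> \<gamma> l (dilate r f) (\<lambda>x. r * dilate r g x)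
      = r\<^sup>2 * kinetic \<alpha> \<gamma> (r * l) g / 2 - r powr (p / 2 - 1) * P"
    by (simp add: weighted_energy_dilate[OF r(1)] P_def)
  also have "\<dots> \<le> r\<^sup>2 * (K / 2) - r powr (p / 2 - 1) * P"
    using mult_left_mono[OF kin, of "r * l" "r\<^sup>2"] r(1) l by simp
  also have "r\<^sup>2 = r powr (p / 2 - 1) * r powr (3 - p / 2)"
    using r(1) by (simp flip: powr_add)
  also have "r powr (p / 2 - 1) * r powr (3 - p / 2) * (K / 2) - r powr (p / 2 - 1) * P
      = r powr (p / 2 - 1) * (r powr (3 - p / 2) * (K / 2) - P)"
    by (simp add: algebra_simps)
  also have "\<dots> < 0" using r by (simp add: mult_pos_neg)
  finally show thesis
    using that[OF decreasing_profile_dilate[OF f r(1)]] mass mass_dilate[OF r(1)] by simp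
qed

definition sup_bound :: "real \<Rightarrow> real \<Rightarrow> real \<Rightarrow> real" where
  "sup_bound p c m = (32 * m\<^sup>2 / (p * c)) powr (1 / (6 - p))"

lemma decreasing_profile_le_sup_bound:
  assumes f: "decreasing_profile f g" and m: "0 < mass f" and p: "2 < p" "p < 6" and c: "0 < c"
    and kinetic_le: "c * sqnorm {0..} g \<le> 2 / p * powr_int p {0..} f"
  shows "f 0 \<le> sup_bound p c (mass f)"
proof (cases "f 0 = 0")
  case False
  then have M: "0 < f 0" using decreasing_profileD(1)[OF f, of 0] by simp
  have "2 / p * powr_int p {0..} f \<le> 2 / p * (f 0 powr (p - 2) * mass f)"
    using decreasing_profile_powr_int_le[OF f, of p] p by (intro mult_left_mono) auto
  with kinetic_le have "c * sqnorm {0..} g \<le> 2 / p * (f 0 powr (p - 2) * mass f)" by linarith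
  then have "16 * mass f * (c * sqnorm {0..} g) \<le> 16 * mass f * (2 / p * (f 0 powr (p - 2) * mass f))"
    using m by (intro mult_left_mono) auto
  moreover have "c * (f 0)^4 \<le> c * (16 * mass f * sqnorm {0..} g)"
    using decreasing_profile_sup_bound[OF f] c by (intro mult_left_mono) auto
  ultimately have "c * (f 0)^4 \<le> f 0 powr (p - 2) * (32 * (mass f)\<^sup>2 / p)"
    by (simp add: power2_eq_square ac_simps)
  also have "(f 0)^4 = f 0 powr (p - 2) * f 0 powr (6 - p)"
    using M by (simp flip: powr_add)
  finally have "f 0 powr (p - 2) * (c * f 0 powr (6 - p)) \<le> f 0 powr (p - 2) * (32 * (mass f)\<^sup>2 / p)"
    by (simp add: ac_simps)
  then have "c * f 0 powr (6 - p) \<le> 32 * (mass f)\<^sup>2 / p"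
    by (rule mult_left_le_imp_le) (use M in simp)
  then have "f 0 powr (6 - p) \<le> 32 * (mass f)\<^sup>2 / (p * c)"
    using c p by (simp add: field_simps)
  then have "(f 0 powr (6 - p)) powr (1 / (6 - p)) \<le> sup_bound p c (mass f)"
    unfolding sup_bound_def using p by (intro powr_mono2) auto
  then show ?thesis using M p by (simp add: powr_powr)
qed (simp add: sup_bound_def)

lemma weighted_energy_coercive:
  assumes p: "2 < p" "p < 6" and \<mu>: "0 < \<mu>" and c: "0 < c"
  obtains M where "0 < M"
    "\<And>f g \<alpha> \<gamma> l. decreasing_profile f g \<Longrightarrow> mass f = \<mu> \<Longrightarrow> c \<le> \<alpha> \<Longrightarrow> c \<le> \<gamma> \<Longrightarrow> 0 \<le> l \<Longrightarrow>
      weighted_energy p \<alpha> \<gamma> l f g \<le> 0 \<Longrightarrow>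
      f 0 \<le> M \<and> kinetic \<alpha> \<gamma> l g \<le> M \<and> - M \<le> weighted_energy p \<alpha> \<gamma> l f g"
proof -
  define S where "S = sup_bound p c \<mu>"
  define M where "M = max S (S powr (p - 2) * \<mu>)"
  have S: "0 < S" unfolding S_def sup_bound_def using p \<mu> c by simp
  have "f 0 \<le> M \<and> kinetic \<alpha> \<gamma> l g \<le> M \<and> - M \<le> weighted_energy p \<alpha> \<gamma> l f g"
    if f: "decreasing_profile f g" and m: "mass f = \<mu>" and w: "c \<le> \<alpha>" "c \<le> \<gamma>" and l: "0 \<le> l"
      and E: "weighted_energy p \<alpha> \<gamma> l f g \<le> 0" for f g \<alpha> \<gamma> l
  proof -
    have kin: "kinetic \<alpha> \<gamma> l g \<le> 2 / p * powr_int p {0..} f"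
      using E by (simp add: weighted_energy_def mult.commute)
    have "c * sqnorm {0..} g \<le> kinetic \<alpha> \<gamma> l g"
      by (rule kinetic_ge_sqnorm[OF w decreasing_profileD(5)[OF f] l])
    with kin m have f0: "f 0 \<le> S"
      using decreasing_profile_le_sup_bound[OF f _ p c] \<mu> by (simp add: S_def)
    have "powr_int p {0..} f \<le> f 0 powr (p - 2) * \<mu>"
      using decreasing_profile_powr_int_le[OF f, of p] p m by simp
    also have "\<dots> \<le> S powr (p - 2) * \<mu>"
      using f0 decreasing_profileD(1)[OF f, of 0] \<mu> p by (intro mult_right_mono powr_mono2) auto
    finally have "powr_int p {0..} f \<le> M" by (simp add: M_def)
    moreover have "powr_int p {0..} f / p \<le> powr_int p {0..} f / 1"
      using p by (intro divide_left_mono) auto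
    moreover have "0 \<le> kinetic \<alpha> \<gamma> l g" using w c by (intro kinetic_nonneg) auto
    moreover have "2 / p * powr_int p {0..} f \<le> 1 * powr_int p {0..} f"
      using p by (intro mult_right_mono) auto
    ultimately show ?thesis using kin f0 by (simp add: weighted_energy_def M_def)
  qed
  moreover have "0 < M" using S by (simp add: M_def)
  ultimately show thesis using that by blast
qed

section \<open>Compactness of decreasing profiles\<close>

lemma equicontinuous_convergent_subsequence:
  fixes f :: "nat \<Rightarrow> 'a::{metric_space,second_countable_topology} \<Rightarrow> 'b::{real_normed_vector,heine_borel}"
  assumes bounded: "\<And>n x. x \<in> S \<Longrightarrow> norm (f n x) \<le> M"
    and equicont: "\<And>x e. x \<in> S \<Longrightarrow> 0 < e \<Longrightarrow> \<exists>d>0. \<forall>n. \<forall>y\<in>S. dist y x < d \<longrightarrow> dist (f n y) (f n x) < e"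
  obtains r h where "strict_mono (r :: nat \<Rightarrow> nat)" "\<And>x. x \<in> S \<Longrightarrow> (\<lambda>n. f (r n) x) \<longlonglongrightarrow> h x"
proof -
  obtain D where D: "countable D" "D \<subseteq> S" "S \<subseteq> closure D" by (rule separable)
  obtain r where r: "strict_mono (r :: nat \<Rightarrow> nat)" "\<And>x. x \<in> D \<Longrightarrow> \<exists>l. (\<lambda>n. f (r n) x) \<longlonglongrightarrow> l"
    using function_convergent_subsequence[of D f M] D(1,2) bounded by blast
  have "convergent (\<lambda>n. f (r n) x)" if x: "x \<in> S" for x
  proof (rule Cauchy_convergent, rule metric_CauchyI)
    fix e :: real assume "0 < e"
    then obtain d where d: "0 < d" "\<And>n y. y \<in> S \<Longrightarrow> dist y x < d \<Longrightarrow> dist (f n y) (f n x) < e / 3"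
      using equicont[OF x, of "e / 3"] by auto
    obtain y where y: "y \<in> D" "dist y x < d"
      using D(3) x d(1) by (meson closure_approachable subsetD)
    then have "Cauchy (\<lambda>n. f (r n) y)" using r(2) LIMSEQ_imp_Cauchy by blast
    from metric_CauchyD[OF this, of "e / 3"]
    obtain N where N: "\<And>m n. N \<le> m \<Longrightarrow> N \<le> n \<Longrightarrow> dist (f (r m) y) (f (r n) y) < e / 3"
      using \<open>0 < e\<close> by auto
    have "dist (f (r m) x) (f (r n) x) < e" if "N \<le> m" "N \<le> n" for m n
    proof -
      have "dist (f (r m) x) (f (r n) x)
          \<le> dist (f (r m) y) (f (r m) x) + dist (f (r m) y) (f (r n) y) + dist (f (r n) y) (f (r n) x)"
        by (metis dist_commute dist_triangle dist_triangle_le add.commute add_mono order_refl)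
      also have "\<dots> < e"
        using d(2)[of y "r m"] d(2)[of y "r n"] N[OF that] y D(2) by (simp add: subset_eq)
      finally show ?thesis .
    qed
    then show "\<exists>N. \<forall>m\<ge>N. \<forall>n\<ge>N. dist (f (r m) x) (f (r n) x) < e" by blast
  qed
  then show thesis using that[OF r(1), of "\<lambda>x. lim (\<lambda>n. f (r n) x)"] by (simp add: convergent_LIMSEQ_iff)
qed

lemma decreasing_profiles_convergent_subsequence:
  assumes f: "\<And>n. decreasing_profile (f n) (g n)" and M: "\<And>n. f n 0 \<le> M"
    and K: "\<And>n. sqnorm {0..} (g n) \<le> K"
  obtains r h where "strict_mono (r :: nat \<Rightarrow> nat)" "\<And>x. 0 \<le> x \<Longrightarrow> (\<lambda>n. f (r n) x) \<longlonglongrightarrow> h x"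
proof -
  have K0: "0 \<le> K" using K[of 0] sqnorm_nonneg[of "{0..}" "g 0"] by linarith
  have "\<exists>d>0. \<forall>n. \<forall>y\<in>{0..}. dist y x < d \<longrightarrow> dist (f n y) (f n x) < e" if x: "x \<in> {0..}"
    and e: "0 < e" for x e
  proof (intro exI conjI allI ballI impI)
    show "0 < e\<^sup>2 / (K + 1)" using e K0 by simp
    fix n y assume y: "y \<in> {0..}" "dist y x < e\<^sup>2 / (K + 1)"
    have "(f n y - f n x)\<^sup>2 \<le> \<bar>y - x\<bar> * sqnorm {0..} (g n)"
      by (rule has_L2_deriv_on_Hoelder[OF decreasing_profileD(4)[OF f]]) (use x y in auto)
    also have "\<dots> \<le> \<bar>y - x\<bar> * (K + 1)" using K[of n] by (intro mult_left_mono) auto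
    also have "\<dots> < e\<^sup>2" using y(2) K0 by (simp add: dist_real_def pos_less_divide_eq)
    finally have "\<bar>f n y - f n x\<bar>\<^sup>2 < e\<^sup>2" by simp
    then show "dist (f n y) (f n x) < e"
      using e power2_less_imp_less[of "\<bar>f n y - f n x\<bar>" e] by (simp add: dist_real_def)
  qed
  moreover have "norm (f n x) \<le> M" if "x \<in> {0..}" for n x
    using decreasing_profile_abs_le[OF f that, of n] M[of n] by simp
  ultimately show thesis
    using equicontinuous_convergent_subsequence[of "{0..}" f M] that by (metis atLeast_iff)
qed

definition profile_majorant :: "real \<Rightarrow> real \<Rightarrow> real \<Rightarrow> real \<Rightarrow> real" where
  "profile_majorant p M \<mu> x
      = indicator {0..1} x * M powr p + indicator {1..} x * (\<mu> powr (p / 2) * x powr (- (p / 2)))"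

lemma profile_majorant_integrable:
  assumes "2 < p"
  shows "integrable lborel (profile_majorant p M \<mu>)"
proof -
  have "set_integrable lebesgue {1..} (\<lambda>x::real. x powr (- (p / 2)))"
    using has_integral_powr_to_inf[of "- (p / 2)" 1] assms
    by (intro nonnegative_absolutely_integrable_1) (auto simp: integrable_on_def)
  then have "set_integrable lborel {1..} (\<lambda>x::real. x powr (- (p / 2)))"
    by (simp add: set_integrable_def integrable_completion)
  then have "set_integrable lborel {1..} (\<lambda>x::real. \<mu> powr (p / 2) * x powr (- (p / 2)))"
    by simp
  then show ?thesis
    using set_integrable_const_Icc[of 0 1 "M powr p"]
    unfolding profile_majorant_def set_integrable_def real_scaleR_def
    by (intro Bochner_Integration.integrable_add)
qed

lemma decreasing_profile_powr_le_majorant: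
  assumes f: "decreasing_profile f g" and M: "f 0 \<le> M" and \<mu>: "mass f \<le> \<mu>" and p: "0 \<le> p"
  shows "indicator {0..} x * \<bar>f x\<bar> powr p \<le> profile_majorant p M \<mu> x"
proof -
  have near: "\<bar>f x\<bar> powr p \<le> M powr p" if "0 \<le> x"
    using decreasing_profile_abs_le[OF f, of x] M that p by (intro powr_mono2) auto
  have far: "\<bar>f x\<bar> powr p \<le> \<mu> powr (p / 2) * x powr (- (p / 2))" if x: "1 \<le> x"
  proof -
    have \<mu>0: "0 \<le> \<mu>" using \<mu> sqnorm_nonneg[of "{0..}" f] by linarith
    have "(f x)\<^sup>2 \<le> \<mu> / x"
      using decreasing_profile_tail[OF f, of x] \<mu> x by (simp add: field_simps)
    then have "((f x)\<^sup>2) powr (p / 2) \<le> (\<mu> / x) powr (p / 2)" using p by (intro powr_mono2) auto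
    also have "(\<mu> / x) powr (p / 2) = \<mu> powr (p / 2) * x powr (- (p / 2))"
      using \<mu>0 x by (simp add: powr_divide powr_minus_divide)
    also have "((f x)\<^sup>2) powr (p / 2) = \<bar>f x\<bar> powr p"
      using powr_powr[of "\<bar>f x\<bar>" 2 "p / 2"] by (cases "f x = 0") simp_all
    finally show ?thesis .
  qed
  have "0 \<le> M powr p" "0 \<le> \<mu> powr (p / 2) * x powr (- (p / 2))" by simp_all
  with near far show ?thesis
    by (auto simp: profile_majorant_def add_increasing2 split: split_indicator)
qed

lemma
  assumes f: "\<And>n. decreasing_profile (f n) (g n)" and M: "\<And>n. f n 0 \<le> M" and \<mu>: "\<And>n. mass (f n) \<le> \<mu>"
    and lim: "\<And>x. 0 \<le> x \<Longrightarrow> (\<lambda>n. f n x) \<longlonglongrightarrow> h x"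
  shows L2_on_profile_limit: "L2_on {0..} h"
    and mass_profile_limit_le: "mass h \<le> \<mu>"
    and powr_int_profile_limit: "2 < p \<Longrightarrow> (\<lambda>n. powr_int p {0..} (f n)) \<longlonglongrightarrow> powr_int p {0..} h"
proof -
  define F H where "F n x = indicator {0..} x * f n x" and "H x = indicator {0..} x * h x" for n x
  have ind_lim: "(\<lambda>n. F n x) \<longlonglongrightarrow> H x" for x
    using lim[of x] by (cases "0 \<le> x") (simp_all add: F_def H_def)
  have sq: "(indicator {0..} x * k x)\<^sup>2 = indicator {0..} x *\<^sub>R (k x)\<^sup>2"
    and pw: "\<bar>indicator {0..} x * k x\<bar> powr p = indicator {0..} x *\<^sub>R \<bar>k x\<bar> powr p"
    for x p and k :: "real \<Rightarrow> real" by (auto split: split_indicator)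
  have [measurable]: "F n \<in> borel_measurable borel" for n
    using L2_onD(1)[OF decreasing_profileD(3)[OF f]] by (simp add: F_def[abs_def])
  have [measurable]: "H \<in> borel_measurable borel"
    by (rule borel_measurable_LIMSEQ_real[OF ind_lim]) simp
  have F: "integrable lborel (\<lambda>x. (F n x)\<^sup>2)" "(\<integral>x. (F n x)\<^sup>2 \<partial>lborel) \<le> \<mu>" for n
    using L2_onD(2)[OF decreasing_profileD(3)[OF f]] \<mu>
    by (simp_all add: F_def sq set_integrable_def set_lebesgue_integral_def)
  note H = lborel.L2_Fatou[of F H \<mu>, OF _ _ F(1) AE_I2[OF ind_lim] always_eventually[OF allI[OF F(2)]]]
  show "L2_on {0..} h"
    using \<open>H \<in> borel_measurable borel\<close> H(1)
    by (simp add: L2_on_def set_borel_measurable_def set_integrable_def H_def[abs_def] sq)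
  show "mass h \<le> \<mu>" using H(2) by (simp add: H_def sq set_lebesgue_integral_def)
  assume p: "2 < p"
  have "(\<lambda>n. \<integral>x. \<bar>F n x\<bar> powr p \<partial>lborel) \<longlonglongrightarrow> (\<integral>x. \<bar>H x\<bar> powr p \<partial>lborel)"
  proof (rule integral_dominated_convergence[OF _ _ profile_majorant_integrable[OF p]])
    show "AE x in lborel. (\<lambda>n. \<bar>F n x\<bar> powr p) \<longlonglongrightarrow> \<bar>H x\<bar> powr p"
      using p by (intro AE_I2 tendsto_powr' tendsto_rabs ind_lim tendsto_const) auto
    show "AE x in lborel. norm (\<bar>F n x\<bar> powr p) \<le> profile_majorant p M \<mu> x" for n
      using decreasing_profile_powr_le_majorant[OF f M \<mu>, of p] p by (simp add: F_def pw)
  qed simp_all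
  then show "(\<lambda>n. powr_int p {0..} (f n)) \<longlonglongrightarrow> powr_int p {0..} h"
    by (simp add: F_def H_def pw set_lebesgue_integral_def)
qed

lemma weighted_Riesz_criterion:
  fixes f \<kappa> :: "real \<Rightarrow> real"
  assumes w: "0 < \<alpha>" "0 < \<gamma>" and l: "0 \<le> l"
    and left: "\<And>x y. 0 \<le> x \<Longrightarrow> x \<le> y \<Longrightarrow> y \<le> l \<Longrightarrow> \<alpha> * (f y - f x)\<^sup>2 \<le> (y - x) * (\<kappa> y - \<kappa> x)"
    and right: "\<And>x y. l \<le> x \<Longrightarrow> x \<le> y \<Longrightarrow> \<gamma> * (f y - f x)\<^sup>2 \<le> (y - x) * (\<kappa> y - \<kappa> x)"
    and bound: "\<And>x. 0 \<le> x \<Longrightarrow> \<kappa> x - \<kappa> 0 \<le> T"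
  obtains g where "has_L2_deriv_on f g {0..}" "kinetic \<alpha> \<gamma> l g \<le> T"
proof -
  obtain g\<^sub>1 where g1: "has_L2_deriv_on f g\<^sub>1 {0..l}" "sqnorm {0..l} g\<^sub>1 \<le> \<kappa> l / \<alpha> - \<kappa> 0 / \<alpha>"
    by (rule Riesz_criterion_Icc[OF l, of f "\<lambda>x. \<kappa> x / \<alpha>"])
      (use left w(1) in \<open>auto simp: pos_le_divide_eq mult.commute simp flip: diff_divide_distrib\<close>)
  obtain g\<^sub>2 where g2: "has_L2_deriv_on f g\<^sub>2 {l..}" "sqnorm {l..} g\<^sub>2 \<le> (T - (\<kappa> l - \<kappa> 0)) / \<gamma>"
  proof (rule Riesz_criterion_Ici)
    show "(f y - f x)\<^sup>2 \<le> (y - x) * (\<kappa> y / \<gamma> - \<kappa> x / \<gamma>)" if "l \<le> x" "x \<le> y" for x y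
      using right[OF that] w(2) by (simp add: pos_le_divide_eq mult.commute flip: diff_divide_distrib)
    show "\<kappa> x / \<gamma> - \<kappa> l / \<gamma> \<le> (T - (\<kappa> l - \<kappa> 0)) / \<gamma>" if "l \<le> x" for x
      using bound[of x] that l w(2) by (simp add: divide_right_mono flip: diff_divide_distrib)
  qed
  define g where "g x = (if x \<le> l then g\<^sub>1 x else g\<^sub>2 x)" for x
  have "{0..l} \<union> {l..} = {0..}" using l by auto
  then have "has_L2_deriv_on f g {0..}"
    using has_L2_deriv_on_If[OF g1(1) g2(1), of l] l by (simp add: g_def[abs_def])
  moreover have "kinetic \<alpha> \<gamma> l g \<le> T"
  proof -
    have "sqnorm {0..l} g = sqnorm {0..l} g\<^sub>1"
      by (rule set_lebesgue_integral_cong) (auto simp: g_def)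
    moreover have "sqnorm {l..} g = sqnorm {l..} g\<^sub>2"
      by (rule set_integral_cong_except_point[of _ l]) (auto simp: g_def)
    moreover have "\<alpha> * sqnorm {0..l} g\<^sub>1 \<le> \<kappa> l - \<kappa> 0"
      using g1(2) w(1) by (simp add: pos_le_divide_eq mult.commute flip: diff_divide_distrib)
    moreover have "\<gamma> * sqnorm {l..} g\<^sub>2 \<le> T - (\<kappa> l - \<kappa> 0)"
      using g2(2) w(2) by (simp add: pos_le_divide_eq mult.commute)
    ultimately show ?thesis by (simp add: kinetic_def)
  qed
  ultimately show thesis by (rule that)
qed

lemma
  fixes k t :: "nat \<Rightarrow> real"
  assumes k: "\<And>n. 0 \<le> k n" "\<And>n. k n \<le> t n" and t: "t \<longlonglongrightarrow> T"
  shows ereal_real_liminf: "ereal (real_of_ereal (liminf k)) = liminf k" (is ?real)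
    and real_liminf_nonneg: "0 \<le> real_of_ereal (liminf k)" (is ?nonneg)
    and real_liminf_le: "real_of_ereal (liminf k) \<le> T" (is ?le)
proof -
  have nonneg: "0 \<le> liminf k"
    using k(1) by (intro Liminf_bounded) simp
  have "liminf k \<le> liminf t"
    using k(2) by (intro Liminf_mono) simp
  also have "liminf t = ereal T"
    using t by (intro lim_imp_Liminf) simp_all
  finally show ?real ?nonneg ?le
    using nonneg by (cases "liminf k"; simp)+
qed

lemma liminf_Hoelder_increment:
  fixes f k :: "nat \<Rightarrow> real \<Rightarrow> real"
  assumes k: "\<And>n x. 0 \<le> k n x" "\<And>n x. k n x \<le> t n" "t \<longlonglongrightarrow> T"
  defines "\<kappa> \<equiv> \<lambda>x. real_of_ereal (liminf (\<lambda>n. ereal (k n x)))"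
  assumes lim: "(\<lambda>n. f n x) \<longlonglongrightarrow> h x" "(\<lambda>n. f n y) \<longlonglongrightarrow> h y" and "x \<le> y"
    and Hoelder: "\<And>n. c * (f n y - f n x)\<^sup>2 \<le> (y - x) * (k n y - k n x)"
  shows "c * (h y - h x)\<^sup>2 \<le> (y - x) * (\<kappa> y - \<kappa> x)"
proof (cases "x = y")
  case False
  with \<open>x \<le> y\<close> have less: "x < y" by simp
  let ?q = "\<lambda>n. c * (f n y - f n x)\<^sup>2 / (y - x)" and ?q' = "c * (h y - h x)\<^sup>2 / (y - x)"
  have q: "?q \<longlonglongrightarrow> ?q'"
    using less by (intro tendsto_intros lim) simp
  have real: "ereal (\<kappa> z) = liminf (\<lambda>n. ereal (k n z))" for z
    unfolding \<kappa>_def by (rule ereal_real_liminf[OF k])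
  have "ereal ?q' + ereal (\<kappa> x) = liminf (\<lambda>n. ereal (?q n) + ereal (k n x))"
    unfolding real by (rule ereal_liminf_lim_add[symmetric]) (use q in auto)
  also have "\<dots> \<le> ereal (\<kappa> y)"
    unfolding real using less Hoelder by (intro Liminf_mono always_eventually) (simp add: field_simps)
  finally show ?thesis using less by (simp add: field_simps)
qed simp

text \<open>Weak compactness of the derivatives is not needed: the pointwise lower limit \<open>\<kappa>\<close> of the
  distribution functions of the kinetic energies satisfies the Riesz criterion for the limit.\<close>

lemma kinetic_lower_semicontinuous:
  assumes f: "\<And>n. decreasing_profile (f n) (g n)" and lim: "\<And>x. 0 \<le> x \<Longrightarrow> (\<lambda>n. f n x) \<longlonglongrightarrow> h x"
    and w: "0 < \<alpha>" "0 < \<gamma>" and l: "0 \<le> l" and T: "(\<lambda>n. kinetic \<alpha> \<gamma> l (g n)) \<longlonglongrightarrow> T"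
  obtains k where "has_L2_deriv_on h k {0..}" "kinetic \<alpha> \<gamma> l k \<le> T"
proof -
  define k where "k n x = \<alpha> * sqnorm {0..min x l} (g n) + \<gamma> * sqnorm {l..max x l} (g n)" for n x
  define \<kappa> where "\<kappa> x = real_of_ereal (liminf (\<lambda>n. ereal (k n x)))" for x
  note g = decreasing_profileD(5)[OF f]
  have k_le: "k n x \<le> kinetic \<alpha> \<gamma> l (g n)" for n x
    unfolding k_def kinetic_def using w l
    by (intro add_mono mult_left_mono sqnorm_mono L2_on_subset[OF g]) auto
  have k_nonneg: "0 \<le> k n x" for n x using w by (simp add: k_def)
  have liminf_increment: "c * (h y - h x)\<^sup>2 \<le> (y - x) * (\<kappa> y - \<kappa> x)"
    if "0 \<le> x" "x \<le> y" "\<And>n. c * (f n y - f n x)\<^sup>2 \<le> (y - x) * (k n y - k n x)" for c x y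
    unfolding \<kappa>_def using that by (intro liminf_Hoelder_increment[OF k_nonneg k_le T, of f] lim) auto

  have int: "set_integrable lborel {a..b} (\<lambda>t. (g n t)\<^sup>2)" if "0 \<le> a" for n a b
    by (rule set_integrable_subset[OF L2_onD(2)[OF g]]) (use that in auto)
  have Hoelder: "c * (f n y - f n x)\<^sup>2 \<le> (y - x) * (k n y - k n x)"
    if "0 \<le> x" "x \<le> y" "0 \<le> c" "k n y - k n x = c * sqnorm {x..y} (g n)" for n x y c
  proof -
    have "(f n y - f n x)\<^sup>2 \<le> (y - x) * sqnorm {x..y} (g n)"
      by (rule has_L2_deriv_on_Hoelder_Icc[OF decreasing_profileD(4)[OF f]]) (use that in auto)
    from mult_left_mono[OF this \<open>0 \<le> c\<close>] show ?thesis using that by (simp add: ac_simps)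
  qed
  show thesis
  proof (rule weighted_Riesz_criterion[OF w l])
    show "\<alpha> * (h y - h x)\<^sup>2 \<le> (y - x) * (\<kappa> y - \<kappa> x)" if "0 \<le> x" "x \<le> y" "y \<le> l" for x y
      using that w set_integral_Icc_split[OF int that(1,2)]
      by (intro liminf_increment Hoelder) (auto simp: k_def algebra_simps)
    show "\<gamma> * (h y - h x)\<^sup>2 \<le> (y - x) * (\<kappa> y - \<kappa> x)" if "l \<le> x" "x \<le> y" for x y
      using that l w set_integral_Icc_split[OF int that]
      by (intro liminf_increment Hoelder) (auto simp: k_def algebra_simps)
    have "0 \<le> \<kappa> x" "\<kappa> x \<le> T" for x
      unfolding \<kappa>_def by (rule real_liminf_nonneg real_liminf_le, (rule k_nonneg k_le T)+)+
    then show "\<kappa> x - \<kappa> 0 \<le> T" for x by (smt (verit))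
  qed (rule that)
qed

section \<open>The minimal weighted energy\<close>

locale subcritical =
  fixes p \<mu> :: real
  assumes p: "2 < p" "p < 6" and \<mu>: "0 < \<mu>"
begin

definition min_energy :: "real \<Rightarrow> real \<Rightarrow> real \<Rightarrow> real" where
  "min_energy \<alpha> \<gamma> l = Inf {weighted_energy p \<alpha> \<gamma> l f g |f g. decreasing_profile f g \<and> mass f = \<mu>}"

lemma negative_energy_bounds:
  assumes "0 < \<alpha>" "0 < \<gamma>"
  obtains M where "0 < M"
    "\<And>f g l. decreasing_profile f g \<Longrightarrow> mass f = \<mu> \<Longrightarrow> 0 \<le> l \<Longrightarrow> weighted_energy p \<alpha> \<gamma> l f g \<le> 0 \<Longrightarrow> f 0 \<le> M"
    "\<And>f g l. decreasing_profile f g \<Longrightarrow> mass f = \<mu> \<Longrightarrow> 0 \<le> l \<Longrightarrow> weighted_energy p \<alpha> \<gamma> l f g \<le> 0 \<Longrightarrow>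
      kinetic \<alpha> \<gamma> l g \<le> M"
    "\<And>f g l. decreasing_profile f g \<Longrightarrow> mass f = \<mu> \<Longrightarrow> 0 \<le> l \<Longrightarrow> weighted_energy p \<alpha> \<gamma> l f g \<le> 0 \<Longrightarrow>
      - M \<le> weighted_energy p \<alpha> \<gamma> l f g"
proof -
  have c: "0 < min \<alpha> \<gamma>" "min \<alpha> \<gamma> \<le> \<alpha>" "min \<alpha> \<gamma> \<le> \<gamma>" using assms by simp_all
  obtain M where M: "0 < M" "\<And>f g l. decreasing_profile f g \<Longrightarrow> mass f = \<mu> \<Longrightarrow> 0 \<le> l \<Longrightarrow>
      weighted_energy p \<alpha> \<gamma> l f g \<le> 0 \<Longrightarrow>
      f 0 \<le> M \<and> kinetic \<alpha> \<gamma> l g \<le> M \<and> - M \<le> weighted_energy p \<alpha> \<gamma> l f g"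
    using weighted_energy_coercive[OF p \<mu> c(1)] c(2,3) by metis
  show thesis by (rule that[OF M(1)]) (use M(2) in blast)+
qed

context
  fixes \<alpha> \<gamma> l :: real
  assumes w: "0 < \<alpha>" "0 < \<gamma>" and l: "0 \<le> l"
begin

lemma weighted_energy_bdd_below:
  "bdd_below {weighted_energy p \<alpha> \<gamma> l f g |f g. decreasing_profile f g \<and> mass f = \<mu>}"
proof -
  obtain M where M: "0 < M" "\<And>f g. decreasing_profile f g \<Longrightarrow> mass f = \<mu> \<Longrightarrow>
      weighted_energy p \<alpha> \<gamma> l f g \<le> 0 \<Longrightarrow> - M \<le> weighted_energy p \<alpha> \<gamma> l f g"
    using negative_energy_bounds[OF w] l by metis
  have "- M \<le> weighted_energy p \<alpha> \<gamma> l f g" if "decreasing_profile f g" "mass f = \<mu>" for f g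
    using M(2)[OF that] M(1) by linarith
  then show ?thesis by (intro bdd_belowI[of _ "- M"]) blast
qed

lemma min_energy_le:
  "decreasing_profile f g \<Longrightarrow> mass f = \<mu> \<Longrightarrow> min_energy \<alpha> \<gamma> l \<le> weighted_energy p \<alpha> \<gamma> l f g"
  unfolding min_energy_def by (rule cInf_lower[OF _ weighted_energy_bdd_below]) blast

lemma min_energy_neg: "min_energy \<alpha> \<gamma> l < 0"
proof -
  obtain f g where "decreasing_profile f g" "mass f = \<mu>" "weighted_energy p \<alpha> \<gamma> l f g < 0"
    using exists_negative_weighted_energy[OF p \<mu>, of \<alpha> \<gamma> l] w l by auto
  then show ?thesis using min_energy_le by fastforce
qed

lemma min_energy_less_witness:
  assumes "min_energy \<alpha> \<gamma> l < e"
  obtains f g where "decreasing_profile f g" "mass f = \<mu>" "weighted_energy p \<alpha> \<gamma> l f g < e"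
proof -
  obtain f g where "decreasing_profile f g" "mass f = \<mu>"
    using exists_negative_weighted_energy[OF p \<mu> _ _ l] w by (metis less_imp_le)
  then have "{weighted_energy p \<alpha> \<gamma> l f g |f g. decreasing_profile f g \<and> mass f = \<mu>} \<noteq> {}"
    by blast
  from cInf_less_iff[OF this weighted_energy_bdd_below, of e] show thesis
    using assms that by (auto simp: min_energy_def)
qed

lemma min_energy_le_lower_mass:
  assumes f: "decreasing_profile f g" and m: "mass f \<le> \<mu>"
  shows "min_energy \<alpha> \<gamma> l \<le> weighted_energy p \<alpha> \<gamma> l f g"
proof (cases "weighted_energy p \<alpha> \<gamma> l f g < 0")
  case True
  then obtain c where "0 \<le> c" "mass (\<lambda>x. c * f x) = \<mu>"
    "weighted_energy p \<alpha> \<gamma> l (\<lambda>x. c * f x) (\<lambda>x. c * g x) \<le> weighted_energy p \<alpha> \<gamma> l f g"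
    using weighted_energy_restore_mass[OF f m _ _ p(1)] w by (metis less_imp_le)
  then show ?thesis using min_energy_le[OF decreasing_profile_const_mult[OF f, of c]] by simp
next
  case False
  then show ?thesis using min_energy_neg by simp
qed

lemma minimizing_sequence:
  obtains f g where "\<And>n. decreasing_profile (f n) (g n)" "\<And>n. mass (f n) = \<mu>"
    "\<And>n. weighted_energy p \<alpha> \<gamma> l (f n) (g n) < 0"
    "(\<lambda>n. weighted_energy p \<alpha> \<gamma> l (f n) (g n)) \<longlonglongrightarrow> min_energy \<alpha> \<gamma> l"
proof -
  define e where "e n = min 0 (min_energy \<alpha> \<gamma> l + inverse (real (Suc n)))" for n
  have "\<exists>f g. decreasing_profile f g \<and> mass f = \<mu> \<and> weighted_energy p \<alpha> \<gamma> l f g < e n" for n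
  proof -
    have "min_energy \<alpha> \<gamma> l < e n" using min_energy_neg by (simp add: e_def)
    then show ?thesis by (rule min_energy_less_witness) blast
  qed
  then obtain f g where fg: "\<And>n. decreasing_profile (f n) (g n)" "\<And>n. mass (f n) = \<mu>"
      "\<And>n. weighted_energy p \<alpha> \<gamma> l (f n) (g n) < e n"
    by metis
  have "e \<longlonglongrightarrow> min 0 (min_energy \<alpha> \<gamma> l + 0)"
    unfolding e_def by (intro tendsto_intros LIMSEQ_inverse_real_of_nat)
  then have e: "e \<longlonglongrightarrow> min_energy \<alpha> \<gamma> l" using min_energy_neg by simp
  have "(\<lambda>n. weighted_energy p \<alpha> \<gamma> l (f n) (g n)) \<longlonglongrightarrow> min_energy \<alpha> \<gamma> l"
  proof (rule real_tendsto_sandwich[OF always_eventually always_eventually tendsto_const e])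
    show "\<forall>n. weighted_energy p \<alpha> \<gamma> l (f n) (g n) \<le> e n" using fg(3) less_imp_le by blast
  qed (use min_energy_le[OF fg(1,2)] in blast)
  then show thesis using fg by (intro that) (auto simp: e_def)
qed

text \<open>Monotone profiles have uniformly small tails, so a minimizing sequence can only lose mass;
  as the infimum is negative, multiplying the limit by a constant restores it at no cost.\<close>

lemma min_energy_attained:
  obtains f g
    where "decreasing_profile f g" "mass f = \<mu>" "weighted_energy p \<alpha> \<gamma> l f g = min_energy \<alpha> \<gamma> l"
proof -
  obtain f g where fg: "\<And>n. decreasing_profile (f n) (g n)" "\<And>n. mass (f n) = \<mu>"
      "\<And>n. weighted_energy p \<alpha> \<gamma> l (f n) (g n) < 0"
      and E: "(\<lambda>n. weighted_energy p \<alpha> \<gamma> l (f n) (g n)) \<longlonglongrightarrow> min_energy \<alpha> \<gamma> l"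
    by (rule minimizing_sequence) blast
  define c where "c = min \<alpha> \<gamma>"
  have c: "0 < c" "c \<le> \<alpha>" "c \<le> \<gamma>" using w by (simp_all add: c_def)
  obtain M where M: "\<And>n. f n 0 \<le> M" "\<And>n. kinetic \<alpha> \<gamma> l (g n) \<le> M"
    using negative_energy_bounds[OF w] fg l by (metis less_imp_le)
  have "sqnorm {0..} (g n) \<le> M / c" for n
    using kinetic_ge_sqnorm[OF c(2,3) decreasing_profileD(5)[OF fg(1)] l, of n] M(2)[of n] c(1)
    by (simp add: pos_le_divide_eq mult.commute)
  then obtain r h where r: "strict_mono r" and h: "\<And>x. 0 \<le> x \<Longrightarrow> (\<lambda>n. f (r n) x) \<longlonglongrightarrow> h x"
    using decreasing_profiles_convergent_subsequence[of f g M, OF fg(1) M(1)] by metis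
  note lim_facts = fg(1) M(1) eq_refl[OF fg(2)] h
  have pot: "(\<lambda>n. powr_int p {0..} (f (r n))) \<longlonglongrightarrow> powr_int p {0..} h"
    by (rule powr_int_profile_limit[OF lim_facts p(1)])
  have "(\<lambda>n. 2 * (weighted_energy p \<alpha> \<gamma> l (f (r n)) (g (r n)) + powr_int p {0..} (f (r n)) / p))
      \<longlonglongrightarrow> 2 * (min_energy \<alpha> \<gamma> l + powr_int p {0..} h / p)"
    using LIMSEQ_subseq_LIMSEQ[OF E r] p by (intro tendsto_intros pot) (simp_all add: o_def)
  then have "(\<lambda>n. kinetic \<alpha> \<gamma> l (g (r n))) \<longlonglongrightarrow> 2 * (min_energy \<alpha> \<gamma> l + powr_int p {0..} h / p)"
    by (simp add: weighted_energy_def)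
  then obtain k where k: "has_L2_deriv_on h k {0..}"
      "kinetic \<alpha> \<gamma> l k \<le> 2 * (min_energy \<alpha> \<gamma> l + powr_int p {0..} h / p)"
    using kinetic_lower_semicontinuous[of "\<lambda>n. f (r n)" "\<lambda>n. g (r n)", OF fg(1) h w l] by blast
  have h_profile: "decreasing_profile h k"
    unfolding decreasing_profile_def
    using k(1) L2_on_profile_limit[OF lim_facts] decreasing_profileD(1,2)[OF fg(1)]
    by (auto intro: LIMSEQ_le_const[OF h] LIMSEQ_le[OF h h])
  have E_h: "weighted_energy p \<alpha> \<gamma> l h k \<le> min_energy \<alpha> \<gamma> l"
    using k(2) by (simp add: weighted_energy_def)
  then have "weighted_energy p \<alpha> \<gamma> l h k < 0" using min_energy_neg by linarith
  then obtain c where c: "0 \<le> c" "mass (\<lambda>x. c * h x) = \<mu>"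
      "weighted_energy p \<alpha> \<gamma> l (\<lambda>x. c * h x) (\<lambda>x. c * k x) \<le> weighted_energy p \<alpha> \<gamma> l h k"
    using weighted_energy_restore_mass[OF h_profile mass_profile_limit_le[OF lim_facts] _ _ p(1)] w
    by (metis less_imp_le)
  note profile = decreasing_profile_const_mult[OF h_profile c(1)]
  show thesis using that[OF profile c(2)] min_energy_le[OF profile c(2)] c(3) E_h by simp
qed

end

end

section \<open>The critical length of the weighted problem\<close>

lemma weighted_energy_dilate_homogeneous:
  assumes f: "decreasing_profile f g" and q: "0 < q" and p: "p < 6"
  defines "r \<equiv> q powr (2 / (6 - p))"
  shows "weighted_energy p c c 0 (dilate r f) (\<lambda>x. r * dilate r g x)
    = r powr (p / 2 - 1) * weighted_energy p (q * c) (q * c) 0 f g"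
proof -
  have r: "0 < r" using q by (simp add: r_def)
  have "2 / (6 - p) * (3 - p / 2) = 1" using p by (simp add: field_simps)
  then have "r powr (3 - p / 2) = q" using q by (simp add: r_def powr_powr)
  then have "r\<^sup>2 = r powr (p / 2 - 1) * q" using r by (auto simp flip: powr_add)
  then show ?thesis
    unfolding weighted_energy_dilate[OF r]
    by (simp add: weighted_energy_def kinetic_def algebra_simps add_divide_distrib)
qed

lemma
  assumes f: "decreasing_profile f g" and l: "0 \<le> l" and p: "2 \<le> p"
  shows decreasing_profile_shift: "decreasing_profile (\<lambda>x. f (l + x)) (\<lambda>x. g (l + x))"
    and mass_shift_le: "mass (\<lambda>x. f (l + x)) \<le> mass f"
    and weighted_energy_shift_le: "0 \<le> \<alpha> \<Longrightarrow> weighted_energy p \<gamma> \<gamma> 0 (\<lambda>x. f (l + x)) (\<lambda>x. g (l + x))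
      \<le> weighted_energy p \<alpha> \<gamma> l f g + l * f 0 powr p / p"
proof -
  have shift: "{x. l + 1 * x \<in> {l..}} = {0..}" by auto
  have affine: "(LINT x:{0..}|lborel. F (l + x)) = (LINT x:{l..}|lborel. F x)" for F :: "real \<Rightarrow> real"
    using set_integral_affine(1)[of 1 l "{l..}" F] unfolding shift by simp
  have sub: "{l..} \<subseteq> {0..}" using l by auto
  note L2 = L2_on_subset[OF _ _ sub]
  show profile: "decreasing_profile (\<lambda>x. f (l + x)) (\<lambda>x. g (l + x))"
    unfolding decreasing_profile_def
    using decreasing_profileD(1,2)[OF f] l L2_on_affine[OF L2[OF decreasing_profileD(3)[OF f]], of 1 l 1]
      has_L2_deriv_on_affine[OF has_L2_deriv_on_subset[OF decreasing_profileD(4)[OF f] sub], of 1 1 l]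
    unfolding shift by simp
  show "mass (\<lambda>x. f (l + x)) \<le> mass f"
    using affine[of "\<lambda>x. (f x)\<^sup>2"] sqnorm_mono[OF decreasing_profileD(3)[OF f] _ sub] by simp
  assume \<alpha>: "0 \<le> \<alpha>"
  note int = decreasing_profile_powr_integrable[OF f p]
  have "powr_int p {0..l} f \<le> (l - 0) * f 0 powr p"
    using decreasing_profile_abs_le[OF f] p l
    by (intro set_integral_le_const_mult_length set_integrable_subset[OF int] powr_mono2) auto
  then have "powr_int p {0..} f / p \<le> l * f 0 powr p / p + powr_int p {l..} f / p"
    using set_integral_Ici_split[OF int l] p by (simp add: divide_right_mono flip: add_divide_distrib)
  moreover have "kinetic \<gamma> \<gamma> 0 (\<lambda>x. g (l + x)) \<le> kinetic \<alpha> \<gamma> l g"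
    using kinetic_eq[OF decreasing_profileD(5)[OF profile], of 0 \<gamma> \<gamma>] affine[of "\<lambda>x. (g x)\<^sup>2"] \<alpha>
    by (simp add: kinetic_def[of \<alpha>])
  ultimately show "weighted_energy p \<gamma> \<gamma> 0 (\<lambda>x. f (l + x)) (\<lambda>x. g (l + x))
      \<le> weighted_energy p \<alpha> \<gamma> l f g + l * f 0 powr p / p"
    using affine[of "\<lambda>x. \<bar>f x\<bar> powr p"] by (simp add: weighted_energy_def)
qed

lemma weighted_energy_dilate_le:
  assumes r: "1 \<le> r" and p: "2 \<le> p"
  shows "weighted_energy p \<alpha> \<gamma> l (dilate r f) (\<lambda>x. r * dilate r g x)
    \<le> weighted_energy p \<alpha> \<gamma> (r * l) f g + (r\<^sup>2 - 1) * kinetic \<alpha> \<gamma> (r * l) g / 2"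
proof -
  have "1 * (powr_int p {0..} f / p) \<le> r powr (p / 2 - 1) * (powr_int p {0..} f / p)"
    using r p by (intro mult_right_mono ge_one_powr_ge_zero) auto
  then show ?thesis
    using weighted_energy_dilate[of r] r
    by (simp add: weighted_energy_def left_diff_distrib diff_divide_distrib)
qed

context subcritical
begin

lemma min_energy_antimono:
  assumes w: "0 < \<alpha>" "\<alpha> \<le> \<gamma>" and l: "0 \<le> l" "l \<le> l'"
  shows "min_energy \<alpha> \<gamma> l' \<le> min_energy \<alpha> \<gamma> l"
proof -
  obtain f g where f: "decreasing_profile f g" "mass f = \<mu>"
      "weighted_energy p \<alpha> \<gamma> l f g = min_energy \<alpha> \<gamma> l"
    using min_energy_attained[of \<alpha> \<gamma> l] w l by auto
  note g = decreasing_profileD(5)[OF f(1)]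
  have "kinetic \<alpha> \<gamma> l' g \<le> kinetic \<alpha> \<gamma> l g"
    unfolding kinetic_eq[OF g l(1)] kinetic_eq[OF g order_trans[OF l]]
    using w l by (intro add_left_mono mult_left_mono sqnorm_mono L2_on_subset[OF g]) auto
  then show ?thesis
    using min_energy_le[of \<alpha> \<gamma> l', OF _ _ _ f(1,2)] f(3) w l by (simp add: weighted_energy_def)
qed

lemma min_energy_homogeneous_strict_mono:
  assumes c: "0 < c" "c < c'"
  shows "min_energy c c 0 < min_energy c' c' 0"
proof -
  obtain f g where f: "decreasing_profile f g" "mass f = \<mu>"
      "weighted_energy p c' c' 0 f g = min_energy c' c' 0"
    using min_energy_attained[of c' c' 0] c by auto
  define r where "r = (c' / c) powr (2 / (6 - p))"
  have r: "1 < r" unfolding r_def using c p by (intro gr_one_powr) auto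
  have "min_energy c c 0 \<le> weighted_energy p c c 0 (dilate r f) (\<lambda>x. r * dilate r g x)"
    using c r f(2) by (intro min_energy_le decreasing_profile_dilate[OF f(1)]) (auto simp: mass_dilate)
  also have "\<dots> = r powr (p / 2 - 1) * min_energy c' c' 0"
    using weighted_energy_dilate_homogeneous[OF f(1), of "c' / c" p c] c p f(3) by (simp add: r_def)
  also have "\<dots> < min_energy c' c' 0"
    using min_energy_neg[of c' c' 0] gr_one_powr[OF r, of "p / 2 - 1"] p c
    by (simp add: mult_less_cancel_right2)
  finally show ?thesis .
qed

lemma exists_length_min_energy_less:
  assumes c: "0 < \<alpha>" "\<alpha> < \<beta>" "\<beta> < \<gamma>"
  obtains l where "0 < l" "min_energy \<alpha> \<gamma> l < min_energy \<beta> \<beta> 0"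
proof -
  obtain f g where f: "decreasing_profile f g" "mass f = \<mu>"
      "weighted_energy p \<alpha> \<alpha> 0 f g = min_energy \<alpha> \<alpha> 0"
    using min_energy_attained[of \<alpha> \<alpha> 0] c by auto
  note g = decreasing_profileD(5)[OF f(1)]
  have "((\<lambda>l. min_energy \<alpha> \<alpha> 0 + (\<gamma> - \<alpha>) / 2 * sqnorm {l..} g) \<longlongrightarrow> min_energy \<alpha> \<alpha> 0 + (\<gamma> - \<alpha>) / 2 * 0) at_top"
    by (intro tendsto_intros set_integral_Ici_tail_tendsto_0[OF L2_onD(2)[OF g]])
  then have "\<forall>\<^sub>F l in at_top. min_energy \<alpha> \<alpha> 0 + (\<gamma> - \<alpha>) / 2 * sqnorm {l..} g < min_energy \<beta> \<beta> 0"
    using min_energy_homogeneous_strict_mono[of \<alpha> \<beta>] c by (intro order_tendstoD(2)) auto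
  then obtain l where l: "0 < l" "min_energy \<alpha> \<alpha> 0 + (\<gamma> - \<alpha>) / 2 * sqnorm {l..} g < min_energy \<beta> \<beta> 0"
    using eventually_happens'[OF trivial_limit_at_top_linorder]
      eventually_conj[OF eventually_gt_at_top] by blast
  have "min_energy \<alpha> \<gamma> l \<le> weighted_energy p \<alpha> \<gamma> l f g"
    using c l by (intro min_energy_le f) auto
  also have "\<dots> = min_energy \<alpha> \<alpha> 0 + (\<gamma> - \<alpha>) / 2 * sqnorm {l..} g"
    using l(1) unfolding f(3)[symmetric] weighted_energy_def
    by (simp add: kinetic_eq[OF g] add_divide_distrib)
  also note l(2)
  finally show thesis by (rule that[OF l(1)])
qed

lemma min_energy_less_small_length:
  assumes c: "0 < \<alpha>" "0 < \<beta>" "\<beta> < \<gamma>"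
  obtains l\<^sub>0 where "0 < l\<^sub>0" "\<And>l. 0 \<le> l \<Longrightarrow> min_energy \<alpha> \<gamma> l \<le> min_energy \<beta> \<beta> 0 \<Longrightarrow> l\<^sub>0 \<le> l"
proof -
  obtain M where M: "0 < M" "\<And>f g l. decreasing_profile f g \<Longrightarrow> mass f = \<mu> \<Longrightarrow> 0 \<le> l \<Longrightarrow>
      weighted_energy p \<alpha> \<gamma> l f g \<le> 0 \<Longrightarrow> f 0 \<le> M"
    using negative_energy_bounds[of \<alpha> \<gamma>] c by (metis order_less_trans)
  define \<delta> where "\<delta> = min_energy \<gamma> \<gamma> 0 - min_energy \<beta> \<beta> 0"
  have \<delta>: "0 < \<delta>" using min_energy_homogeneous_strict_mono[OF c(2,3)] by (simp add: \<delta>_def)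
  have "\<delta> * p / M powr p \<le> l" if l: "0 \<le> l" and energy_le: "min_energy \<alpha> \<gamma> l \<le> min_energy \<beta> \<beta> 0" for l
  proof -
    obtain f g where f: "decreasing_profile f g" "mass f = \<mu>"
        "weighted_energy p \<alpha> \<gamma> l f g = min_energy \<alpha> \<gamma> l"
      using min_energy_attained[of \<alpha> \<gamma> l] c l by auto
    have "f 0 powr p \<le> M powr p"
      using M(2)[OF f(1,2) l] f(3) min_energy_neg[of \<alpha> \<gamma> l] decreasing_profileD(1)[OF f(1), of 0] c p l
      by (intro powr_mono2) auto
    then have "l * f 0 powr p / p \<le> l * M powr p / p"
      using l p by (intro divide_right_mono mult_left_mono) auto
    moreover have "min_energy \<gamma> \<gamma> 0 \<le> weighted_energy p \<gamma> \<gamma> 0 (\<lambda>x. f (l + x)) (\<lambda>x. g (l + x))"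
      using c p f(2) mass_shift_le[OF f(1) l]
      by (intro min_energy_le_lower_mass decreasing_profile_shift[OF f(1) l]) auto
    ultimately have "\<delta> \<le> l * M powr p / p"
      using weighted_energy_shift_le[OF f(1) l, of p \<alpha> \<gamma>] f(3) energy_le p c by (simp add: \<delta>_def)
    then show ?thesis using M(1) p by (simp add: field_simps)
  qed
  moreover have "0 < \<delta> * p / M powr p" using \<delta> M(1) p by simp
  ultimately show thesis using that by blast
qed

lemma min_energy_le_dilation:
  assumes w: "0 < \<alpha>" "0 < \<gamma>"
  obtains M where "\<And>l l'. 0 < l \<Longrightarrow> l \<le> l' \<Longrightarrow>
    min_energy \<alpha> \<gamma> l \<le> min_energy \<alpha> \<gamma> l' + ((l' / l)\<^sup>2 - 1) * M / 2"
proof -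
  obtain M where M: "\<And>f g l. decreasing_profile f g \<Longrightarrow> mass f = \<mu> \<Longrightarrow> 0 \<le> l \<Longrightarrow>
      weighted_energy p \<alpha> \<gamma> l f g \<le> 0 \<Longrightarrow> kinetic \<alpha> \<gamma> l g \<le> M"
    using negative_energy_bounds[OF w] by metis
  have "min_energy \<alpha> \<gamma> l \<le> min_energy \<alpha> \<gamma> l' + ((l' / l)\<^sup>2 - 1) * M / 2" if l: "0 < l" "l \<le> l'" for l l'
  proof -
    obtain f g where f: "decreasing_profile f g" "mass f = \<mu>"
        "weighted_energy p \<alpha> \<gamma> l' f g = min_energy \<alpha> \<gamma> l'"
      using min_energy_attained[of \<alpha> \<gamma> l'] w l by auto
    define r where "r = l' / l"
    have r: "1 \<le> r" "r * l = l'" using l by (simp_all add: r_def)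
    have "min_energy \<alpha> \<gamma> l \<le> weighted_energy p \<alpha> \<gamma> l (dilate r f) (\<lambda>x. r * dilate r g x)"
      using w l r f(2)
      by (intro min_energy_le decreasing_profile_dilate[OF f(1)]) (auto simp: mass_dilate)
    also have "\<dots> \<le> min_energy \<alpha> \<gamma> l' + (r\<^sup>2 - 1) * kinetic \<alpha> \<gamma> l' g / 2"
      using weighted_energy_dilate_le[OF r(1), of p \<alpha> \<gamma> l f g] p f(3) r(2) by simp
    also have "(r\<^sup>2 - 1) * kinetic \<alpha> \<gamma> l' g \<le> (r\<^sup>2 - 1) * M"
      using M[OF f(1,2)] f(3) min_energy_neg[of \<alpha> \<gamma> l'] w l r(1) by (intro mult_left_mono) auto
    finally show ?thesis by (simp add: r_def)
  qed
  then show thesis by (rule that)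
qed

lemma critical_length:
  assumes c: "0 < \<alpha>" "\<alpha> < \<beta>" "\<beta> < \<gamma>"
  shows "\<exists>l\<^sub>0>0. \<forall>l>0. min_energy \<alpha> \<gamma> l \<le> min_energy \<beta> \<beta> 0 \<longleftrightarrow> l\<^sub>0 \<le> l"
proof -
  define S where "S = {l. 0 < l \<and> min_energy \<alpha> \<gamma> l \<le> min_energy \<beta> \<beta> 0}"
  obtain L where "0 < L" "min_energy \<alpha> \<gamma> L < min_energy \<beta> \<beta> 0"
    by (rule exists_length_min_energy_less[OF c])
  then have "L \<in> S" by (simp add: S_def)
  then have nonempty: "S \<noteq> {}" by blast
  obtain l\<^sub>0 where l0: "0 < l\<^sub>0" "\<And>l. l \<in> S \<Longrightarrow> l\<^sub>0 \<le> l"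
    using min_energy_less_small_length[OF c(1) _ c(3)] c unfolding S_def
    by (metis (no_types, lifting) less_imp_le mem_Collect_eq order_less_trans)
  then have bdd: "bdd_below S" by (intro bdd_belowI)
  have Inf: "0 < Inf S" using cInf_greatest[OF nonempty l0(2)] l0(1) by linarith
  obtain M where M: "\<And>l l'. 0 < l \<Longrightarrow> l \<le> l' \<Longrightarrow>
      min_energy \<alpha> \<gamma> l \<le> min_energy \<alpha> \<gamma> l' + ((l' / l)\<^sup>2 - 1) * M / 2"
    using min_energy_le_dilation[of \<alpha> \<gamma>] c by auto
  define h where "h l = min_energy \<beta> \<beta> 0 + ((l / Inf S)\<^sup>2 - 1) * M / 2" for l
  have "min_energy \<alpha> \<gamma> (Inf S) \<le> h (Inf S)"
  proof (rule continuous_ge_on_closure[OF _ closure_contains_Inf[OF nonempty bdd]])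
    show "continuous_on (closure S) h"
      unfolding h_def[abs_def] using Inf by (intro continuous_intros) auto
    show "min_energy \<alpha> \<gamma> (Inf S) \<le> h l" if "l \<in> S" for l
      using M[OF Inf cInf_lower[OF that bdd]] that by (simp add: S_def h_def)
  qed
  then have "min_energy \<alpha> \<gamma> (Inf S) \<le> min_energy \<beta> \<beta> 0" using Inf by (simp add: h_def)
  then have "min_energy \<alpha> \<gamma> l \<le> min_energy \<beta> \<beta> 0" if "Inf S \<le> l" for l
    using min_energy_antimono[of \<alpha> \<gamma> "Inf S" l] that c Inf by simp
  moreover have "Inf S \<le> l" if "0 < l" "min_energy \<alpha> \<gamma> l \<le> min_energy \<beta> \<beta> 0" for l
    using that bdd by (intro cInf_lower) (simp_all add: S_def)
  ultimately show ?thesis using Inf by blast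
qed

end

section \<open>Crossings of level bands\<close>

lemma power2_add_le_mult_add:
  fixes x y a b c d :: real
  assumes "x\<^sup>2 \<le> a * b" "y\<^sup>2 \<le> c * d" "0 \<le> a" "0 \<le> b" "0 \<le> c" "0 \<le> d"
  shows "(x + y)\<^sup>2 \<le> (a + c) * (b + d)"
proof -
  have "(x * y)\<^sup>2 \<le> (a * b) * (c * d)"
    unfolding power_mult_distrib using assms by (intro mult_mono) auto
  also have "\<dots> = (a * d) * (c * b)" by (simp add: ac_simps)
  also have "\<dots> \<le> ((a * d + c * b) / 2)\<^sup>2"
    using zero_le_power2[of "a * d - c * b"] by (simp add: power2_eq_square field_simps)
  finally have "\<bar>x * y\<bar> \<le> (a * d + c * b) / 2"
    using assms by (simp add: abs_le_square_iff[symmetric])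
  then have "x * y \<le> (a * d + c * b) / 2" by linarith
  then show ?thesis using assms(1,2) by (simp add: power2_eq_square algebra_simps)
qed

lemma power2_sum_le_mult_sum:
  fixes x a b :: "'a \<Rightarrow> real"
  assumes "\<And>i. i \<in> S \<Longrightarrow> (x i)\<^sup>2 \<le> a i * b i" "\<And>i. i \<in> S \<Longrightarrow> 0 \<le> a i" "\<And>i. i \<in> S \<Longrightarrow> 0 \<le> b i"
  shows "(\<Sum>i\<in>S. x i)\<^sup>2 \<le> (\<Sum>i\<in>S. a i) * (\<Sum>i\<in>S. b i)"
  using assms
  by (induction S rule: infinite_finite_induct) (auto intro!: power2_add_le_mult_add sum_nonneg)

lemma continuous_on_band_crossing:
  fixes w :: "real \<Rightarrow> real"
  assumes cont: "continuous_on {a..b} w" and "a \<le> b" and w: "w a \<le> s" "s < t" "t \<le> w b"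
  obtains c d where "a \<le> c" "c < d" "d \<le> b" "w c \<le> s" "t \<le> w d" "\<And>x. x \<in> {c<..<d} \<Longrightarrow> w x \<in> {s<..<t}"
proof -
  have compact: "compact ({a..b'} \<inter> w -` C)" if "b' \<le> b" "closed C" for b' C
    unfolding compact_eq_bounded_closed using that
    by (intro conjI continuous_closed_preimage continuous_on_subset[OF cont] bounded_Int disjI1) auto
  have "b \<in> {a..b} \<inter> w -` {t..}" using \<open>a \<le> b\<close> w(3) by simp
  then obtain d where d: "d \<in> {a..b} \<inter> w -` {t..}" "\<And>x. x \<in> {a..b} \<inter> w -` {t..} \<Longrightarrow> d \<le> x"
    using compact_attains_inf[OF compact[OF order_refl closed_atLeast]] by (metis empty_iff)
  have "a \<in> {a..d} \<inter> w -` {..s}" using d(1) w(1) by simp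
  then obtain c where c: "c \<in> {a..d} \<inter> w -` {..s}" "\<And>x. x \<in> {a..d} \<inter> w -` {..s} \<Longrightarrow> x \<le> c"
    using compact_attains_sup[OF compact[OF _ closed_atMost]] d(1)
    by (metis IntD1 atLeastAtMost_iff empty_iff)
  have "w x \<in> {s<..<t}" if "x \<in> {c<..<d}" for x
    using c(1) c(2)[of x] d(1) d(2)[of x] that by (auto simp: not_le[symmetric])
  moreover have "c < d" using c(1) d(1) w(2) by (cases "c = d") auto
  ultimately show thesis using c(1) d(1) by (intro that[of c d]) auto
qed

lemma has_L2_deriv_on_band_crossing:
  assumes u: "has_L2_deriv_on u g I" "is_interval I" and ab: "a \<in> I" "b \<in> I" "a \<le> b"
    and t: "min \<bar>u a\<bar> \<bar>u b\<bar> \<le> s" "s < t" "t \<le> max \<bar>u a\<bar> \<bar>u b\<bar>"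
  obtains c d where "a \<le> c" "c < d" "d \<le> b" "\<And>x. x \<in> {c<..<d} \<Longrightarrow> \<bar>u x\<bar> \<in> {s<..<t}"
    "(t - s)\<^sup>2 \<le> (d - c) * sqnorm {c<..<d} g"
proof -
  have sub: "{a..b} \<subseteq> I" by (rule is_interval_Icc_subset[OF u(2) ab(1,2)])
  have cont: "continuous_on {a..b} (\<lambda>x. \<bar>u x\<bar>)"
    by (intro continuous_on_rabs continuous_on_subset[OF has_L2_deriv_on_imp_continuous_on[OF u] sub])
  obtain c d where cd: "a \<le> c" "c < d" "d \<le> b" "\<And>x. x \<in> {c<..<d} \<Longrightarrow> \<bar>u x\<bar> \<in> {s<..<t}"
    and jump: "\<bar>u c\<bar> \<le> s \<and> t \<le> \<bar>u d\<bar> \<or> \<bar>u d\<bar> \<le> s \<and> t \<le> \<bar>u c\<bar>"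
  proof (cases "\<bar>u a\<bar> \<le> s")
    case True
    with t have "t \<le> \<bar>u b\<bar>" by linarith
    from continuous_on_band_crossing[OF cont ab(3) True t(2) this] show thesis
      using that by metis
  next
    case False
    with t have "- \<bar>u a\<bar> \<le> - t" "- t < - s" "- s \<le> - \<bar>u b\<bar>" by linarith+
    from continuous_on_band_crossing[OF continuous_on_minus[OF cont] ab(3) this]
    obtain c d where "a \<le> c" "c < d" "d \<le> b" "- \<bar>u c\<bar> \<le> - t" "- s \<le> - \<bar>u d\<bar>"
      "\<And>x. x \<in> {c<..<d} \<Longrightarrow> - \<bar>u x\<bar> \<in> {- t<..<- s}" by blast
    then show thesis by (intro that[of c d]) auto
  qed
  have "\<bar>t - s\<bar> \<le> \<bar>u d - u c\<bar>" using jump t(2) by linarith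
  then have "(t - s)\<^sup>2 \<le> (u d - u c)\<^sup>2" by (simp add: abs_le_square_iff)
  also have "\<dots> \<le> (d - c) * sqnorm {c..d} g"
    by (rule has_L2_deriv_on_Hoelder_Icc[OF u(1)]) (use sub cd(1-3) u(2) in auto)
  also have "sqnorm {c..d} g = sqnorm {c<..<d} g"
    unfolding set_lebesgue_integral_def
    by (rule integral_discrete_difference[of "{c, d}"]) (auto split: split_indicator)
  finally show thesis using that[OF cd] by simp
qed

locale edge_family =
  fixes E :: "'e set" and I :: "'e \<Rightarrow> real set" and u g :: "'e \<Rightarrow> real \<Rightarrow> real"
  assumes finite_edges: "finite E"
    and interval: "\<And>i. i \<in> E \<Longrightarrow> is_interval (I i)"
    and L2: "\<And>i. i \<in> E \<Longrightarrow> L2_on (I i) (u i)"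
    and deriv: "\<And>i. i \<in> E \<Longrightarrow> has_L2_deriv_on (u i) (g i) (I i)"
    and bounded: "\<exists>M. \<forall>i\<in>E. \<forall>x\<in>I i. \<bar>u i x\<bar> \<le> M"
begin

definition level :: "'e \<Rightarrow> real set \<Rightarrow> real set" where
  "level i A = {x \<in> I i. \<bar>u i x\<bar> \<in> A}"

definition level_length :: "real set \<Rightarrow> real" where
  "level_length A = (\<Sum>i\<in>E. measure lborel (level i A))"

definition level_kinetic :: "real set \<Rightarrow> real" where
  "level_kinetic A = (\<Sum>i\<in>E. sqnorm (level i A) (g i))"

definition total_mass :: real where
  "total_mass = (\<Sum>i\<in>E. sqnorm (I i) (u i))"

definition total_kinetic :: real where
  "total_kinetic = (\<Sum>i\<in>E. sqnorm (I i) (g i))"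

definition total_powr_int :: "real \<Rightarrow> real" where
  "total_powr_int q = (\<Sum>i\<in>E. powr_int q (I i) (u i))"

lemma deriv_L2: "i \<in> E \<Longrightarrow> L2_on (I i) (g i)"
  using has_L2_deriv_onD(1)[OF deriv] .

lemma level_subset: "level i A \<subseteq> I i"
  by (auto simp: level_def)

lemma level_mono: "A \<subseteq> B \<Longrightarrow> level i A \<subseteq> level i B"
  by (auto simp: level_def)

lemma sets_level:
  assumes i: "i \<in> E" and A: "A \<in> sets borel"
  shows "level i A \<in> sets lborel"
proof -
  note [measurable] = L2_onD(1)[OF L2[OF i]] is_interval_sets_lborel[OF interval[OF i], simplified] A
  have "{x \<in> space borel. x \<in> I i \<and> \<bar>indicator (I i) x * u i x\<bar> \<in> A} \<in> sets borel" by measurable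
  also have "{x \<in> space borel. x \<in> I i \<and> \<bar>indicator (I i) x * u i x\<bar> \<in> A} = level i A"
    by (auto simp: level_def)
  finally show ?thesis by simp
qed

lemma fmeasurable_level:
  assumes i: "i \<in> E" and A: "A \<in> sets borel" "A \<subseteq> {t<..}" and t: "0 < t"
  shows "level i A \<in> fmeasurable lborel"
proof (rule fmeasurableI[OF sets_level[OF i A(1)]])
  have "emeasure lborel (level i A) = (\<integral>\<^sup>+x. indicator (level i A) x \<partial>lborel)"
    using sets_level[OF i A(1)] by simp
  also have "\<dots> \<le> (\<integral>\<^sup>+x. ennreal (indicator (I i) x *\<^sub>R (u i x)\<^sup>2 / t\<^sup>2) \<partial>lborel)"
  proof (rule nn_integral_mono)
    fix x
    have "1 \<le> (u i x)\<^sup>2 / t\<^sup>2" if "x \<in> level i A"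
      using that A(2) t power_mono[of t "\<bar>u i x\<bar>" 2] by (auto simp: level_def)
    then show "indicator (level i A) x \<le> ennreal (indicator (I i) x *\<^sub>R (u i x)\<^sup>2 / t\<^sup>2)"
      using level_subset[of i A] by (auto split: split_indicator)
  qed
  also have "\<dots> = ennreal (sqnorm (I i) (u i) / t\<^sup>2)"
    using L2_onD(2)[OF L2[OF i]]
    by (subst nn_integral_eq_integral) (auto simp: set_integrable_def set_lebesgue_integral_def)
  finally show "emeasure lborel (level i A) < \<infinity>" by (simp add: le_less_trans)
qed

lemma
  assumes i: "i \<in> E" and A: "A \<in> sets borel"
    and BC: "B \<in> sets lborel" "C \<in> sets lborel" "B \<inter> C = {}" "B \<subseteq> level i A" "C \<subseteq> level i A"
  shows measure_level_superadditive:
      "A \<subseteq> {t<..} \<Longrightarrow> 0 < t \<Longrightarrow> measure lborel B + measure lborel C \<le> measure lborel (level i A)"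
    and sqnorm_level_superadditive: "sqnorm B (g i) + sqnorm C (g i) \<le> sqnorm (level i A) (g i)"
proof -
  have lev: "L2_on (level i A) (g i)"
    by (rule L2_on_subset[OF deriv_L2[OF i] sets_level[OF i A] level_subset])
  have "sqnorm B (g i) + sqnorm C (g i) = sqnorm (B \<union> C) (g i)"
    using BC by (intro set_integral_Un[symmetric] L2_onD(2) L2_on_subset[OF lev]) auto
  also have "\<dots> \<le> sqnorm (level i A) (g i)"
    using BC by (intro sqnorm_mono[OF lev]) auto
  finally show "sqnorm B (g i) + sqnorm C (g i) \<le> sqnorm (level i A) (g i)" .
  assume "A \<subseteq> {t<..}" "0 < t"
  note fin = fmeasurable_level[OF i A this]
  have "measure lborel B + measure lborel C = measure lborel (B \<union> C)"
    using BC fmeasurableI2[OF fin BC(4)] fmeasurableI2[OF fin BC(5)]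
    by (intro measure_Union[symmetric]) (auto simp: fmeasurable_def)
  also have "\<dots> \<le> measure lborel (level i A)"
    using BC by (intro measure_mono_fmeasurable[OF _ _ fin]) auto
  finally show "measure lborel B + measure lborel C \<le> measure lborel (level i A)" .
qed

lemma level_length_nonneg [simp]: "0 \<le> level_length A"
  by (simp add: level_length_def sum_nonneg)

lemma level_kinetic_nonneg [simp]: "0 \<le> level_kinetic A"
  by (simp add: level_kinetic_def sum_nonneg)

lemma level_kinetic_le_total_kinetic: "A \<in> sets borel \<Longrightarrow> level_kinetic A \<le> total_kinetic"
  unfolding level_kinetic_def total_kinetic_def
  by (intro sum_mono sqnorm_mono deriv_L2 sets_level level_subset)

lemma level_length_superadditive:
  assumes "A \<in> sets borel" "B \<in> sets borel" "C \<in> sets borel" "A \<inter> B = {}" "A \<union> B \<subseteq> C" "C \<subseteq> {t<..}"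
    "0 < t"
  shows "level_length A + level_length B \<le> level_length C"
  unfolding level_length_def sum.distrib[symmetric] using assms
  by (intro sum_mono measure_level_superadditive sets_level level_mono) (auto simp: level_def)

lemma level_kinetic_superadditive:
  assumes "A \<in> sets borel" "B \<in> sets borel" "C \<in> sets borel" "A \<inter> B = {}" "A \<union> B \<subseteq> C"
  shows "level_kinetic A + level_kinetic B \<le> level_kinetic C"
  unfolding level_kinetic_def sum.distrib[symmetric] using assms
  by (intro sum_mono sqnorm_level_superadditive sets_level level_mono) (auto simp: level_def)

text \<open>What the Cauchy-Schwarz inequality yields when the band between the levels \<open>s\<close> and \<open>t\<close> is
  crossed at least \<open>n\<close> times, on a single edge and on the whole family.\<close>

definition edge_crosses :: "'e \<Rightarrow> real \<Rightarrow> real \<Rightarrow> real \<Rightarrow> bool" where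
  "edge_crosses i n s t \<longleftrightarrow>
    (n * (t - s))\<^sup>2 \<le> measure lborel (level i {s<..<t}) * sqnorm (level i {s<..<t}) (g i)"

definition crosses :: "real \<Rightarrow> real \<Rightarrow> real \<Rightarrow> bool" where
  "crosses n s t \<longleftrightarrow> (n * (t - s))\<^sup>2 \<le> level_length {s<..<t} * level_kinetic {s<..<t}"

lemma crosses_mono:
  assumes "crosses n s t" "0 \<le> m" "m \<le> n" "s \<le> t"
  shows "crosses m s t"
proof -
  have "(m * (t - s))\<^sup>2 \<le> (n * (t - s))\<^sup>2"
    using assms by (intro power_mono mult_right_mono) auto
  with assms(1) show ?thesis unfolding crosses_def by linarith
qed

lemma crosses_trans:
  assumes "crosses n r s" "crosses n s t" "0 < r" "r \<le> s" "s \<le> t"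
  shows "crosses n r t"
proof -
  have length: "level_length {r<..<s} + level_length {s<..<t} \<le> level_length {r<..<t}"
    by (rule level_length_superadditive[where t = r]) (use assms in auto)
  have kinetic: "level_kinetic {r<..<s} + level_kinetic {s<..<t} \<le> level_kinetic {r<..<t}"
    by (rule level_kinetic_superadditive) (use assms in auto)
  have "(n * (s - r) + n * (t - s))\<^sup>2
      \<le> (level_length {r<..<s} + level_length {s<..<t}) *
          (level_kinetic {r<..<s} + level_kinetic {s<..<t})"
    by (rule power2_add_le_mult_add) (use assms in \<open>auto simp: crosses_def\<close>)
  also have "\<dots> \<le> level_length {r<..<t} * level_kinetic {r<..<t}"
    by (rule mult_mono[OF length kinetic]) simp_all
  finally show ?thesis unfolding crosses_def by (simp add: algebra_simps)
qed

lemma crosses_glue: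
  assumes low: "\<And>s t. 0 < s \<Longrightarrow> s < t \<Longrightarrow> t \<le> v \<Longrightarrow> crosses n s t"
    and high: "\<And>s t. 0 < s \<Longrightarrow> s < t \<Longrightarrow> v \<le> s \<Longrightarrow> t \<le> m \<Longrightarrow> crosses n s t"
    and t: "0 < s" "s < t" "t \<le> m"
  shows "crosses n s t"
proof -
  consider "t \<le> v" | "v \<le> s" | "s < v" "v < t" by linarith
  then show ?thesis
  proof cases
    case 3
    with t have "crosses n s v" "crosses n v t" by (auto intro: low high)
    then show ?thesis by (rule crosses_trans) (use 3 t in auto)
  qed (use low high t in blast)+
qed

lemma crosses_sum:
  assumes "\<And>i. i \<in> E \<Longrightarrow> edge_crosses i (n i) s t"
  shows "crosses (\<Sum>i\<in>E. n i) s t"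
  using assms
    power2_sum_le_mult_sum[of E "\<lambda>i. n i * (t - s)" "\<lambda>i. measure lborel (level i {s<..<t})"
      "\<lambda>i. sqnorm (level i {s<..<t}) (g i)"]
  by (simp add: crosses_def edge_crosses_def level_length_def level_kinetic_def sum_distrib_right)

lemma edge_crosses_0 [simp]: "edge_crosses i 0 s t"
  by (simp add: edge_crosses_def)

lemma edge_crossing:
  assumes i: "i \<in> E" and ab: "a \<in> I i" "b \<in> I i" "a \<le> b"
    and st: "min \<bar>u i a\<bar> \<bar>u i b\<bar> \<le> s" "s < t" "t \<le> max \<bar>u i a\<bar> \<bar>u i b\<bar>"
  obtains B where "B \<in> sets lborel" "B \<subseteq> {a<..<b}" "B \<subseteq> level i {s<..<t}"
    "(t - s)\<^sup>2 \<le> measure lborel B * sqnorm B (g i)"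
proof -
  obtain c d where cd: "a \<le> c" "c < d" "d \<le> b" "\<And>x. x \<in> {c<..<d} \<Longrightarrow> \<bar>u i x\<bar> \<in> {s<..<t}"
      "(t - s)\<^sup>2 \<le> (d - c) * sqnorm {c<..<d} (g i)"
    using has_L2_deriv_on_band_crossing[OF deriv[OF i] interval[OF i] ab st] by metis
  have "{c<..<d} \<subseteq> level i {s<..<t}"
    using cd(1,3,4) is_interval_Icc_subset[OF interval[OF i] ab(1,2)] by (auto simp: level_def)
  with cd show thesis by (intro that[of "{c<..<d}"]) auto
qed

lemma edge_crosses_once:
  assumes i: "i \<in> E" and ab: "a \<in> I i" "b \<in> I i" "a \<le> b"
    and st: "min \<bar>u i a\<bar> \<bar>u i b\<bar> \<le> s" "s < t" "t \<le> max \<bar>u i a\<bar> \<bar>u i b\<bar>" and s: "0 < s"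
  shows "edge_crosses i 1 s t"
proof -
  obtain B where B: "B \<in> sets lborel" "B \<subseteq> level i {s<..<t}"
      "(t - s)\<^sup>2 \<le> measure lborel B * sqnorm B (g i)"
    using edge_crossing[OF i ab st] by metis
  have "measure lborel B * sqnorm B (g i)
      \<le> measure lborel (level i {s<..<t}) * sqnorm (level i {s<..<t}) (g i)"
  proof (intro mult_mono)
    show "measure lborel B \<le> measure lborel (level i {s<..<t})"
      using B(1) by (intro measure_mono_fmeasurable[OF B(2)] fmeasurable_level[OF i _ _ s]) auto
    show "sqnorm B (g i) \<le> sqnorm (level i {s<..<t}) (g i)"
      by (rule sqnorm_mono[OF L2_on_subset[OF deriv_L2[OF i] sets_level[OF i] level_subset] B(1,2)]) simp
  qed simp_all
  with B(3) show ?thesis by (simp add: edge_crosses_def)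
qed

lemma edge_crosses_twice:
  assumes i: "i \<in> E" and abc: "a \<in> I i" "b \<in> I i" "c \<in> I i" "a \<le> b" "b \<le> c"
    and st: "\<bar>u i a\<bar> \<le> s" "\<bar>u i c\<bar> \<le> s" "s < t" "t \<le> \<bar>u i b\<bar>" and s: "0 < s"
  shows "edge_crosses i 2 s t"
proof -
  have up: "min \<bar>u i a\<bar> \<bar>u i b\<bar> \<le> s" "t \<le> max \<bar>u i a\<bar> \<bar>u i b\<bar>"
    and down: "min \<bar>u i b\<bar> \<bar>u i c\<bar> \<le> s" "t \<le> max \<bar>u i b\<bar> \<bar>u i c\<bar>"
    using st by linarith+
  obtain B where B: "B \<in> sets lborel" "B \<subseteq> {a<..<b}" "B \<subseteq> level i {s<..<t}"
      "(t - s)\<^sup>2 \<le> measure lborel B * sqnorm B (g i)"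
    using edge_crossing[OF i abc(1,2,4) up(1) st(3) up(2)] by metis
  obtain C where C: "C \<in> sets lborel" "C \<subseteq> {b<..<c}" "C \<subseteq> level i {s<..<t}"
      "(t - s)\<^sup>2 \<le> measure lborel C * sqnorm C (g i)"
    using edge_crossing[OF i abc(2,3,5) down(1) st(3) down(2)] by metis
  have disjoint: "B \<inter> C = {}" using B(2) C(2) by fastforce
  have "((t - s) + (t - s))\<^sup>2 \<le> (measure lborel B + measure lborel C) * (sqnorm B (g i) + sqnorm C (g i))"
    by (rule power2_add_le_mult_add[OF B(4) C(4)]) simp_all
  also have "\<dots> \<le> measure lborel (level i {s<..<t}) * sqnorm (level i {s<..<t}) (g i)"
    using s
    by (intro mult_mono measure_level_superadditive[OF i _ B(1) C(1) disjoint B(3) C(3), of s]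
        sqnorm_level_superadditive[OF i _ B(1) C(1) disjoint B(3) C(3)]) auto
  finally show ?thesis by (simp add: edge_crosses_def algebra_simps)
qed

end

section \<open>Decreasing rearrangement\<close>

lemma less_powr_iff:
  fixes s y q :: real
  assumes "0 < s" "0 \<le> y" "0 < q"
  shows "s < y powr q \<longleftrightarrow> s powr (1 / q) < y"
proof -
  have "s = (s powr (1 / q)) powr q" using assms by (simp add: powr_powr)
  moreover have "(s powr (1 / q)) powr q < y powr q \<longleftrightarrow> s powr (1 / q) < y"
    using assms powr_mono2[of q y "s powr (1 / q)"] powr_less_mono2[of q "s powr (1 / q)" y]
    by (auto simp: not_less[symmetric])
  ultimately show ?thesis by simp
qed

lemma
  fixes h :: "'a \<Rightarrow> real"
  assumes "sigma_finite_measure M" and [measurable]: "h \<in> borel_measurable M"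
  shows measurable_layer:
      "(\<lambda>s. indicator {0<..} s * emeasure M {x \<in> space M. s < h x}) \<in> borel_measurable lborel"
    and nn_integral_layer_cake:
      "(\<integral>\<^sup>+x. ennreal (h x) \<partial>M) = (\<integral>\<^sup>+s. indicator {0<..} s * emeasure M {x \<in> space M. s < h x} \<partial>lborel)"
proof -
  interpret pair_sigma_finite M lborel
    using assms(1) by (intro pair_sigma_finite.intro lborel.sigma_finite_measure_axioms)
  have inner: "(\<integral>\<^sup>+s. indicator {0<..<h x} s \<partial>lborel) = ennreal (h x)" for x
    by (cases "0 \<le> h x") (simp_all add: ennreal_neg)
  have layer: "(\<integral>\<^sup>+x. indicator {0<..<h x} s \<partial>M)
      = indicator {0<..} s * emeasure M {x \<in> space M. s < h x}" for s
  proof -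
    have "(\<integral>\<^sup>+x. indicator {0<..<h x} s \<partial>M)
        = (\<integral>\<^sup>+x. indicator {0<..} s * indicator {x \<in> space M. s < h x} x \<partial>M)"
      by (intro nn_integral_cong) (auto split: split_indicator)
    then show ?thesis by (simp add: nn_integral_cmult_indicator)
  qed
  have [measurable]: "(\<lambda>(x, s). indicator {0<..<h x} s :: ennreal) \<in> borel_measurable (M \<Otimes>\<^sub>M lborel)"
    unfolding indicator_def greaterThanLessThan_iff by measurable
  then have "(\<lambda>s. \<integral>\<^sup>+x. indicator {0<..<h x} s \<partial>M) \<in> borel_measurable lborel" by measurable
  then show "(\<lambda>s. indicator {0<..} s * emeasure M {x \<in> space M. s < h x}) \<in> borel_measurable lborel"
    by (simp only: layer)
  have "(\<integral>\<^sup>+x. ennreal (h x) \<partial>M) = (\<integral>\<^sup>+x. \<integral>\<^sup>+s. indicator {0<..<h x} s \<partial>lborel \<partial>M)"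
    by (simp only: inner)
  also have "\<dots> = (\<integral>\<^sup>+s. \<integral>\<^sup>+x. indicator {0<..<h x} s \<partial>M \<partial>lborel)"
    by (rule Fubini'[symmetric]) simp
  finally show "(\<integral>\<^sup>+x. ennreal (h x) \<partial>M)
      = (\<integral>\<^sup>+s. indicator {0<..} s * emeasure M {x \<in> space M. s < h x} \<partial>lborel)"
    by (simp only: layer)
qed

lemma
  assumes f: "set_borel_measurable lborel A f" and q: "0 < q"
  shows measurable_powr_layer:
      "(\<lambda>s. indicator {0<..} s * emeasure lborel {x \<in> A. s powr (1 / q) < \<bar>f x\<bar>}) \<in> borel_measurable lborel"
    and nn_integral_powr_layer_cake: "(\<integral>\<^sup>+x. ennreal (indicator A x * \<bar>f x\<bar> powr q) \<partial>lborel)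
      = (\<integral>\<^sup>+s. indicator {0<..} s * emeasure lborel {x \<in> A. s powr (1 / q) < \<bar>f x\<bar>} \<partial>lborel)"
proof -
  define h where "h x = indicator A x * \<bar>f x\<bar> powr q" for x
  have [measurable]: "(\<lambda>x. indicator A x * f x) \<in> borel_measurable borel"
    using f by (simp add: set_borel_measurable_def)
  have "(\<lambda>x. \<bar>indicator A x * f x\<bar> powr q) \<in> borel_measurable borel" by measurable
  also have "(\<lambda>x. \<bar>indicator A x * f x\<bar> powr q) = h"
    by (auto simp: h_def split: split_indicator)
  finally have h: "h \<in> borel_measurable lborel" by simp
  have "{x \<in> space lborel. s < h x} = {x \<in> A. s powr (1 / q) < \<bar>f x\<bar>}" if "0 < s" for s
    using less_powr_iff[OF that abs_ge_zero q] that by (auto simp: h_def split: split_indicator)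
  then have layer: "indicator {0<..} s * emeasure lborel {x \<in> space lborel. s < h x}
      = indicator {0<..} s * emeasure lborel {x \<in> A. s powr (1 / q) < \<bar>f x\<bar>}" for s
    by (cases "0 < s") simp_all
  show "(\<lambda>s. indicator {0<..} s * emeasure lborel {x \<in> A. s powr (1 / q) < \<bar>f x\<bar>}) \<in> borel_measurable lborel"
    using measurable_layer[OF lborel.sigma_finite_measure_axioms h] by (simp only: layer)
  show "(\<integral>\<^sup>+x. ennreal (indicator A x * \<bar>f x\<bar> powr q) \<partial>lborel)
      = (\<integral>\<^sup>+s. indicator {0<..} s * emeasure lborel {x \<in> A. s powr (1 / q) < \<bar>f x\<bar>} \<partial>lborel)"
    using nn_integral_layer_cake[OF lborel.sigma_finite_measure_axioms h]
    unfolding layer by (simp only: h_def)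
qed

context edge_family
begin

definition distribution :: "real \<Rightarrow> real" where
  "distribution t = level_length {t<..}"

definition rearrangement :: "real \<Rightarrow> real" where
  "rearrangement x = Inf {t. 0 < t \<and> distribution t \<le> x}"

lemma distribution_nonneg [simp]: "0 \<le> distribution t"
  by (simp add: distribution_def)

lemma distribution_eq_0:
  assumes "\<And>i x. i \<in> E \<Longrightarrow> x \<in> I i \<Longrightarrow> \<bar>u i x\<bar> \<le> t"
  shows "distribution t = 0"
proof -
  have "level i {t<..} = {}" if "i \<in> E" for i using assms[OF that] by (force simp: level_def)
  then show ?thesis by (simp add: distribution_def level_length_def)
qed

lemma level_length_mono:
  "A \<in> sets borel \<Longrightarrow> B \<in> sets borel \<Longrightarrow> A \<subseteq> B \<Longrightarrow> B \<subseteq> {t<..} \<Longrightarrow> 0 < t \<Longrightarrow> level_length A \<le> level_length B"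
  unfolding level_length_def
  by (intro sum_mono measure_mono_fmeasurable level_mono sets_level fmeasurable_level)

lemma distribution_antimono: "0 < s \<Longrightarrow> s \<le> t \<Longrightarrow> distribution t \<le> distribution s"
  unfolding distribution_def by (rule level_length_mono[where t = s]) auto

lemma distribution_right_continuous:
  assumes t: "0 < t"
  shows "(\<lambda>n. distribution (t + inverse (real (Suc n)))) \<longlonglongrightarrow> distribution t"
  unfolding distribution_def level_length_def
proof (rule tendsto_sum)
  fix i assume i: "i \<in> E"
  let ?L = "\<lambda>n. level i {t + inverse (real (Suc n))<..}"
  have Union: "(\<Union>n. ?L n) = level i {t<..}"
  proof (intro equalityI subsetI)
    fix y assume "y \<in> (\<Union>n. ?L n)"
    then obtain n where y: "y \<in> I i" "t + inverse (real (Suc n)) < \<bar>u i y\<bar>" by (auto simp: level_def)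
    have "0 < inverse (real (Suc n))" by simp
    with y(2) have "t < \<bar>u i y\<bar>" by linarith
    with y(1) show "y \<in> level i {t<..}" by (simp add: level_def)
  next
    fix y assume y: "y \<in> level i {t<..}"
    then have "0 < \<bar>u i y\<bar> - t" by (simp add: level_def)
    then obtain n where "inverse (real (Suc n)) < \<bar>u i y\<bar> - t" using reals_Archimedean by blast
    then have "t + inverse (real (Suc n)) < \<bar>u i y\<bar>" by linarith
    then show "y \<in> (\<Union>n. ?L n)" using y by (auto simp: level_def)
  qed
  have "(\<lambda>n. measure lborel (?L n)) \<longlonglongrightarrow> measure lborel (\<Union>n. ?L n)"
  proof (rule Lim_measure_incseq)
    show "incseq ?L" by (intro incseq_SucI level_mono) (simp add: le_imp_inverse_le)
    show "emeasure lborel (\<Union>n. ?L n) \<noteq> \<infinity>"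
      unfolding Union using fmeasurable_level[OF i _ order_refl t]
      by (simp add: fmeasurable_def less_top)
    show "range ?L \<subseteq> sets lborel" using sets_level[OF i] by (intro image_subsetI) simp
  qed
  then show "(\<lambda>n. measure lborel (?L n)) \<longlonglongrightarrow> measure lborel (level i {t<..})"
    unfolding Union .
qed

lemma rearrangement_set_nonempty:
  assumes "0 \<le> x"
  shows "{t. 0 < t \<and> distribution t \<le> x} \<noteq> {}"
proof -
  obtain M where M: "\<And>i x. i \<in> E \<Longrightarrow> x \<in> I i \<Longrightarrow> \<bar>u i x\<bar> \<le> M" using bounded by blast
  have "distribution (max M 1) = 0" by (rule distribution_eq_0) (simp add: M le_max_iff_disj)
  then have "max M 1 \<in> {t. 0 < t \<and> distribution t \<le> x}" using assms by simp
  then show ?thesis by blast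
qed

lemma rearrangement_set_bdd_below: "bdd_below {t. 0 < t \<and> distribution t \<le> x}"
  by (intro bdd_belowI[of _ 0]) auto

lemma rearrangement_nonneg: "0 \<le> x \<Longrightarrow> 0 \<le> rearrangement x"
  unfolding rearrangement_def by (rule cInf_greatest[OF rearrangement_set_nonempty]) auto

lemma rearrangement_antimono: "0 \<le> x \<Longrightarrow> x \<le> y \<Longrightarrow> rearrangement y \<le> rearrangement x"
  unfolding rearrangement_def
  by (rule cInf_superset_mono[OF rearrangement_set_nonempty rearrangement_set_bdd_below]) auto

lemma less_rearrangement_iff:
  assumes t: "0 < t" and x: "0 \<le> x"
  shows "t < rearrangement x \<longleftrightarrow> x < distribution t"
proof
  assume "t < rearrangement x"
  moreover have "rearrangement x \<le> t" if "distribution t \<le> x"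
    unfolding rearrangement_def using t that by (intro cInf_lower rearrangement_set_bdd_below) auto
  ultimately show "x < distribution t" by (meson not_le)
next
  assume "x < distribution t"
  then have "\<forall>\<^sub>F n in sequentially. x < distribution (t + inverse (real (Suc n)))"
    by (rule order_tendstoD(1)[OF distribution_right_continuous[OF t]])
  then obtain n where n: "x < distribution (t + inverse (real (Suc n)))"
    by (auto simp: eventually_sequentially)
  have "t + inverse (real (Suc n)) \<le> rearrangement x"
    unfolding rearrangement_def
  proof (rule cInf_greatest[OF rearrangement_set_nonempty[OF x]])
    fix s assume "s \<in> {t. 0 < t \<and> distribution t \<le> x}"
    then show "t + inverse (real (Suc n)) \<le> s"
      using n distribution_antimono[of s "t + inverse (real (Suc n))"] by force
  qed
  then show "t < rearrangement x" by (rule less_le_trans[rotated]) simp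
qed

lemma rearrangement_le:
  assumes t: "0 \<le> t" and x: "0 \<le> x" and distribution_le: "\<And>s. t < s \<Longrightarrow> distribution s \<le> x"
  shows "rearrangement x \<le> t"
proof (rule dense_le)
  fix s assume "s < rearrangement x"
  then show "s \<le> t"
    using less_rearrangement_iff[OF _ x, of s] distribution_le[of s] t by (cases "t < s") auto
qed

lemma set_borel_measurable_rearrangement: "set_borel_measurable lborel {0..} rearrangement"
proof -
  have "mono (\<lambda>x. - rearrangement (max 0 x))" by (intro monoI) (simp add: rearrangement_antimono)
  note [measurable] = borel_measurable_mono[OF this]
  have "(\<lambda>x. indicator {0..} x * - (- rearrangement (max 0 x))) \<in> borel_measurable borel"
    by measurable
  also have "(\<lambda>x. indicator {0..} x * - (- rearrangement (max 0 x)))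
      = (\<lambda>x. indicator {0..} x * rearrangement x)"
    by (auto split: split_indicator)
  finally show ?thesis by (simp add: set_borel_measurable_def)
qed

lemma emeasure_rearrangement_level:
  assumes "0 < t"
  shows "emeasure lborel {x \<in> {0..}. t < \<bar>rearrangement x\<bar>}
    = (\<Sum>i\<in>E. emeasure lborel {x \<in> I i. t < \<bar>u i x\<bar>})"
proof -
  have "x \<in> {x \<in> {0..}. t < \<bar>rearrangement x\<bar>} \<longleftrightarrow> x \<in> {0..<distribution t}" for x
    by (cases "0 \<le> x") (simp_all add: less_rearrangement_iff[OF assms] rearrangement_nonneg)
  then have "{x \<in> {0..}. t < \<bar>rearrangement x\<bar>} = {0..<distribution t}" by blast
  then have "emeasure lborel {x \<in> {0..}. t < \<bar>rearrangement x\<bar>} = ennreal (distribution t)" by simp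
  also have "\<dots> = (\<Sum>i\<in>E. ennreal (measure lborel (level i {t<..})))"
    by (simp add: distribution_def level_length_def sum_ennreal)
  also have "\<dots> = (\<Sum>i\<in>E. emeasure lborel (level i {t<..}))"
    using fmeasurable_level[OF _ _ order_refl assms]
    by (intro sum.cong refl) (simp add: emeasure_eq_ennreal_measure fmeasurable_def less_top)
  finally show ?thesis by (simp add: level_def)
qed

lemma nn_integral_rearrangement_powr:
  assumes q: "0 < q"
  shows "(\<integral>\<^sup>+x. ennreal (indicator {0..} x * \<bar>rearrangement x\<bar> powr q) \<partial>lborel)
    = (\<Sum>i\<in>E. \<integral>\<^sup>+x. ennreal (indicator (I i) x * \<bar>u i x\<bar> powr q) \<partial>lborel)"
proof -
  have u: "set_borel_measurable lborel (I i) (u i)" if "i \<in> E" for i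
    using L2[OF that] by (simp add: L2_on_def)
  have "(\<integral>\<^sup>+x. ennreal (indicator {0..} x * \<bar>rearrangement x\<bar> powr q) \<partial>lborel)
      = (\<integral>\<^sup>+s. (\<Sum>i\<in>E. indicator {0<..} s * emeasure lborel {x \<in> I i. s powr (1 / q) < \<bar>u i x\<bar>}) \<partial>lborel)"
    unfolding nn_integral_powr_layer_cake[OF set_borel_measurable_rearrangement q]
    using emeasure_rearrangement_level
    by (intro nn_integral_cong) (auto simp: sum_distrib_left[symmetric] split: split_indicator)
  also have "\<dots>
      = (\<Sum>i\<in>E. \<integral>\<^sup>+s. indicator {0<..} s * emeasure lborel {x \<in> I i. s powr (1 / q) < \<bar>u i x\<bar>} \<partial>lborel)"
    by (rule nn_integral_sum[OF measurable_powr_layer[OF u q]])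
  also have "\<dots> = (\<Sum>i\<in>E. \<integral>\<^sup>+x. ennreal (indicator (I i) x * \<bar>u i x\<bar> powr q) \<partial>lborel)"
    by (intro sum.cong refl nn_integral_powr_layer_cake[OF u q, symmetric])
  finally show ?thesis .
qed

lemma
  assumes q: "0 < q" and int: "\<And>i. i \<in> E \<Longrightarrow> set_integrable lborel (I i) (\<lambda>x. \<bar>u i x\<bar> powr q)"
  shows rearrangement_powr_integrable: "set_integrable lborel {0..} (\<lambda>x. \<bar>rearrangement x\<bar> powr q)"
    and powr_int_rearrangement: "powr_int q {0..} rearrangement = total_powr_int q"
proof -
  have "(\<integral>\<^sup>+x. ennreal (indicator (I i) x * \<bar>u i x\<bar> powr q) \<partial>lborel) = ennreal (powr_int q (I i) (u i))"
    if "i \<in> E" for i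
    using int[OF that] unfolding set_lebesgue_integral_def set_integrable_def real_scaleR_def
    by (intro nn_integral_eq_integral) auto
  then have nn_integral_eq: "(\<integral>\<^sup>+x. ennreal (indicator {0..} x * \<bar>rearrangement x\<bar> powr q) \<partial>lborel)
      = ennreal (total_powr_int q)"
    by (simp add: nn_integral_rearrangement_powr[OF q] total_powr_int_def sum_ennreal)
  have "(\<lambda>x. indicator {0..} x * \<bar>rearrangement x\<bar> powr q)
      = (\<lambda>x. \<bar>indicator {0..} x * rearrangement x\<bar> powr q)"
    by (auto split: split_indicator)
  also have "\<dots> \<in> borel_measurable lborel"
    using set_borel_measurable_rearrangement by (simp add: set_borel_measurable_def)
  finally have int_rearrangement: "integrable lborel (\<lambda>x. indicator {0..} x * \<bar>rearrangement x\<bar> powr q)"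
    using nn_integral_eq by (intro integrableI_nonneg) auto
  then show "set_integrable lborel {0..} (\<lambda>x. \<bar>rearrangement x\<bar> powr q)"
    by (simp add: set_integrable_def)
  have "0 \<le> total_powr_int q" by (simp add: total_powr_int_def sum_nonneg)
  then show "powr_int q {0..} rearrangement = total_powr_int q"
    using nn_integral_eq nn_integral_eq_integral[OF int_rearrangement]
      powr_int_nonneg[of "{0..}" rearrangement q]
    by (simp add: set_lebesgue_integral_def)
qed

lemma
  shows L2_on_rearrangement: "L2_on {0..} rearrangement"
    and mass_rearrangement: "mass rearrangement = total_mass"
proof -
  have powr_2: "\<bar>x\<bar> powr 2 = x\<^sup>2" for x :: real by (cases "x = 0") simp_all
  have int: "set_integrable lborel (I i) (\<lambda>x. \<bar>u i x\<bar> powr 2)" if "i \<in> E" for i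
    unfolding powr_2 by (rule L2_onD(2)[OF L2[OF that]])
  show "L2_on {0..} rearrangement"
    using rearrangement_powr_integrable[OF _ int] set_borel_measurable_rearrangement
    by (simp add: L2_on_def powr_2)
  show "mass rearrangement = total_mass"
    using powr_int_rearrangement[OF _ int] by (simp add: total_powr_int_def total_mass_def powr_2)
qed

lemma powr_integrable:
  assumes "2 \<le> q" "i \<in> E"
  shows "set_integrable lborel (I i) (\<lambda>x. \<bar>u i x\<bar> powr q)"
proof -
  obtain M where "\<And>x. x \<in> I i \<Longrightarrow> \<bar>u i x\<bar> \<le> M" using bounded assms(2) by blast
  then show ?thesis
    using L2 is_interval_sets_lborel[OF interval] assms by (intro L2_on_bounded_powr_integrable)
qed

lemma rearrangement_increment:
  assumes ab: "0 \<le> a" "a \<le> b"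
    and crosses: "\<And>s t. rearrangement b < s \<Longrightarrow> s < t \<Longrightarrow> t < rearrangement a \<Longrightarrow> crosses n s t"
  shows "n\<^sup>2 * (rearrangement b - rearrangement a)\<^sup>2
    \<le> (b - a) * (level_kinetic {rearrangement b<..} - level_kinetic {rearrangement a<..})"
proof (cases "rearrangement a = rearrangement b")
  case False
  define D where "D = rearrangement a - rearrangement b"
  let ?R = "(b - a) * (level_kinetic {rearrangement b<..} - level_kinetic {rearrangement a<..})"
  have D: "0 < D" using rearrangement_antimono[OF ab] False by (simp add: D_def)
  have b0: "0 \<le> rearrangement b" using ab by (intro rearrangement_nonneg) simp
  have strict: "(n * (D - 2 * e))\<^sup>2 \<le> ?R" if e: "0 < e" "2 * e < D" for e
  proof -
    define s t where "s = rearrangement b + e" and "t = rearrangement a - e"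
    have st: "rearrangement b < s" "s < t" "t < rearrangement a" "0 < s" "t - s = D - 2 * e"
      using e b0 by (auto simp: s_def t_def D_def)
    have "level_length {s<..<t} + distribution t \<le> distribution s"
      unfolding distribution_def by (rule level_length_superadditive[of _ _ _ s]) (use st in auto)
    moreover have "distribution s \<le> b" using less_rearrangement_iff[OF st(4), of b] st(1) ab by simp
    moreover have "a < distribution t" using less_rearrangement_iff[of t a] st ab by simp
    ultimately have length: "level_length {s<..<t} \<le> b - a" by linarith
    have "level_kinetic {s<..<t} + level_kinetic {rearrangement a<..}
        \<le> level_kinetic {rearrangement b<..}"
      by (rule level_kinetic_superadditive) (use st in auto)
    then have "level_length {s<..<t} * level_kinetic {s<..<t} \<le> ?R"
      using ab by (intro mult_mono[OF length]) auto
    with crosses[OF st(1-3)] show ?thesis by (simp add: crosses_def st(5))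
  qed
  have "((\<lambda>e. (n * (D - 2 * e))\<^sup>2) \<longlongrightarrow> (n * (D - 2 * 0))\<^sup>2) (at_right 0)"
    by (intro tendsto_intros)
  moreover have "\<forall>\<^sub>F e in at_right 0. (n * (D - 2 * e))\<^sup>2 \<le> ?R"
    using eventually_at_right_real[of 0 "D / 2"] D by (auto elim!: eventually_mono intro: strict)
  ultimately have "(n * (D - 2 * 0))\<^sup>2 \<le> ?R"
    by (rule tendsto_upperbound) (rule trivial_limit_at_right_real)
  then show ?thesis by (simp add: D_def power_mult_distrib power2_commute)
qed simp

lemma rearrangement_kinetic_le:
  assumes y: "0 \<le> y" and n: "0 < n" "0 < m"
    and high: "\<And>s t. 0 < s \<Longrightarrow> rearrangement y < s \<Longrightarrow> s < t \<Longrightarrow> t < rearrangement 0 \<Longrightarrow> crosses n s t"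
    and low: "\<And>s t. 0 < s \<Longrightarrow> s < t \<Longrightarrow> t < rearrangement y \<Longrightarrow> crosses m s t"
  obtains h where "decreasing_profile rearrangement h" "kinetic (n\<^sup>2) (m\<^sup>2) y h \<le> total_kinetic"
proof -
  define \<kappa> where "\<kappa> x = level_kinetic {rearrangement x<..}" for x
  obtain h where h: "has_L2_deriv_on rearrangement h {0..}" "kinetic (n\<^sup>2) (m\<^sup>2) y h \<le> total_kinetic"
  proof (rule weighted_Riesz_criterion[OF _ _ y])
    show "n\<^sup>2 * (rearrangement b - rearrangement a)\<^sup>2 \<le> (b - a) * (\<kappa> b - \<kappa> a)"
      if ab: "0 \<le> a" "a \<le> b" "b \<le> y" for a b
      unfolding \<kappa>_def
    proof (rule rearrangement_increment[OF ab(1,2)], rule high)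
      fix s t assume "rearrangement b < s" "s < t" "t < rearrangement a"
      then show "0 < s" "rearrangement y < s" "s < t" "t < rearrangement 0"
        using rearrangement_antimono[of 0 a] rearrangement_antimono[of b y]
          rearrangement_nonneg[of b] ab by auto
    qed
    show "m\<^sup>2 * (rearrangement b - rearrangement a)\<^sup>2 \<le> (b - a) * (\<kappa> b - \<kappa> a)"
      if ab: "y \<le> a" "a \<le> b" for a b
      unfolding \<kappa>_def
    proof (rule rearrangement_increment[OF _ ab(2)], goal_cases)
      case (2 s t)
      then show ?case
        using rearrangement_antimono[OF y ab(1)] rearrangement_nonneg[of b] ab y by (intro low) auto
    qed (use y ab in simp)
    have "0 \<le> \<kappa> x" "\<kappa> x \<le> total_kinetic" for x
      unfolding \<kappa>_def by (simp_all add: level_kinetic_le_total_kinetic)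
    then show "\<kappa> x - \<kappa> 0 \<le> total_kinetic" for x by (smt (verit))
  qed (use n in auto)
  have "decreasing_profile rearrangement h"
    using rearrangement_nonneg rearrangement_antimono L2_on_rearrangement h(1)
    by (simp add: decreasing_profile_def)
  with h(2) show thesis by (rule that[rotated])
qed

end

section \<open>Functions on the star graph\<close>

lemma L2_deriv_halfline_power2_le:
  assumes u: "L2_on {x..} u" "has_L2_deriv_on u g {x..}"
  shows "(u x)\<^sup>2 \<le> 2 * (sqnorm {x..} u + sqnorm {x..} g)"
proof -
  have "(u x)\<^sup>2 / 2 - sqnorm {x..} g \<le> (u y)\<^sup>2" if y: "y \<in> {x..x + 1}" for y
  proof -
    have "(u y - u x)\<^sup>2 \<le> \<bar>y - x\<bar> * sqnorm {x..} g"
      by (rule has_L2_deriv_on_Hoelder[OF u(2)]) (use y in auto)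
    also have "\<dots> \<le> 1 * sqnorm {x..} g" using y by (intro mult_right_mono) auto
    finally show ?thesis
      using zero_le_power2[of "2 * u y - u x"] by (simp add: power2_eq_square algebra_simps)
  qed
  then have "(x + 1 - x) * ((u x)\<^sup>2 / 2 - sqnorm {x..} g) \<le> sqnorm {x..x + 1} u"
    by (intro const_mult_length_le_set_integral set_integrable_subset[OF L2_onD(2)[OF u(1)]]) auto
  also have "\<dots> \<le> sqnorm {x..} u" by (rule sqnorm_mono[OF u(1)]) auto
  finally show ?thesis by simp
qed

lemma L2_deriv_halfline_tendsto_0:
  assumes u: "L2_on {a..} u" "has_L2_deriv_on u g {a..}"
  shows "(u \<longlongrightarrow> 0) at_top"
proof -
  have "((\<lambda>x. 2 * (sqnorm {x..} u + sqnorm {x..} g)) \<longlongrightarrow> 2 * (0 + 0)) at_top"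
    by (intro tendsto_intros set_integral_Ici_tail_tendsto_0[OF L2_onD(2)[OF u(1)]]
        set_integral_Ici_tail_tendsto_0[OF L2_onD(2)[OF has_L2_deriv_onD(1)[OF u(2)]]])
  then have tail: "((\<lambda>x. 2 * (sqnorm {x..} u + sqnorm {x..} g)) \<longlongrightarrow> 0) at_top" by simp
  have bound: "\<forall>\<^sub>F x in at_top. (u x)\<^sup>2 \<le> 2 * (sqnorm {x..} u + sqnorm {x..} g)"
    using eventually_ge_at_top[of a]
  proof eventually_elim
    case (elim x)
    then have "{x..} \<subseteq> {a..}" by auto
    then show ?case
      by (intro L2_deriv_halfline_power2_le L2_on_subset[OF u(1)] has_L2_deriv_on_subset[OF u(2)]) auto
  qed
  have "((\<lambda>x. (u x)\<^sup>2) \<longlongrightarrow> 0) at_top"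
    by (rule tendsto_sandwich[OF _ bound tendsto_const tail]) simp
  from tendsto_real_sqrt[OF this] show ?thesis by (simp add: tendsto_rabs_zero_iff)
qed

lemma continuous_halfline_attains_max_abs:
  fixes u :: "real \<Rightarrow> real"
  assumes cont: "continuous_on {a..} u" and lim: "(u \<longlongrightarrow> 0) at_top"
  obtains x where "a \<le> x" "\<And>y. a \<le> y \<Longrightarrow> \<bar>u y\<bar> \<le> \<bar>u x\<bar>"
proof (cases "\<forall>x\<ge>a. u x = 0")
  case True
  then show thesis using that[of a] by simp
next
  case False
  then obtain x0 where x0: "a \<le> x0" "u x0 \<noteq> 0" by blast
  have "\<forall>\<^sub>F x in at_top. \<bar>u x\<bar> < \<bar>u x0\<bar>"
    using order_tendstoD(2)[OF tendsto_rabs_zero[OF lim]] x0(2) by simp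
  then obtain N where N: "\<And>x. N \<le> x \<Longrightarrow> \<bar>u x\<bar> < \<bar>u x0\<bar>" by (auto simp: eventually_at_top_linorder)
  have "continuous_on {a..max N x0} (\<lambda>x. \<bar>u x\<bar>)"
    by (intro continuous_on_rabs continuous_on_subset[OF cont]) auto
  then obtain x where x: "x \<in> {a..max N x0}" "\<And>y. y \<in> {a..max N x0} \<Longrightarrow> \<bar>u y\<bar> \<le> \<bar>u x\<bar>"
    using continuous_attains_sup[OF compact_Icc] x0(1)
    by (metis atLeastAtMost_iff empty_iff max.cobounded2)
  have "\<bar>u y\<bar> \<le> \<bar>u x\<bar>" if "a \<le> y" for y
  proof (cases "y \<le> max N x0")
    case False
    then have "\<bar>u y\<bar> < \<bar>u x0\<bar>" by (intro N) simp
    then show ?thesis using x(2)[of x0] x0(1) by simp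
  qed (use x(2) that in simp)
  with x(1) show thesis using that by auto
qed

locale star_graph_function =
  fixes l :: real and u g :: "nat \<Rightarrow> real \<Rightarrow> real"
  assumes l_pos: "0 < l"
    and edge_L2: "\<And>i. i < 4 \<Longrightarrow> L2_on (edge_dom l i) (u i)"
    and edge_deriv: "\<And>i. i < 4 \<Longrightarrow> has_L2_deriv_on (u i) (g i) (edge_dom l i)"
    and vertex: "\<And>i. i < 4 \<Longrightarrow> u i 0 = u 0 0"

lemma edge_dom_halfline: "i < 3 \<Longrightarrow> edge_dom l i = {0..}"
  and edge_dom_terminal [simp]: "edge_dom l 3 = {0..l}"
  by (simp_all add: edge_dom_def)

lemma is_interval_edge_dom [simp]: "is_interval (edge_dom l i)"
  by (simp add: edge_dom_def)

lemma less_4_cases: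
  fixes i :: nat
  assumes "i < 4"
  obtains (halfline) "i < 3" | (terminal) "i = 3"
  using assms by linarith

context star_graph_function
begin

lemma halfline_L2: "i < 3 \<Longrightarrow> L2_on {0..} (u i)"
  using edge_L2[of i] by (simp add: edge_dom_halfline)

lemma halfline_deriv: "i < 3 \<Longrightarrow> has_L2_deriv_on (u i) (g i) {0..}"
  using edge_deriv[of i] by (simp add: edge_dom_halfline)

lemma halfline_max_at:
  assumes "i < 3"
  obtains x where "0 \<le> x" "\<And>y. 0 \<le> y \<Longrightarrow> \<bar>u i y\<bar> \<le> \<bar>u i x\<bar>"
  using continuous_halfline_attains_max_abs
    [OF has_L2_deriv_on_imp_continuous_on[OF halfline_deriv[OF assms]]
      L2_deriv_halfline_tendsto_0[OF halfline_L2[OF assms] halfline_deriv[OF assms]]] by auto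

lemma halfline_max:
  obtains j x where "j < 3" "0 \<le> x" "\<And>i y. i < 3 \<Longrightarrow> 0 \<le> y \<Longrightarrow> \<bar>u i y\<bar> \<le> \<bar>u j x\<bar>"
proof -
  have "\<exists>x\<ge>0. \<forall>y\<ge>0. \<bar>u i y\<bar> \<le> \<bar>u i x\<bar>" if "i < 3" for i
    using halfline_max_at[OF that] by metis
  then obtain X where X: "\<And>i. i < 3 \<Longrightarrow> 0 \<le> X i" "\<And>i y. i < 3 \<Longrightarrow> 0 \<le> y \<Longrightarrow> \<bar>u i y\<bar> \<le> \<bar>u i (X i)\<bar>"
    by metis
  let ?j = "arg_min_on (\<lambda>i. - \<bar>u i (X i)\<bar>) {..<3}"
  have "{..<3::nat} \<noteq> {}" by (simp add: lessThan_empty_iff)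
  then have j: "?j < 3" "\<And>i. i < 3 \<Longrightarrow> \<bar>u i (X i)\<bar> \<le> \<bar>u ?j (X ?j)\<bar>"
    using arg_min_if_finite[of "{..<3}" "\<lambda>i. - \<bar>u i (X i)\<bar>"] by (auto simp: not_less)
  show thesis
  proof (rule that[OF j(1) X(1)[OF j(1)]])
    show "\<bar>u i y\<bar> \<le> \<bar>u ?j (X ?j)\<bar>" if "i < 3" "0 \<le> y" for i y
      using X(2)[OF that] j(2)[OF that(1)] by (rule order_trans)
  qed
qed

lemma terminal_max:
  obtains x where "x \<in> {0..l}" "\<And>y. y \<in> {0..l} \<Longrightarrow> \<bar>u 3 y\<bar> \<le> \<bar>u 3 x\<bar>"
proof -
  have "continuous_on {0..l} (\<lambda>x. \<bar>u 3 x\<bar>)"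
    using has_L2_deriv_on_imp_continuous_on[OF edge_deriv[of 3]] by (intro continuous_on_rabs) simp
  moreover have "{0..l} \<noteq> {}" using l_pos by simp
  ultimately show thesis using continuous_attains_sup[OF compact_Icc] that by blast
qed

end

sublocale star_graph_function \<subseteq> edge_family "{..<4}" "edge_dom l" u g
proof unfold_locales
  obtain j x where x: "\<And>i y. i < 3 \<Longrightarrow> 0 \<le> y \<Longrightarrow> \<bar>u i y\<bar> \<le> \<bar>u j x\<bar>" using halfline_max by metis
  obtain x' where x': "\<And>y. y \<in> {0..l} \<Longrightarrow> \<bar>u 3 y\<bar> \<le> \<bar>u 3 x'\<bar>" using terminal_max by metis
  have "\<bar>u i y\<bar> \<le> max \<bar>u j x\<bar> \<bar>u 3 x'\<bar>" if "i < 4" "y \<in> edge_dom l i" for i y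
    using that(1) by (cases rule: less_4_cases)
      (use that(2) x[of i y] x'[of y] in \<open>auto simp: edge_dom_halfline le_max_iff_disj\<close>)
  then show "\<exists>M. \<forall>i\<in>{..<4}. \<forall>x\<in>edge_dom l i. \<bar>u i x\<bar> \<le> M" by blast
qed (simp_all add: edge_L2 edge_deriv)

definition (in edge_family) family_energy :: "real \<Rightarrow> real" where
  "family_energy p = total_kinetic / 2 - total_powr_int p / p"

context star_graph_function
begin

lemma vertex_value: "i < 4 \<Longrightarrow> \<bar>u i 0\<bar> = \<bar>u 0 0\<bar>"
  using vertex[of i] by simp

lemma halfline_exit:
  assumes "i < 3" "0 < t"
  obtains b where "a \<le> b" "0 \<le> b" "\<bar>u i b\<bar> \<le> t"
proof -
  have "\<forall>\<^sub>F x in at_top. \<bar>u i x\<bar> < t"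
    using order_tendstoD(2)[OF tendsto_rabs_zero[OF
        L2_deriv_halfline_tendsto_0[OF halfline_L2[OF assms(1)] halfline_deriv[OF assms(1)]]] assms(2)] .
  then obtain N where "\<And>x. N \<le> x \<Longrightarrow> \<bar>u i x\<bar> < t" by (auto simp: eventually_at_top_linorder)
  then show thesis using that[of "max 0 (max a N)"] by (simp add: less_imp_le)
qed

lemma halfline_crosses_once:
  assumes i: "i < 3" and s: "0 < s" "s < t" "t \<le> \<bar>u 0 0\<bar>"
  shows "edge_crosses i 1 s t"
proof -
  obtain b where b: "0 \<le> b" "\<bar>u i b\<bar> \<le> s" using halfline_exit[OF i s(1), of 0] by blast
  then show ?thesis
    using i s vertex_value[of i] by (intro edge_crosses_once[of i 0 b]) (auto simp: edge_dom_halfline)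
qed

lemma halfline_crosses_twice:
  assumes i: "i < 3" and s: "0 < s" "s < t" "\<bar>u 0 0\<bar> \<le> s" "t \<le> \<bar>u i x\<bar>" and x: "0 \<le> x"
  shows "edge_crosses i 2 s t"
proof -
  obtain b where b: "x \<le> b" "0 \<le> b" "\<bar>u i b\<bar> \<le> s" using halfline_exit[OF i s(1), of x] by blast
  then show ?thesis
    using i s x vertex_value[of i]
    by (intro edge_crosses_twice[of i 0 x b]) (auto simp: edge_dom_halfline)
qed

lemma terminal_crosses_once:
  assumes x: "x \<in> {0..l}" and s: "0 < s" "s < t" "\<bar>u 0 0\<bar> \<le> s" "t \<le> \<bar>u 3 x\<bar>"
  shows "edge_crosses 3 1 s t"
  using x s vertex_value[of 3] l_pos by (intro edge_crosses_once[of 3 0 x]) auto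

lemma crosses_below_vertex:
  assumes "0 < s" "s < t" "t \<le> \<bar>u 0 0\<bar>"
  shows "crosses 3 s t"
proof -
  have "crosses (\<Sum>i<4::nat. if i < 3 then 1 else 0) s t"
    by (rule crosses_sum) (simp add: halfline_crosses_once[OF _ assms])
  then show ?thesis by (simp add: eval_nat_numeral)
qed

lemma crosses_below_halfline_value:
  assumes j: "j < 3" "0 \<le> x" and s: "0 < s" "s < t" "t \<le> \<bar>u j x\<bar>"
  shows "crosses 2 s t"
proof (rule crosses_glue[where v = "\<bar>u 0 0\<bar>", OF _ _ s])
  show "crosses 2 s t" if "0 < s" "s < t" "t \<le> \<bar>u 0 0\<bar>" for s t
    by (rule crosses_mono[OF crosses_below_vertex[OF that]]) (use that in simp_all)
  show "crosses 2 s t" if "0 < s" "s < t" "\<bar>u 0 0\<bar> \<le> s" "t \<le> \<bar>u j x\<bar>" for s t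
  proof -
    have "crosses (\<Sum>i<4::nat. if i = j then 2 else 0) s t"
      by (rule crosses_sum) (simp add: halfline_crosses_twice[OF j(1) that j(2)])
    then show ?thesis using j(1) by simp
  qed
qed

lemma crosses_below_terminal_value:
  assumes x: "x \<in> {0..l}" and s: "0 < s" "s < t" "t \<le> \<bar>u 3 x\<bar>"
  shows "crosses 1 s t"
proof (rule crosses_glue[where v = "\<bar>u 0 0\<bar>", OF _ _ s])
  show "crosses 1 s t" if "0 < s" "s < t" "t \<le> \<bar>u 0 0\<bar>" for s t
    by (rule crosses_mono[OF crosses_below_vertex[OF that]]) (use that in simp_all)
  show "crosses 1 s t" if "0 < s" "s < t" "\<bar>u 0 0\<bar> \<le> s" "t \<le> \<bar>u 3 x\<bar>" for s t
  proof -
    have "crosses (\<Sum>i<4::nat. if i = 3 then 1 else 0) s t"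
      by (rule crosses_sum) (simp add: terminal_crosses_once[OF x that])
    then show ?thesis by simp
  qed
qed

lemma crosses_below_halfline_and_terminal_value:
  assumes j: "j < 3" "0 \<le> x" and x': "x' \<in> {0..l}" and s: "0 < s" "s < t" "t \<le> min \<bar>u j x\<bar> \<bar>u 3 x'\<bar>"
  shows "crosses 3 s t"
proof (rule crosses_glue[where v = "\<bar>u 0 0\<bar>", OF crosses_below_vertex _ s])
  show "crosses 3 s t" if "0 < s" "s < t" "\<bar>u 0 0\<bar> \<le> s" "t \<le> min \<bar>u j x\<bar> \<bar>u 3 x'\<bar>" for s t
  proof -
    have "crosses (\<Sum>i<4::nat. (if i = j then 2 else 0) + (if i = 3 then 1 else 0)) s t"
      using that j(1) by (intro crosses_sum)
        (auto simp: halfline_crosses_twice[OF j(1) _ _ _ _ j(2)] terminal_crosses_once[OF x'])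
    then show ?thesis using j(1) by (simp add: sum.distrib)
  qed
qed

end

section \<open>Energy of functions on the star graph\<close>

context star_graph_function
begin

lemma rearrangement_0_le:
  assumes "\<And>i x. i < 4 \<Longrightarrow> x \<in> edge_dom l i \<Longrightarrow> \<bar>u i x\<bar> \<le> m" "0 \<le> m"
  shows "rearrangement 0 \<le> m"
proof (rule rearrangement_le[OF assms(2) order_refl])
  fix s assume "m < s"
  then have "distribution s = 0" by (intro distribution_eq_0) (use assms(1) in force)
  then show "distribution s \<le> 0" by simp
qed

lemma rearrangement_l_le:
  assumes m: "\<And>i x. i < 3 \<Longrightarrow> 0 \<le> x \<Longrightarrow> \<bar>u i x\<bar> \<le> m"
  shows "rearrangement l \<le> m"
proof (rule rearrangement_le)
  show "0 \<le> m" using m[of 0 0] by simp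
  show "0 \<le> l" using l_pos by simp
  fix s assume s: "m < s"
  have "level i {s<..} = {}" if "i < 3" for i
    using m[OF that] s by (fastforce simp: level_def edge_dom_halfline[OF that])
  moreover have "{..<4::nat} = insert 3 {..<3}" by auto
  ultimately have "distribution s = measure lborel (level 3 {s<..})"
    unfolding distribution_def level_length_def by simp
  also have "\<dots> \<le> measure lborel {0..l}"
    using sets_level[of 3 "{s<..}"] level_subset[of 3 "{s<..}"]
    by (intro measure_mono_fmeasurable fmeasurableI emeasure_lborel_Icc_finite) auto
  also have "\<dots> = l" using l_pos by simp
  finally show "distribution s \<le> l" .
qed

lemma weighted_energy_rearrangement:
  assumes "2 \<le> p"
  shows "weighted_energy p \<alpha> \<gamma> y rearrangement h = kinetic \<alpha> \<gamma> y h / 2 - total_powr_int p / p"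
  using powr_int_rearrangement[of p, OF _ powr_integrable[OF assms]] assms
  by (simp add: weighted_energy_def)

lemma rearrangement_kinetic_le_terminal_max:
  assumes j: "j < 3" "0 \<le> x" "\<And>i y. i < 3 \<Longrightarrow> 0 \<le> y \<Longrightarrow> \<bar>u i y\<bar> \<le> \<bar>u j x\<bar>"
    and x': "x' \<in> {0..l}" "\<And>y. y \<in> {0..l} \<Longrightarrow> \<bar>u 3 y\<bar> \<le> \<bar>u 3 x'\<bar>" "\<bar>u j x\<bar> \<le> \<bar>u 3 x'\<bar>"
  obtains h where "decreasing_profile rearrangement h" "kinetic 1 9 l h \<le> total_kinetic"
proof -
  have top: "rearrangement 0 \<le> \<bar>u 3 x'\<bar>"
  proof (rule rearrangement_0_le)
    show "\<bar>u i y\<bar> \<le> \<bar>u 3 x'\<bar>" if "i < 4" "y \<in> edge_dom l i" for i y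
      using that(1) by (cases rule: less_4_cases)
        (use that(2) j(3)[of i y] x'(2)[of y] x'(3) in \<open>auto simp: edge_dom_halfline\<close>)
  qed simp
  have "rearrangement l \<le> \<bar>u j x\<bar>" by (rule rearrangement_l_le[OF j(3)])
  then have low: "crosses 3 s t" if "0 < s" "s < t" "t < rearrangement l" for s t
    using that x'(3) by (intro crosses_below_halfline_and_terminal_value[OF j(1,2) x'(1)]) auto
  have high: "crosses 1 s t" if "0 < s" "s < t" "t < rearrangement 0" for s t
    using that top by (intro crosses_below_terminal_value[OF x'(1)]) auto
  obtain h where "decreasing_profile rearrangement h" "kinetic (1\<^sup>2) (3\<^sup>2) l h \<le> total_kinetic"
    by (rule rearrangement_kinetic_le[of l 1 3]) (use l_pos in \<open>auto intro: low high\<close>)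
  then show thesis using that by simp
qed

definition max_on_halfline :: "nat \<Rightarrow> real \<Rightarrow> bool" where
  "max_on_halfline j x \<longleftrightarrow> j < 3 \<and> 0 \<le> x \<and> (\<forall>i<4. \<forall>y\<in>edge_dom l i. \<bar>u i y\<bar> \<le> \<bar>u j x\<bar>)"

lemma crosses_below_rearrangement_0:
  assumes max: "max_on_halfline j x"
    and s: "0 < s" "s < t" "t < rearrangement 0"
  shows "crosses 2 s t"
proof -
  have "rearrangement 0 \<le> \<bar>u j x\<bar>"
    using max by (intro rearrangement_0_le) (simp_all add: max_on_halfline_def)
  then show ?thesis
    using max s by (intro crosses_below_halfline_value[of j x]) (simp_all add: max_on_halfline_def)
qed

lemma rearrangement_kinetic_le_halfline_max:
  assumes max: "max_on_halfline j x"
    and low: "\<And>s t. 0 < s \<Longrightarrow> s < t \<Longrightarrow> t < rearrangement y \<Longrightarrow> crosses n s t" and "0 \<le> y" "0 < n"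
  obtains h where "decreasing_profile rearrangement h" "kinetic 4 (n\<^sup>2) y h \<le> total_kinetic"
proof -
  obtain h where "decreasing_profile rearrangement h" "kinetic (2\<^sup>2) (n\<^sup>2) y h \<le> total_kinetic"
    by (rule rearrangement_kinetic_le[OF \<open>0 \<le> y\<close>, of 2 n])
      (use \<open>0 < n\<close> in \<open>auto intro: low crosses_below_rearrangement_0[OF max]\<close>)
  then show thesis using that by simp
qed

lemma rearrangement_attains_below:
  assumes "decreasing_profile rearrangement h" "0 < total_mass" "0 < v"
  obtains y where "0 \<le> y" "0 < rearrangement y" "rearrangement y \<le> v"
proof (cases "rearrangement 0 \<le> v")
  case True
  have "rearrangement 0 \<noteq> 0"
  proof
    assume "rearrangement 0 = 0"
    then have "rearrangement x = 0" if "0 \<le> x" for x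
      using rearrangement_antimono[OF order_refl that] rearrangement_nonneg[OF that] by simp
    then have "mass rearrangement = (LINT x:{0..}|(lborel :: real measure). 0)"
      by (intro set_lebesgue_integral_cong) simp_all
    then show False using assms(2) mass_rearrangement by (simp add: set_lebesgue_integral_def)
  qed
  then show thesis using that[of 0] rearrangement_nonneg[of 0] True by simp
next
  case False
  have "\<not> v < rearrangement (distribution v)" by (simp add: less_rearrangement_iff[OF assms(3)])
  moreover have "continuous_on {0..distribution v} rearrangement"
    using has_L2_deriv_on_imp_continuous_on[OF decreasing_profileD(4)[OF assms(1)]]
    by (rule continuous_on_subset) auto
  ultimately obtain y where "0 \<le> y" "y \<le> distribution v" "rearrangement y = v"
    using IVT2'[of rearrangement "distribution v" v 0] False by auto
  then show thesis using that[of y] assms(3) by simp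
qed

lemma rearrangement_kinetic_less_halfline_max:
  assumes max: "max_on_halfline j x"
    and v: "u 0 0 \<noteq> 0" and mass: "0 < total_mass"
  obtains h where "decreasing_profile rearrangement h" "kinetic 4 4 0 h < total_kinetic"
proof -
  obtain h\<^sub>0 where "decreasing_profile rearrangement h\<^sub>0"
    by (rule rearrangement_kinetic_le_halfline_max[OF max, of 0 2])
      (auto intro: crosses_below_rearrangement_0[OF max])
  then obtain y where y: "0 \<le> y" "0 < rearrangement y" "rearrangement y \<le> \<bar>u 0 0\<bar>"
    by (rule rearrangement_attains_below[OF _ mass]) (use v in auto)
  have low: "crosses 3 s t" if "0 < s" "s < t" "t < rearrangement y" for s t
    using that y(3) by (intro crosses_below_vertex) auto
  obtain h where h: "decreasing_profile rearrangement h" "kinetic 4 (3\<^sup>2) y h \<le> total_kinetic"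
    by (rule rearrangement_kinetic_le_halfline_max[OF max, of y 3]) (use y(1) in \<open>auto intro: low\<close>)
  note k = decreasing_profileD(5)[OF h(1)]
  have "kinetic 4 4 0 h < kinetic 4 9 y h"
    using decreasing_profile_tail_kinetic_pos[OF h(1) y(1,2)]
    by (simp add: kinetic_eq[OF k y(1)] kinetic_eq[OF k order_refl])
  then show thesis using that[OF h(1)] h(2) by simp
qed

lemma in_H1_mass: "u \<in> H1_mass l total_mass"
  unfolding H1_mass_def total_mass_def
proof (intro CollectI conjI allI impI)
  fix i :: nat
  assume i: "i < 4"
  show "continuous_on (edge_dom l i) (u i)"
    by (rule has_L2_deriv_on_imp_continuous_on[OF edge_deriv[OF i] is_interval_edge_dom])
  show "H1_on (edge_dom l i) (u i)"
    by (rule has_L2_deriv_on_imp_H1_on[OF edge_L2[OF i] edge_deriv[OF i] is_interval_edge_dom])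
  show "u i 0 = u 0 0" by (rule vertex[OF i])
qed (rule refl)

lemma energy_eq_family_energy: "energy p l u = family_energy p"
proof -
  have "(\<Sum>i<4. sqnorm (edge_dom l i) (weak_deriv (edge_dom l i) (u i))) = total_kinetic"
    unfolding total_kinetic_def
    by (intro sum.cong refl sqnorm_weak_deriv edge_L2 edge_deriv) simp_all
  then show ?thesis by (simp add: energy_def family_energy_def total_powr_int_def)
qed

lemma star_graph_function_const_mult: "star_graph_function l (\<lambda>i x. c * u i x) (\<lambda>i x. c * g i x)"
proof
  show "c * u i 0 = c * u 0 0" if "i < 4" for i using vertex[OF that] by simp
qed (simp_all add: l_pos L2_on_const_mult edge_L2 has_L2_deriv_on_const_mult edge_deriv)

lemma lower_mass_competitor:
  assumes m: "0 < m" "m \<le> total_mass" and p: "0 < p"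
  obtains v where "v \<in> H1_mass l m"
    "energy p l v \<le> total_kinetic / 2 - (m / total_mass) powr (p / 2) * total_powr_int p / p"
proof -
  define c where "c = sqrt (m / total_mass)"
  have c: "0 \<le> c" "c\<^sup>2 = m / total_mass" "c\<^sup>2 \<le> 1" using m by (simp_all add: c_def)
  have cp: "c powr p = (m / total_mass) powr (p / 2)"
    using m by (simp add: c_def powr_half_sqrt[symmetric] powr_powr)
  interpret scaled: star_graph_function l "\<lambda>i x. c * u i x" "\<lambda>i x. c * g i x"
    by (rule star_graph_function_const_mult)
  have "scaled.total_mass = c\<^sup>2 * total_mass"
    by (simp add: scaled.total_mass_def total_mass_def sum_distrib_left power_mult_distrib)
  then have "scaled.total_mass = m" using m c(2) by simp
  moreover have "scaled.family_energy p = c\<^sup>2 * total_kinetic / 2 - c powr p * total_powr_int p / p"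
    unfolding scaled.family_energy_def scaled.total_kinetic_def total_kinetic_def
      scaled.total_powr_int_def total_powr_int_def
    using c(1) by (simp add: sqnorm_const_mult powr_int_const_mult flip: sum_distrib_left)
  moreover have "c\<^sup>2 * total_kinetic \<le> 1 * total_kinetic"
    using c(3) by (intro mult_right_mono) (simp_all add: total_kinetic_def sum_nonneg)
  ultimately show thesis
    using that[of "\<lambda>i x. c * u i x"] scaled.in_H1_mass scaled.energy_eq_family_energy[of p] cp by simp
qed

end

lemma H1_mass_imp_star_graph_function:
  assumes l: "0 < l" and u: "u \<in> H1_mass l \<mu>"
  obtains g where "star_graph_function l u g" "edge_family.total_mass {..<4} (edge_dom l) u = \<mu>"
proof
  have H1: "continuous_on (edge_dom l i) (u i)" "H1_on (edge_dom l i) (u i)" "u i 0 = u 0 0"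
    if "i < 4" for i
    using u that unfolding H1_mass_def by blast+
  show "star_graph_function l u (\<lambda>i. weak_deriv (edge_dom l i) (u i))"
  proof
    show "L2_on (edge_dom l i) (u i)" if "i < 4" for i using H1(2)[OF that] by (simp add: H1_on_def)
    show "has_L2_deriv_on (u i) (weak_deriv (edge_dom l i) (u i)) (edge_dom l i)" if "i < 4" for i
      by (rule H1_on_imp_has_L2_deriv_on_weak_deriv[OF H1(1,2)[OF that] is_interval_edge_dom])
  qed (fact l H1(3))+
  then interpret star_graph_function l u "\<lambda>i. weak_deriv (edge_dom l i) (u i)" .
  show "total_mass = \<mu>" using u by (simp add: total_mass_def H1_mass_def)
qed

section \<open>Competitors\<close>

lemma sum_star_graph:
  fixes F :: "nat \<Rightarrow> real"
  shows "(\<Sum>i<4. F i) = F 0 + F 1 + F 2 + F 3"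
  by (simp add: eval_nat_numeral)

lemma profile_on_star_graph:
  assumes f: "decreasing_profile f h" and l: "0 < l" and p: "2 \<le> p"
  obtains v where "v \<in> H1_mass l (mass f)" "energy p l v = weighted_energy p 1 9 l f h"
proof -
  define u where "u i x = (if i < 3 then f (l + 3 * x) else f (l + (-1) * x))" for i :: nat and x
  define g where "g i x = (if i < 3 then 3 * h (l + 3 * x) else (-1) * h (l + (-1) * x))"
    for i :: nat and x
  have tail: "{x. l + 3 * x \<in> {l..}} = {0..}" and segment: "{x. l + (-1) * x \<in> {0..l}} = {0..l}" by auto
  have L2: "L2_on {l..} f" "L2_on {0..l} f"
    by (rule L2_on_subset[OF decreasing_profileD(3)[OF f]]; use l in auto)+
  have deriv: "has_L2_deriv_on f h {l..}" "has_L2_deriv_on f h {0..l}"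
    by (rule has_L2_deriv_on_subset[OF decreasing_profileD(4)[OF f]]; use l in auto)+
  interpret star_graph_function l u g
  proof
    fix i :: nat assume "i < 4"
    then show "L2_on (edge_dom l i) (u i)" "has_L2_deriv_on (u i) (g i) (edge_dom l i)"
      using L2_on_affine[OF L2(1), of 3 l 1] L2_on_affine[OF L2(2), of "-1" l 1]
        has_L2_deriv_on_affine[OF deriv(1), of 3 1 l] has_L2_deriv_on_affine[OF deriv(2), of "-1" 1 l]
      unfolding tail segment u_def[abs_def] g_def[abs_def] edge_dom_def by auto
  qed (simp_all add: l u_def)
  have halfline: "(LINT x:{0..}|lborel. \<phi> (l + 3 * x)) = (LINT x:{l..}|lborel. \<phi> x) / 3"
    and terminal: "(LINT x:{0..l}|lborel. \<phi> (l + (-1) * x)) = (LINT x:{0..l}|lborel. \<phi> x)"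
    for \<phi> :: "real \<Rightarrow> real"
    using set_integral_affine(1)[of 3 l "{l..}" \<phi>] set_integral_affine(1)[of "-1" l "{0..l}" \<phi>]
    unfolding tail segment by simp_all
  note split = set_integral_Ici_split[OF _ less_imp_le[OF l]]
  have "total_mass = mass f"
    unfolding total_mass_def sum_star_graph
    using halfline[of "\<lambda>x. (f x)\<^sup>2"] terminal[of "\<lambda>x. (f x)\<^sup>2"]
      split[OF L2_onD(2)[OF decreasing_profileD(3)[OF f]]]
    by (simp add: u_def edge_dom_halfline)
  moreover have "total_kinetic = kinetic 1 9 l h"
    unfolding total_kinetic_def sum_star_graph
    using halfline[of "\<lambda>x. (h x)\<^sup>2"] terminal[of "\<lambda>x. (h x)\<^sup>2"]
    by (simp add: g_def edge_dom_halfline kinetic_def power_mult_distrib)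
  moreover have "total_powr_int p = powr_int p {0..} f"
    unfolding total_powr_int_def sum_star_graph
    using halfline[of "\<lambda>x. \<bar>f x\<bar> powr p"] terminal[of "\<lambda>x. \<bar>f x\<bar> powr p"]
      split[OF decreasing_profile_powr_integrable[OF f p]]
    by (simp add: u_def edge_dom_halfline)
  ultimately show thesis
    using that[of u] in_H1_mass energy_eq_family_energy[of p]
    by (simp add: family_energy_def weighted_energy_def)
qed

definition even_translate :: "real \<Rightarrow> (real \<Rightarrow> real) \<Rightarrow> real \<Rightarrow> real" where
  "even_translate b f x = f \<bar>2 * x - b\<bar>"

lemma even_translate_eq_If:
  "even_translate b f = (\<lambda>x. if x \<le> b / 2 then f (b + (-2) * x) else f (- b + 2 * x))"
proof
  fix x
  have "\<bar>2 * x - b\<bar> = (if x \<le> b / 2 then b + (-2) * x else - b + 2 * x)" by simp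
  then show "even_translate b f x = (if x \<le> b / 2 then f (b + (-2) * x) else f (- b + 2 * x))"
    by (simp add: even_translate_def)
qed

lemma
  assumes "0 \<le> b"
  shows L2_on_even_translate: "L2_on {0..} f \<Longrightarrow> L2_on {0..} (even_translate b f)"
    and has_L2_deriv_on_even_translate: "has_L2_deriv_on f h {0..} \<Longrightarrow>
      has_L2_deriv_on (even_translate b f)
          (\<lambda>x. (if x \<le> b / 2 then -2 else 2) * even_translate b h x) {0..}"
    and set_integral_even_translate: "set_integrable lborel {0..} \<phi> \<Longrightarrow>
      (LINT x:{0..}|lborel. even_translate b \<phi> x) =
          ((LINT x:{0..b}|lborel. \<phi> x) + (LINT x:{0..}|lborel. \<phi> x)) / 2"
proof -
  have left: "{x. b + (-2) * x \<in> {0..b}} = {0..b / 2}" and right: "{x. - b + 2 * x \<in> {0..}} = {b / 2..}"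
    by auto
  have sub: "{0..b} \<subseteq> {0..}" by auto
  show "L2_on {0..} (even_translate b f)" if f: "L2_on {0..} f"
    using L2_on_affine[OF L2_on_subset[OF f _ sub], of "-2" b 1] L2_on_affine[OF f, of 2 "- b" 1] assms
    unfolding left right even_translate_eq_If by (intro L2_on_Ici_If) simp_all
  show "has_L2_deriv_on (even_translate b f)
      (\<lambda>x. (if x \<le> b / 2 then -2 else 2) * even_translate b h x) {0..}"
    if f: "has_L2_deriv_on f h {0..}"
  proof -
    have "has_L2_deriv_on (even_translate b f)
        (\<lambda>x. if x \<le> b / 2 then (-2) * h (b + (-2) * x) else 2 * h (- b + 2 * x)) {0..}"
      using has_L2_deriv_on_affine[OF has_L2_deriv_on_subset[OF f sub], of "-2" 1 b]
        has_L2_deriv_on_affine[OF f, of 2 1 "- b"] assms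
      unfolding left right even_translate_eq_If by (intro has_L2_deriv_on_Ici_If) simp_all
    also have "(\<lambda>x. if x \<le> b / 2 then (-2) * h (b + (-2) * x) else 2 * h (- b + 2 * x))
        = (\<lambda>x. (if x \<le> b / 2 then -2 else 2) * even_translate b h x)"
      by (auto simp: even_translate_eq_If)
    finally show ?thesis .
  qed
  show "(LINT x:{0..}|lborel. even_translate b \<phi> x)
      = ((LINT x:{0..b}|lborel. \<phi> x) + (LINT x:{0..}|lborel. \<phi> x)) / 2"
    if \<phi>: "set_integrable lborel {0..} \<phi>"
    using set_integral_affine[of "-2" b "{0..b}" \<phi>] set_integral_affine[of 2 "- b" "{0..}" \<phi>]
      set_integrable_subset[OF \<phi> _ sub] \<phi> assms
    unfolding left right even_translate_eq_If
    by (subst set_integral_Ici_If) (simp_all add: add_divide_distrib)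
qed

lemma compactly_supported_profile_on_star_graph:
  assumes f: "decreasing_profile f h" and b: "0 \<le> b" "\<And>x. b \<le> x \<Longrightarrow> f x = 0" and l: "0 < l" and p: "2 \<le> p"
  obtains v where "v \<in> H1_mass l (mass f)" "energy p l v \<le> weighted_energy p 4 4 0 f h"
proof -
  define k where "k x = (if x \<le> b / 2 then -2 else 2) * even_translate b h x" for x
  define u where "u i = (if i = 0 then even_translate b f else (\<lambda>x. 0))" for i :: nat
  define g where "g i = (if i = 0 then k else (\<lambda>x. 0))" for i :: nat
  have zero: "L2_on A (\<lambda>x. 0)" for A
    by (simp add: L2_on_def set_borel_measurable_def set_integrable_def)
  interpret star_graph_function l u g
    using L2_on_even_translate[OF b(1) decreasing_profileD(3)[OF f]] b(2)[of b] b(1) l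
      has_L2_deriv_on_even_translate[OF b(1) decreasing_profileD(4)[OF f], folded k_def]
    by unfold_locales (auto simp: u_def g_def even_translate_def edge_dom_def zero has_L2_deriv_on_const)
  have support: "(LINT x:{0..b}|lborel. F (f x)) = (LINT x:{0..}|lborel. F (f x))" if "F 0 = 0"
    for F :: "real \<Rightarrow> real"
    unfolding set_lebesgue_integral_def using b(2) that
    by (intro Bochner_Integration.integral_cong) (auto split: split_indicator)
  note integral = set_integral_even_translate[OF b(1)]
  have "(even_translate b f x)\<^sup>2 = even_translate b (\<lambda>x. (f x)\<^sup>2) x" for x
    by (simp add: even_translate_def)
  then have "total_mass = mass f"
    using integral[OF L2_onD(2)[OF decreasing_profileD(3)[OF f]]] support[of "\<lambda>y. y\<^sup>2"]
    by (simp add: total_mass_def sum_star_graph u_def edge_dom_halfline)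
  moreover have "\<bar>even_translate b f x\<bar> powr p = even_translate b (\<lambda>x. \<bar>f x\<bar> powr p) x" for x
    by (simp add: even_translate_def)
  then have "total_powr_int p = powr_int p {0..} f"
    using integral[OF decreasing_profile_powr_integrable[OF f p]] support[of "\<lambda>y. \<bar>y\<bar> powr p"] p
    by (simp add: total_powr_int_def sum_star_graph u_def edge_dom_halfline)
  moreover have "(k x)\<^sup>2 = 4 * even_translate b (\<lambda>x. (h x)\<^sup>2) x" for x
    by (simp add: k_def even_translate_def power_mult_distrib)
  then have "total_kinetic = 2 * sqnorm {0..b} h + 2 * sqnorm {0..} h"
    using integral[OF L2_onD(2)[OF decreasing_profileD(5)[OF f]]]
    by (simp add: total_kinetic_def sum_star_graph g_def edge_dom_halfline)
  moreover have "sqnorm {0..b} h \<le> sqnorm {0..} h"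
    by (rule sqnorm_mono[OF decreasing_profileD(5)[OF f]]) auto
  ultimately show thesis
    using that[of u] in_H1_mass energy_eq_family_energy[of p]
      kinetic_eq[OF decreasing_profileD(5)[OF f], of 0 4 4]
    by (simp add: family_energy_def weighted_energy_def)
qed

definition truncate :: "real \<Rightarrow> (real \<Rightarrow> real) \<Rightarrow> real \<Rightarrow> real" where
  "truncate b f x = (if x \<le> b then f x - f b else 0)"

lemma
  assumes f: "decreasing_profile f g" and b: "0 \<le> b"
  shows decreasing_profile_truncate: "decreasing_profile (truncate b f) (\<lambda>x. if x \<le> b then g x else 0)"
    and mass_truncate_le: "mass (truncate b f) \<le> mass f"
    and kinetic_truncate_le: "0 \<le> \<alpha> \<Longrightarrow> 0 \<le> \<gamma> \<Longrightarrow> 0 \<le> l \<Longrightarrow>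
      kinetic \<alpha> \<gamma> l (\<lambda>x. if x \<le> b then g x else 0) \<le> kinetic \<alpha> \<gamma> l g"
proof -
  have sub: "{0..b} \<subseteq> {0..}" by auto
  note L2 = L2_on_subset[OF decreasing_profileD(3)[OF f] _ sub]
  have const: "L2_on {0..b} (\<lambda>x. f b)" by (rule L2_on_continuous_Icc) simp
  have zero: "L2_on {b..} (\<lambda>x. 0)"
    by (simp add: L2_on_def set_borel_measurable_def set_integrable_def)
  have "has_L2_deriv_on (\<lambda>x. f x - f b) g {0..b}"
    using has_L2_deriv_on_subset[OF decreasing_profileD(4)[OF f] sub] by (simp add: has_L2_deriv_on_def)
  then have deriv: "has_L2_deriv_on (truncate b f) (\<lambda>x. if x \<le> b then g x else 0) {0..}"
    unfolding truncate_def[abs_def] by (rule has_L2_deriv_on_Ici_If[OF _ has_L2_deriv_on_const b]) simp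
  have L2_truncate: "L2_on {0..} (truncate b f)"
    unfolding truncate_def[abs_def] by (rule L2_on_Ici_If[OF L2_on_diff[OF L2 const] zero b]) simp
  show profile: "decreasing_profile (truncate b f) (\<lambda>x. if x \<le> b then g x else 0)"
    unfolding decreasing_profile_def
    using decreasing_profileD(2)[OF f] deriv L2_truncate by (auto simp: truncate_def)
  have "(truncate b f x)\<^sup>2 \<le> (f x)\<^sup>2" if "0 \<le> x" for x
    using decreasing_profileD(1,2)[OF f] that b by (auto simp: truncate_def intro!: power_mono)
  then show "mass (truncate b f) \<le> mass f"
    by (intro set_integral_mono L2_onD(2) L2_truncate decreasing_profileD(3)[OF f]) simp
  show "kinetic \<alpha> \<gamma> l (\<lambda>x. if x \<le> b then g x else 0) \<le> kinetic \<alpha> \<gamma> l g"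
    if "0 \<le> \<alpha>" "0 \<le> \<gamma>" "0 \<le> l"
    unfolding kinetic_def using that
    by (intro add_mono mult_left_mono set_integral_mono L2_onD(2)
        L2_on_subset[OF decreasing_profileD(5)[OF profile]]
        L2_on_subset[OF decreasing_profileD(5)[OF f]]) auto
qed

lemma exists_truncation_energy_less:
  assumes f: "decreasing_profile f g" and less: "weighted_energy p \<alpha> \<gamma> l f g < e"
    and w: "0 \<le> \<alpha>" "0 \<le> \<gamma>" and l: "0 \<le> l" and p: "2 < p"
  obtains b where "0 \<le> b" "weighted_energy p \<alpha> \<gamma> l (truncate b f) (\<lambda>x. if x \<le> b then g x else 0) < e"
proof -
  have "(f \<longlongrightarrow> 0) at_top"
    by (rule L2_deriv_halfline_tendsto_0[OF decreasing_profileD(3,4)[OF f]])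
  then have "(\<lambda>n. f x - f (real n)) \<longlonglongrightarrow> f x - 0" for x
    by (intro tendsto_diff tendsto_const filterlim_compose[OF _ filterlim_real_sequentially])
  moreover have "\<forall>\<^sub>F n in sequentially. f x - f (real n) = truncate (real n) f x" for x
    using eventually_ge_at_top[of "nat \<lceil>x\<rceil>"] by eventually_elim (simp add: truncate_def)
  ultimately have lim: "(\<lambda>n. truncate (real n) f x) \<longlonglongrightarrow> f x" for x
    using Lim_transform_eventually by fastforce
  have profile: "decreasing_profile (truncate (real n) f) (\<lambda>x. if x \<le> real n then g x else 0)" for n
    by (rule decreasing_profile_truncate[OF f]) simp
  have sup: "truncate (real n) f 0 \<le> f 0" for n
    using decreasing_profileD(1)[OF f] by (simp add: truncate_def)
  have mass: "mass (truncate (real n) f) \<le> mass f" for n by (rule mass_truncate_le[OF f]) simp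
  have "(\<lambda>n. kinetic \<alpha> \<gamma> l g / 2 - powr_int p {0..} (truncate (real n) f) / p)
      \<longlonglongrightarrow> weighted_energy p \<alpha> \<gamma> l f g"
    unfolding weighted_energy_def using p
    by (intro tendsto_intros powr_int_profile_limit[OF profile sup mass lim]) auto
  then have "\<forall>\<^sub>F n in sequentially. kinetic \<alpha> \<gamma> l g / 2 - powr_int p {0..} (truncate (real n) f) / p < e"
    by (rule order_tendstoD(2)[OF _ less])
  then obtain n where n: "kinetic \<alpha> \<gamma> l g / 2 - powr_int p {0..} (truncate (real n) f) / p < e"
    by (auto simp: eventually_sequentially)
  have "kinetic \<alpha> \<gamma> l (\<lambda>x. if x \<le> real n then g x else 0) \<le> kinetic \<alpha> \<gamma> l g"
    by (rule kinetic_truncate_le[OF f _ w l]) simp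
  with n show thesis using that[of "real n"] by (simp add: weighted_energy_def)
qed

lemma (in subcritical) exists_competitor_below_line:
  assumes l: "0 < l" and e: "min_energy 4 4 0 < e"
  obtains v where "v \<in> H1_mass l \<mu>" "energy p l v < e"
proof -
  have "min_energy 4 4 0 < min 0 e" using e min_energy_neg[of 4 4 0] by simp
  then obtain f g where f: "decreasing_profile f g" "mass f = \<mu>" "weighted_energy p 4 4 0 f g < min 0 e"
    by (rule min_energy_less_witness[rotated 3]) simp_all
  obtain b where b: "0 \<le> b"
      "weighted_energy p 4 4 0 (truncate b f) (\<lambda>x. if x \<le> b then g x else 0) < min 0 e"
    using exists_truncation_energy_less[OF f(1,3)] p by auto
  obtain c where c: "0 \<le> c" "mass (\<lambda>x. c * truncate b f x) = \<mu>"
      "weighted_energy p 4 4 0 (\<lambda>x. c * truncate b f x) (\<lambda>x. c * (if x \<le> b then g x else 0))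
        \<le> weighted_energy p 4 4 0 (truncate b f) (\<lambda>x. if x \<le> b then g x else 0)"
    using weighted_energy_restore_mass[OF decreasing_profile_truncate[OF f(1) b(1)], of \<mu> 4 4 p 0]
      mass_truncate_le[OF f(1) b(1)] f(2) b(2) p by auto
  have zero: "c * truncate b f x = 0" if "b \<le> x" for x
    using that by (cases "x = b") (simp_all add: truncate_def)
  obtain v where "v \<in> H1_mass l \<mu>"
      "energy p l v
          \<le> weighted_energy p 4 4 0 (\<lambda>x. c * truncate b f x) (\<lambda>x. c * (if x \<le> b then g x else 0))"
    using compactly_supported_profile_on_star_graph
      [OF decreasing_profile_const_mult[OF decreasing_profile_truncate[OF f(1) b(1)] c(1)] b(1) zero
          l, of p]
      p c(2) by auto
  then show thesis using that[of v] b(2) c(3) by simp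
qed

section \<open>Functions vanishing at the vertex\<close>

lemma continuous_first_nonzero:
  fixes u :: "real \<Rightarrow> real"
  assumes cont: "continuous_on {a..} u" and "u a = 0" and x: "a \<le> x" "u x \<noteq> 0"
  obtains x\<^sub>1 where "a \<le> x\<^sub>1" "\<And>y. y \<in> {a..x\<^sub>1} \<Longrightarrow> u y = 0" "\<And>d. 0 < d \<Longrightarrow> \<exists>y\<in>{x\<^sub>1..x\<^sub>1 + d}. u y \<noteq> 0"
proof -
  define S where "S = {x. a \<le> x \<and> u x \<noteq> 0}"
  have S: "S \<noteq> {}" "bdd_below S" using x by (auto simp: S_def intro: bdd_belowI)
  have a: "a \<le> Inf S" by (rule cInf_greatest[OF S(1)]) (simp add: S_def)
  have before: "u y = 0" if "y \<in> {a..<Inf S}" for y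
  proof (rule ccontr)
    assume "u y \<noteq> 0"
    then have "Inf S \<le> y" using that by (intro cInf_lower S(2)) (simp add: S_def)
    then show False using that by simp
  qed
  have "u y = 0" if y: "y \<in> {a..Inf S}" for y
  proof (cases "a = Inf S")
    case False
    then have "closure {a..<Inf S} = {a..Inf S}" using a by simp
    then show ?thesis
      using continuous_constant_on_closure[of "{a..<Inf S}" u 0 y] before y
        continuous_on_subset[OF cont, of "{a..Inf S}"] by auto
  qed (use y \<open>u a = 0\<close> in simp)
  moreover have "\<exists>y\<in>{Inf S..Inf S + d}. u y \<noteq> 0" if d: "0 < d" for d
  proof -
    obtain y where "y \<in> S" "y < Inf S + d" using cInf_lessD[OF S(1), of "Inf S + d"] d by auto
    then show ?thesis using cInf_lower[OF _ S(2), of y] by (intro bexI[of _ y]) (auto simp: S_def)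
  qed
  ultimately show thesis using that a by blast
qed

lemma Poincare_inequality:
  assumes u: "has_L2_deriv_on u g {a..b}" and zero: "u a = 0" and ab: "a \<le> b"
  shows "y \<in> {a..b} \<Longrightarrow> (u y)\<^sup>2 \<le> (b - a) * sqnorm {a..b} g"
    and "sqnorm {a..b} u \<le> (b - a)\<^sup>2 * sqnorm {a..b} g"
proof -
  show bound: "(u y)\<^sup>2 \<le> (b - a) * sqnorm {a..b} g" if y: "y \<in> {a..b}" for y
  proof -
    have "(u y - u a)\<^sup>2 \<le> \<bar>y - a\<bar> * sqnorm {a..b} g"
      by (rule has_L2_deriv_on_Hoelder[OF u]) (use y ab in auto)
    also have "\<dots> \<le> (b - a) * sqnorm {a..b} g" using y by (intro mult_right_mono) auto
    finally show ?thesis by (simp add: zero)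
  qed
  have "continuous_on {a..b} u" by (rule has_L2_deriv_on_imp_continuous_on[OF u]) simp
  then have "sqnorm {a..b} u \<le> (b - a) * ((b - a) * sqnorm {a..b} g)"
    by (intro set_integral_le_const_mult_length L2_onD(2) L2_on_continuous_Icc ab bound)
  then show "sqnorm {a..b} u \<le> (b - a)\<^sup>2 * sqnorm {a..b} g" by (simp add: power2_eq_square ac_simps)
qed

definition stretch :: "real \<Rightarrow> real \<Rightarrow> (real \<Rightarrow> real) \<Rightarrow> real \<Rightarrow> real" where
  "stretch x a u y = (if y \<le> 2 * a then u (x + 1 / 2 * y) else u (x - a + 1 * y))"

lemma
  assumes "0 \<le> a"
  shows L2_on_stretch: "L2_on {x..} u \<Longrightarrow> L2_on {0..} (stretch x a u)"
    and has_L2_deriv_on_stretch: "has_L2_deriv_on u g {x..} \<Longrightarrow>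
      has_L2_deriv_on (stretch x a u) (\<lambda>y. (if y \<le> 2 * a then 1 / 2 else 1) * stretch x a g y) {0..}"
    and set_integral_stretch: "set_integrable lborel {x..} \<phi> \<Longrightarrow>
      (LINT y:{0..}|lborel. (if y \<le> 2 * a then c else 1) * stretch x a \<phi> y)
        = (LINT y:{x..}|lborel. \<phi> y) + (2 * c - 1) * (LINT y:{x..x + a}|lborel. \<phi> y)"
proof -
  have left: "{y. x + 1 / 2 * y \<in> {x..x + a}} = {0..2 * a}"
    and right: "{y. x - a + 1 * y \<in> {x + a..}} = {2 * a..}"
    by auto
  have sub: "{x..x + a} \<subseteq> {x..}" "{x + a..} \<subseteq> {x..}" using assms by auto
  show "L2_on {0..} (stretch x a u)" if u: "L2_on {x..} u"
    using L2_on_affine[OF L2_on_subset[OF u _ sub(1)], of "1 / 2" x 1]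
      L2_on_affine[OF L2_on_subset[OF u _ sub(2)], of 1 "x - a" 1] assms
    unfolding left right stretch_def[abs_def] by (intro L2_on_Ici_If) simp_all
  show "has_L2_deriv_on (stretch x a u) (\<lambda>y. (if y \<le> 2 * a then 1 / 2 else 1) * stretch x a g y) {0..}"
    if u: "has_L2_deriv_on u g {x..}"
  proof -
    have "has_L2_deriv_on (stretch x a u)
        (\<lambda>y. if y \<le> 2 * a then 1 / 2 * g (x + 1 / 2 * y) else g (x - a + 1 * y)) {0..}"
      using has_L2_deriv_on_affine[OF has_L2_deriv_on_subset[OF u sub(1)], of "1 / 2" 1 x]
        has_L2_deriv_on_affine[OF has_L2_deriv_on_subset[OF u sub(2)], of 1 1 "x - a"] assms
      unfolding left right stretch_def[abs_def]
      by (intro has_L2_deriv_on_Ici_If) (simp_all add: add.commute[of x a])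
    also have "(\<lambda>y. if y \<le> 2 * a then 1 / 2 * g (x + 1 / 2 * y) else g (x - a + 1 * y))
        = (\<lambda>y. (if y \<le> 2 * a then 1 / 2 else 1) * stretch x a g y)"
      by (auto simp: stretch_def)
    finally show ?thesis .
  qed
  show "(LINT y:{0..}|lborel. (if y \<le> 2 * a then c else 1) * stretch x a \<phi> y)
      = (LINT y:{x..}|lborel. \<phi> y) + (2 * c - 1) * (LINT y:{x..x + a}|lborel. \<phi> y)"
    if \<phi>: "set_integrable lborel {x..} \<phi>"
  proof -
    have "(\<lambda>y. (if y \<le> 2 * a then c else 1) * stretch x a \<phi> y)
        = (\<lambda>y. if y \<le> 2 * a then c * \<phi> (x + 1 / 2 * y) else \<phi> (x - a + 1 * y))"
      by (auto simp: stretch_def)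
    then show ?thesis
      using set_integral_affine[of "1 / 2" x "{x..x + a}" \<phi>]
        set_integral_affine[of 1 "x - a" "{x + a..}" \<phi>]
        set_integrable_subset[OF \<phi> _ sub(1)] set_integrable_subset[OF \<phi> _ sub(2)] assms
        set_integral_Ici_split[OF \<phi>, of "x + a"]
      unfolding left right by (simp add: set_integral_Ici_If algebra_simps)
  qed
qed

lemma
  assumes u: "L2_on {0..} u" "has_L2_deriv_on u g {0..}" and zero: "\<And>y. y \<in> {0..x} \<Longrightarrow> u y = 0"
    and x: "0 \<le> x" and a: "0 \<le> a"
  shows sqnorm_stretch: "sqnorm {0..} (stretch x a u) = sqnorm {0..} u + sqnorm {x..x + a} u"
    and powr_int_stretch_ge: "set_integrable lborel {0..} (\<lambda>x. \<bar>u x\<bar> powr p) \<Longrightarrow>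
      powr_int p {0..} u \<le> powr_int p {0..} (stretch x a u)"
    and sqnorm_stretch_deriv_le: "sqnorm {0..} (\<lambda>y. (if y \<le> 2 * a then 1 / 2 else 1) * stretch x a g y)
      \<le> sqnorm {0..} g - sqnorm {x..x + a} g / 2"
proof -
  have sub: "{x..} \<subseteq> {0..}" using x by auto
  note g = has_L2_deriv_onD(1)[OF u(2)]
  have vanish: "(LINT y:{0..}|lborel. F (u y)) = (LINT y:{x..}|lborel. F (u y))" if "F 0 = 0"
    for F :: "real \<Rightarrow> real"
    unfolding set_lebesgue_integral_def using x zero that
    by (intro Bochner_Integration.integral_cong) (auto split: split_indicator)
  show "sqnorm {0..} (stretch x a u) = sqnorm {0..} u + sqnorm {x..x + a} u"
    using set_integral_stretch[OF a L2_onD(2)[OF L2_on_subset[OF u(1) _ sub]], of 1] vanish[of "\<lambda>y. y\<^sup>2"]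
    by (simp add: stretch_def if_distrib[of "\<lambda>y. y\<^sup>2"])
  show "powr_int p {0..} u \<le> powr_int p {0..} (stretch x a u)"
    if int: "set_integrable lborel {0..} (\<lambda>x. \<bar>u x\<bar> powr p)"
    using set_integral_stretch[OF a set_integrable_subset[OF int _ sub], of 1]
      vanish[of "\<lambda>y. \<bar>y\<bar> powr p"]
      powr_int_nonneg[of "{x..x + a}" u p]
    by (simp add: stretch_def if_distrib[of "\<lambda>y. \<bar>y\<bar> powr p"])
  have "((if y \<le> 2 * a then 1 / 2 else 1) * stretch x a g y)\<^sup>2
      = (if y \<le> 2 * a then 1 / 4 else 1) * stretch x a (\<lambda>x. (g x)\<^sup>2) y" for y
    by (simp add: stretch_def power2_eq_square)
  then have "sqnorm {0..} (\<lambda>y. (if y \<le> 2 * a then 1 / 2 else 1) * stretch x a g y)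
      = sqnorm {x..} g - sqnorm {x..x + a} g / 2"
    using set_integral_stretch[OF a L2_onD(2)[OF L2_on_subset[OF g _ sub]], of "1 / 4"] by simp
  also have "sqnorm {x..} g \<le> sqnorm {0..} g" by (rule sqnorm_mono[OF g _ sub]) simp
  finally show "sqnorm {0..} (\<lambda>y. (if y \<le> 2 * a then 1 / 2 else 1) * stretch x a g y)
      \<le> sqnorm {0..} g - sqnorm {x..x + a} g / 2" by simp
qed

text \<open>Stretching a short piece adjacent to a zero by a factor two lowers the kinetic energy by a
  fixed fraction, while by the Poincare inequality the added mass is of second order in the length
  of the piece.\<close>

lemma stretch_next_to_zero:
  assumes u: "L2_on {0..} u" "has_L2_deriv_on u g {0..}" and zero: "u 0 = 0" and x: "0 \<le> x" "u x \<noteq> 0"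
    and a: "0 < a" and int: "set_integrable lborel {0..} (\<lambda>x. \<bar>u x\<bar> powr p)"
  obtains w k \<kappa> m where "L2_on {0..} w" "has_L2_deriv_on w k {0..}" "w 0 = 0"
    "0 < \<kappa>" "sqnorm {0..} k \<le> sqnorm {0..} g - \<kappa> / 2"
    "0 \<le> m" "m \<le> a\<^sup>2 * \<kappa>" "sqnorm {0..} w = sqnorm {0..} u + m" "powr_int p {0..} u \<le> powr_int p {0..} w"
proof -
  have "continuous_on {0..} u" by (rule has_L2_deriv_on_imp_continuous_on[OF u(2)]) simp
  then obtain x\<^sub>1 where x1: "0 \<le> x\<^sub>1" "\<And>y. y \<in> {0..x\<^sub>1} \<Longrightarrow> u y = 0" "\<And>d. 0 < d \<Longrightarrow> \<exists>y\<in>{x\<^sub>1..x\<^sub>1 + d}. u y \<noteq> 0"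
    by (rule continuous_first_nonzero[OF _ zero x]) auto
  have sub: "{x\<^sub>1..} \<subseteq> {0..}" "{x\<^sub>1..x\<^sub>1 + a} \<subseteq> {0..}" using x1(1) by auto
  have "has_L2_deriv_on u g {x\<^sub>1..x\<^sub>1 + a}" by (rule has_L2_deriv_on_subset[OF u(2) sub(2)]) simp
  note Poincare = Poincare_inequality[OF this x1(2)]
  have "sqnorm {x\<^sub>1..x\<^sub>1 + a} g \<noteq> 0"
  proof
    assume "sqnorm {x\<^sub>1..x\<^sub>1 + a} g = 0"
    then have "u y = 0" if "y \<in> {x\<^sub>1..x\<^sub>1 + a}" for y
      using Poincare(1)[OF _ _ that] x1(1) a by simp
    then show False using x1(3)[OF a] by blast
  qed
  then have pos: "0 < sqnorm {x\<^sub>1..x\<^sub>1 + a} g" using sqnorm_nonneg[of "{x\<^sub>1..x\<^sub>1 + a}" g] by linarith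
  show thesis
  proof (rule that)
    show "L2_on {0..} (stretch x\<^sub>1 a u)"
      using a by (intro L2_on_stretch L2_on_subset[OF u(1) _ sub(1)]) simp_all
    show "has_L2_deriv_on (stretch x\<^sub>1 a u) (\<lambda>y. (if y \<le> 2 * a then 1 / 2 else 1) * stretch x\<^sub>1 a g y) {0..}"
      using a by (intro has_L2_deriv_on_stretch has_L2_deriv_on_subset[OF u(2) sub(1)]) simp_all
    show "stretch x\<^sub>1 a u 0 = 0" using x1(1,2) a by (simp add: stretch_def)
    show "sqnorm {x\<^sub>1..x\<^sub>1 + a} u \<le> a\<^sup>2 * sqnorm {x\<^sub>1..x\<^sub>1 + a} g" using Poincare(2) x1(1) a by simp
  qed (use sqnorm_stretch[OF u x1(2)] powr_int_stretch_ge[OF u x1(2) _ _ int]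
      sqnorm_stretch_deriv_le[OF u x1(2)] x1(1) a pos in simp_all)
qed

lemma stretch_energy_less:
  fixes p m \<kappa> d K K' P P' a :: real
  assumes p: "2 < p" "p < 6" and m: "0 < m" "0 \<le> d" "d \<le> a\<^sup>2 * \<kappa>" and \<kappa>: "0 < \<kappa>" "K' \<le> K - \<kappa> / 2"
    and P: "0 \<le> P" "P \<le> P'" and small: "12 * P * a\<^sup>2 < p * m"
  shows "K' / 2 - (m / (m + d)) powr (p / 2) * P' / p < K / 2 - P / p"
proof -
  define y where "y = d / (m + d)"
  have y: "0 \<le> y" "y \<le> 1" "m / (m + d) = 1 - y" using m by (simp_all add: y_def field_simps)
  have "1 + real 3 * (- y) \<le> (1 + - y) ^ 3" using y by (intro Bernoulli_inequality) simp
  also have "\<dots> = (1 - y) powr 3" using y by (cases "y = 1") simp_all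
  also have "\<dots> \<le> (1 - y) powr (p / 2)" using y p by (intro powr_mono') auto
  finally have "(1 - 3 * y) * P \<le> (1 - y) powr (p / 2) * P" using P(1) by (intro mult_right_mono) auto
  also have "\<dots> \<le> (1 - y) powr (p / 2) * P'" using P(2) by (intro mult_left_mono) auto
  finally have "(1 - 3 * y) * P / p \<le> (1 - y) powr (p / 2) * P' / p" using p
    by (intro divide_right_mono) auto
  moreover have "3 * y * P / p < \<kappa> / 4"
  proof -
    have "y * m \<le> y * (m + d)" using y m by (intro mult_left_mono) auto
    also have "\<dots> = d" using m by (simp add: y_def)
    finally have "y * m \<le> a\<^sup>2 * \<kappa>" using m(3) by simp
    then have "12 * P * (y * m) \<le> 12 * P * (a\<^sup>2 * \<kappa>)" using P(1) by (intro mult_left_mono) auto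
    also have "\<dots> < p * m * \<kappa>" using mult_strict_right_mono[OF small \<kappa>(1)] by (simp add: ac_simps)
    finally have "m * (12 * P * y) < m * (p * \<kappa>)" by (simp add: ac_simps)
    then have "12 * P * y < p * \<kappa>" using m(1) by simp
    then show ?thesis using p by (simp add: field_simps)
  qed
  ultimately show ?thesis
    using \<kappa>(2) y(3) by (simp add: left_diff_distrib diff_divide_distrib)
qed

lemma sum_fun_upd:
  fixes F :: "'a \<Rightarrow> 'b \<Rightarrow> real"
  assumes "finite S" "j \<in> S"
  shows "(\<Sum>i\<in>S. F i ((u(j := w)) i)) = (\<Sum>i\<in>S. F i (u i)) - F j (u j) + F j w"
proof -
  have "(\<Sum>i\<in>S - {j}. F i ((u(j := w)) i)) = (\<Sum>i\<in>S - {j}. F i (u i))" by (intro sum.cong) auto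
  then show ?thesis
    using sum.remove[OF assms, of "\<lambda>i. F i ((u(j := w)) i)"]
      sum.remove[OF assms, of "\<lambda>i. F i (u i)"] by simp
qed

lemma exists_small_square:
  fixes b c :: real
  assumes "0 < b" "0 \<le> c"
  obtains a where "0 < a" "c * a\<^sup>2 < b"
proof -
  define a where "a = min 1 (b / (c + 1))"
  have a: "0 < a" "a \<le> 1" using assms by (simp_all add: a_def)
  have "c * a\<^sup>2 \<le> c * a"
    using a assms(2) by (intro mult_left_mono) (auto simp: power2_eq_square mult_left_le)
  also have "\<dots> < a * (c + 1)" using a by (simp add: algebra_simps)
  also have "\<dots> \<le> b"
    using assms by (subst pos_le_divide_eq[symmetric]) (auto simp: a_def)
  finally show thesis by (rule that[OF a(1)])
qed

lemma (in star_graph_function) better_competitor_if_vertex_0: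
  assumes p: "2 < p" "p < 6" and j: "j < 3" "0 \<le> x" "u j x \<noteq> 0" and zero: "u 0 0 = 0"
    and mass: "0 < total_mass"
  obtains v where "v \<in> H1_mass l total_mass" "energy p l v < energy p l u"
proof -
  define P where "P = total_powr_int p"
  have P: "0 \<le> P" by (simp add: P_def total_powr_int_def sum_nonneg)
  obtain a where a: "0 < a" and small: "12 * P * a\<^sup>2 < p * total_mass"
    using exists_small_square[of "p * total_mass" "12 * P"] p mass P by auto
  have j4: "j < 4" "j \<in> {..<4}" and I: "edge_dom l j = {0..}" using j(1)
    by (simp_all add: edge_dom_halfline)
  obtain w k \<kappa> d where w: "L2_on {0..} w" "has_L2_deriv_on w k {0..}" "w 0 = 0"
    "0 < \<kappa>" "sqnorm {0..} k \<le> sqnorm {0..} (g j) - \<kappa> / 2"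
    "0 \<le> d" "d \<le> a\<^sup>2 * \<kappa>" "sqnorm {0..} w = sqnorm {0..} (u j) + d"
        "powr_int p {0..} (u j) \<le> powr_int p {0..} w"
    by (rule stretch_next_to_zero[OF halfline_L2[OF j(1)] halfline_deriv[OF j(1)] _ j(2,3) a])
      (use powr_integrable[of p j] vertex[OF j4(1)] zero p j4 I in simp_all)
  interpret stretched: star_graph_function l "u(j := w)" "g(j := k)"
  proof
    show "(u(j := w)) i 0 = (u(j := w)) 0 0" if "i < 4" for i
      using vertex[OF that] zero w(3) by simp
  qed (use edge_L2 edge_deriv w(1,2) I l_pos in auto)
  have "stretched.total_mass = total_mass + d"
    unfolding stretched.total_mass_def total_mass_def
    using sum_fun_upd[OF _ j4(2), of "\<lambda>i. sqnorm (edge_dom l i)" u w] w(8) I by simp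
  moreover have "stretched.total_kinetic \<le> total_kinetic - \<kappa> / 2"
    unfolding stretched.total_kinetic_def total_kinetic_def
    using sum_fun_upd[OF _ j4(2), of "\<lambda>i. sqnorm (edge_dom l i)" g k] w(5) I by simp
  moreover have "P \<le> stretched.total_powr_int p"
    unfolding stretched.total_powr_int_def total_powr_int_def P_def
    using sum_fun_upd[OF _ j4(2), of "\<lambda>i. powr_int p (edge_dom l i)" u w] w(9) I by simp
  moreover obtain v where "v \<in> H1_mass l total_mass"
      "energy p l v \<le> stretched.total_kinetic / 2
        - (total_mass / stretched.total_mass) powr (p / 2) * stretched.total_powr_int p / p"
    using stretched.lower_mass_competitor[of total_mass p] mass w(6) p calculation(1) by auto
  ultimately show thesis
    using that[of v] stretch_energy_less[OF p mass w(6,7,4) _ P _ small] energy_eq_family_energy[of p]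
    by (fastforce simp: family_energy_def P_def)
qed

section \<open>Ground states\<close>

lemma (in star_graph_function) max_cases:
  obtains (terminal) h where "decreasing_profile rearrangement h" "kinetic 1 9 l h \<le> total_kinetic"
  | (halfline) j x where "max_on_halfline j x" "u j x \<noteq> 0"
proof -
  obtain j x where j: "j < 3" "0 \<le> x" "\<And>i y. i < 3 \<Longrightarrow> 0 \<le> y \<Longrightarrow> \<bar>u i y\<bar> \<le> \<bar>u j x\<bar>"
    using halfline_max by blast
  obtain x' where x': "x' \<in> {0..l}" "\<And>y. y \<in> {0..l} \<Longrightarrow> \<bar>u 3 y\<bar> \<le> \<bar>u 3 x'\<bar>"
    using terminal_max by blast
  show thesis
  proof (cases "\<bar>u j x\<bar> \<le> \<bar>u 3 x'\<bar>")
    case True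
    show thesis
      by (rule rearrangement_kinetic_le_terminal_max[OF j x' True]) (assumption | rule terminal)+
  next
    case False
    have "\<bar>u i y\<bar> \<le> \<bar>u j x\<bar>" if "i < 4" "y \<in> edge_dom l i" for i y
      using that(1) by (cases rule: less_4_cases)
        (use that(2) j(3)[of i y] x'(2)[of y] False in \<open>auto simp: edge_dom_halfline\<close>)
    then show thesis using j(1,2) False by (intro halfline) (auto simp: max_on_halfline_def)
  qed
qed

context subcritical
begin

lemma
  assumes l: "0 < l" and u: "u \<in> H1_mass l \<mu>"
  shows min_energy_le_energy: "min_energy 1 9 l \<le> energy p l u \<or> min_energy 4 4 0 \<le> energy p l u"
    and min_energy_less_ground_state_energy: "ground_state p l \<mu> u \<Longrightarrow>
      min_energy 1 9 l \<le> energy p l u \<or> min_energy 4 4 0 < energy p l u"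
proof -
  obtain g where "star_graph_function l u g" and mass: "edge_family.total_mass {..<4} (edge_dom l) u = \<mu>"
    by (rule H1_mass_imp_star_graph_function[OF l u])
  then interpret star_graph_function l u g by simp
  have bound: "min_energy \<alpha> \<gamma> y \<le> kinetic \<alpha> \<gamma> y h / 2 - total_powr_int p / p"
    if "decreasing_profile rearrangement h" "0 < \<alpha>" "0 < \<gamma>" "0 \<le> y" for h \<alpha> \<gamma> y
    using min_energy_le[OF that(2-4,1)] weighted_energy_rearrangement[of p] mass_rearrangement mass p
    by simp
  have E: "energy p l u = total_kinetic / 2 - total_powr_int p / p"
    by (simp add: energy_eq_family_energy family_energy_def)
  show "min_energy 1 9 l \<le> energy p l u \<or> min_energy 4 4 0 \<le> energy p l u"
  proof (cases rule: max_cases)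
    case (terminal h)
    then show ?thesis using bound[of h 1 9 l] l E by simp
  next
    case (halfline j x)
    then obtain h where "decreasing_profile rearrangement h" "kinetic 4 (2\<^sup>2) 0 h \<le> total_kinetic"
      using rearrangement_kinetic_le_halfline_max[of j x 0 2] crosses_below_rearrangement_0 by auto
    then show ?thesis using bound[of h 4 4 0] E by simp
  qed
  show "min_energy 1 9 l \<le> energy p l u \<or> min_energy 4 4 0 < energy p l u" if gs: "ground_state p l \<mu> u"
  proof (cases rule: max_cases)
    case (terminal h)
    then show ?thesis using bound[of h 1 9 l] l E by simp
  next
    case (halfline j x)
    have "u 0 0 \<noteq> 0"
    proof
      assume "u 0 0 = 0"
      then obtain v where "v \<in> H1_mass l \<mu>" "energy p l v < energy p l u"
        using better_competitor_if_vertex_0[OF p, of j x] halfline mass \<mu>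
        by (auto simp: max_on_halfline_def)
      with gs show False by (auto simp: ground_state_def)
    qed
    then obtain h where "decreasing_profile rearrangement h" "kinetic 4 4 0 h < total_kinetic"
      using rearrangement_kinetic_less_halfline_max[OF halfline(1)] mass \<mu> by auto
    then show ?thesis using bound[of h 4 4 0] E by simp
  qed
qed

lemma exists_ground_state_iff:
  assumes l: "0 < l"
  shows "(\<exists>u. ground_state p l \<mu> u) \<longleftrightarrow> min_energy 1 9 l \<le> min_energy 4 4 0"
proof
  assume "\<exists>u. ground_state p l \<mu> u"
  then obtain u where gs: "ground_state p l \<mu> u" by blast
  then have u: "u \<in> H1_mass l \<mu>" by (simp add: ground_state_def)
  have "energy p l u \<le> min_energy 4 4 0"
  proof (rule dense_ge)
    fix e assume "min_energy 4 4 0 < e"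
    then obtain v where "v \<in> H1_mass l \<mu>" "energy p l v < e" by (rule exists_competitor_below_line[OF l])
    then show "energy p l u \<le> e" using gs by (force simp: ground_state_def)
  qed
  then show "min_energy 1 9 l \<le> min_energy 4 4 0"
    using min_energy_less_ground_state_energy[OF l u gs] by linarith
next
  assume weighted_le: "min_energy 1 9 l \<le> min_energy 4 4 0"
  obtain f h where f: "decreasing_profile f h" "mass f = \<mu>"
      "weighted_energy p 1 9 l f h = min_energy 1 9 l"
    using min_energy_attained[of 1 9 l] l by auto
  then obtain u where "u \<in> H1_mass l \<mu>" "energy p l u = min_energy 1 9 l"
    using profile_on_star_graph[OF f(1) l, of p] p by auto
  then have "ground_state p l \<mu> u"
    using min_energy_le_energy[OF l] weighted_le by (fastforce simp: ground_state_def)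
  then show "\<exists>u. ground_state p l \<mu> u" by blast
qed

end

theorem theorem6p5:
  fixes p \<mu> :: real
  assumes "2 < p" and "p < 6" and "\<mu> > 0"
  shows "\<exists>l_star > 0. \<forall>l > 0. (\<exists>u. ground_state p l \<mu> u) \<longleftrightarrow> l \<ge> l_star"
proof -
  interpret subcritical p \<mu> by unfold_locales (fact assms)+
  show ?thesis using critical_length[of 1 4 9] exists_ground_state_iff by simp
qed

end
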